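(* Let $\Sigma$ be a closed Riemann surface of genus $g\ge2$, $n\ge3$, $0\not\equiv q_{n-1}\in H^0(\Sigma,K^{n-1})$, and for $t>0$ let $\phi_t=\tilde e_1+tq_{n-1}e_{n-2}$ and let $h_t$ be the Hermitian metric on $E$ solving the Hitchin equation $F_{A_t}+[\phi_t,\phi_t^{*_{h_t}}]=0$, where $A_t$ is the Chern connection of $h_t$. Then away from the zeros of $q_{n-1}$ (on compact subsets of the complement of the zeros) the Hitchin equation decouples as $t\to\infty$: both terms tend to zero, $$F_{A_t}\to0\qquad\text{and}\qquad[\phi_t,\phi_t^{*_{h_t}}]\to0.$$
   Context: $K$ is the canonical bundle of $\Sigma$, $K^{1/2}$ a fixed square root, $E=\bigoplus_{j=1}^nK^{\frac{n+1-2j}2}$. The Higgs field $\phi_t:E\to E\otimes K$ is the matrix with $(i+1,i)$ entries $1$ ($1\le i\le n-1$), entries $tq_{n-1}$ in positions $(1,n-1)$ and $(2,n)$, zeros elsewhere. $(E,\phi_t)$ is stable, so $h_t$ (inducing the trivial metric on $\det E=\mathcal O$) exists and is unique; it is diagonal with respect to the decomposition of $E$, so $F_{A_t}$ and hence $[\phi_t,\phi_t^{*_{h_t}}]=-F_{A_t}$ are diagonal matrices of $2$-forms, and convergence to zero means convergence of these diagonal entries. *)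

theory Defs
  imports
    "HOL-Complex_Analysis.Complex_Analysis"
    "HOL-Homology.Homology"
    "Jordan_Normal_Form.Determinant"
    "Jordan_Normal_Form.Gauss_Jordan_Elimination"
    "Jordan_Normal_Form.Schur_Decomposition"
begin

section \<open>Closed Riemann surfaces\<close>

text \<open>A chart is a pair of a domain \<open>U\<close> and a coordinate \<open>z\<close>; the values of \<open>z\<close> off \<open>U\<close> are irrelevant.\<close>

type_synonym 'a chart = "'a set \<times> ('a \<Rightarrow> complex)"

abbreviation chart_dom :: "'a chart \<Rightarrow> 'a set" where
  "chart_dom c \<equiv> fst c"

abbreviation coord :: "'a chart \<Rightarrow> 'a \<Rightarrow> complex" where
  "coord c \<equiv> snd c"

definition chart_inv :: "'a chart \<Rightarrow> complex \<Rightarrow> 'a" where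
  "chart_inv c = inv_into (chart_dom c) (coord c)"

definition is_chart :: "'a::topological_space chart \<Rightarrow> bool" where
  "is_chart c \<longleftrightarrow> open (chart_dom c) \<and> open (coord c ` chart_dom c) \<and>
     homeomorphism (chart_dom c) (coord c ` chart_dom c) (coord c) (chart_inv c)"

definition riemann_surface :: "'a::t2_space chart set \<Rightarrow> bool" where
  "riemann_surface A \<longleftrightarrow>
     connected (UNIV :: 'a set) \<and>
     (\<Union>c\<in>A. chart_dom c) = UNIV \<and>
     (\<forall>c\<in>A. is_chart c) \<and>
     (\<forall>c\<in>A. \<forall>d\<in>A.
        (\<lambda>u. coord d (chart_inv c u)) holomorphic_on coord c ` (chart_dom c \<inter> chart_dom d))"

text \<open>Second countability is automatic for a compact surface.\<close>

definition closed_riemann_surface :: "'a::t2_space chart set \<Rightarrow> bool" where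
  "closed_riemann_surface A \<longleftrightarrow> riemann_surface A \<and> compact (UNIV :: 'a set)"

text \<open>For a closed oriented surface, \<open>H\<^sub>1\<close> with integer coefficients is free of rank \<open>2 g\<close>.\<close>

definition has_genus :: "'a topology \<Rightarrow> nat \<Rightarrow> bool" where
  "has_genus X g \<longleftrightarrow> homology_group 1 X \<cong> free_Abelian_group {..<2 * g}"


section \<open>Powers of the canonical bundle and of its square root\<close>

text \<open>The derivative \<open>dw/dz\<close> at a point, where \<open>z\<close>, \<open>w\<close> are the coordinates of \<open>c\<close>, \<open>d\<close>.
  The canonical bundle has the frame \<open>dz\<close> over each chart, and \<open>dw = (dw/dz) dz\<close> on overlaps.\<close>

definition chart_deriv :: "'a chart \<Rightarrow> 'a chart \<Rightarrow> 'a \<Rightarrow> complex" where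
  "chart_deriv c d p = deriv (\<lambda>u. coord d (chart_inv c u)) (coord c p)"

text \<open>A square root of the canonical bundle is given by frames \<open>s\<^sub>c\<close> over the charts whose squares
  are the frames \<open>dz\<close> of the canonical bundle; here \<open>S c d\<close> is the transition function with
  \<open>s\<^sub>d = S c d \<cdot> s\<^sub>c\<close>. Every holomorphic square root is of this form for
  an atlas of simply connected charts, since there \<open>dz\<close> has a square root.\<close>

definition canonical_square_root ::
    "'a::t2_space chart set \<Rightarrow> ('a chart \<Rightarrow> 'a chart \<Rightarrow> 'a \<Rightarrow> complex) \<Rightarrow> bool" where
  "canonical_square_root A S \<longleftrightarrow>
     (\<forall>c\<in>A. \<forall>d\<in>A.
        (\<lambda>u. S c d (chart_inv c u)) holomorphic_on coord c ` (chart_dom c \<inter> chart_dom d) \<and>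
        (\<forall>p \<in> chart_dom c \<inter> chart_dom d. (S c d p)\<^sup>2 = chart_deriv c d p)) \<and>
     (\<forall>c\<in>A. \<forall>d\<in>A. \<forall>e\<in>A. \<forall>p \<in> chart_dom c \<inter> chart_dom d \<inter> chart_dom e.
        S c e p = S c d p * S d e p)"

text \<open>A holomorphic section of the \<open>m\<close>-th power of the canonical bundle is \<open>q c \<cdot> dz\<^sup>m\<close> over the
  chart \<open>c\<close> with coordinate \<open>z\<close>.\<close>

definition holomorphic_differential ::
    "'a::t2_space chart set \<Rightarrow> nat \<Rightarrow> ('a chart \<Rightarrow> 'a \<Rightarrow> complex) \<Rightarrow> bool" where
  "holomorphic_differential A m q \<longleftrightarrow>
     (\<forall>c\<in>A. (\<lambda>u. q c (chart_inv c u)) holomorphic_on coord c ` chart_dom c) \<and>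
     (\<forall>c\<in>A. \<forall>d\<in>A. \<forall>p \<in> chart_dom c \<inter> chart_dom d. q c p = q d p * chart_deriv c d p ^ m)"

definition differential_zeros ::
    "'a chart set \<Rightarrow> ('a chart \<Rightarrow> 'a \<Rightarrow> complex) \<Rightarrow> 'a set" where
  "differential_zeros A q = {p. \<exists>c\<in>A. p \<in> chart_dom c \<and> q c p = 0}"


section \<open>Smooth functions and Wirtinger derivatives\<close>

definition deriv_x :: "(complex \<Rightarrow> complex) \<Rightarrow> complex \<Rightarrow> complex" where
  "deriv_x f u = frechet_derivative f (at u) 1"

definition deriv_y :: "(complex \<Rightarrow> complex) \<Rightarrow> complex \<Rightarrow> complex" where
  "deriv_y f u = frechet_derivative f (at u) \<i>"

text \<open>Differentiability is over the reals throughout.\<close>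

primrec Ck_on :: "nat \<Rightarrow> complex set \<Rightarrow> (complex \<Rightarrow> complex) \<Rightarrow> bool" where
  "Ck_on 0 W f \<longleftrightarrow> continuous_on W f"
| "Ck_on (Suc k) W f \<longleftrightarrow>
     (\<forall>u\<in>W. f differentiable (at u)) \<and> Ck_on k W (deriv_x f) \<and> Ck_on k W (deriv_y f)"

definition smooth_on :: "complex set \<Rightarrow> (complex \<Rightarrow> complex) \<Rightarrow> bool" where
  "smooth_on W f \<longleftrightarrow> (\<forall>k. Ck_on k W f)"

definition deriv_z :: "(complex \<Rightarrow> complex) \<Rightarrow> complex \<Rightarrow> complex" where
  "deriv_z f u = (deriv_x f u - \<i> * deriv_y f u) / 2"

definition deriv_zbar :: "(complex \<Rightarrow> complex) \<Rightarrow> complex \<Rightarrow> complex" where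
  "deriv_zbar f u = (deriv_x f u + \<i> * deriv_y f u) / 2"

definition mat_deriv_z :: "nat \<Rightarrow> (complex \<Rightarrow> complex mat) \<Rightarrow> complex \<Rightarrow> complex mat" where
  "mat_deriv_z n M u = Matrix.mat n n (\<lambda>(i, j). deriv_z (\<lambda>v. M v $$ (i, j)) u)"

definition mat_deriv_zbar :: "nat \<Rightarrow> (complex \<Rightarrow> complex mat) \<Rightarrow> complex \<Rightarrow> complex mat" where
  "mat_deriv_zbar n M u = Matrix.mat n n (\<lambda>(i, j). deriv_zbar (\<lambda>v. M v $$ (i, j)) u)"


section \<open>Hermitian metrics on \<open>E\<close>\<close>

text \<open>Matrix indices start at \<open>0\<close>. The summand of \<open>E\<close> with index \<open>j\<close> is the power of
  \<open>K\<^sup>1\<^sup>/\<^sup>2\<close> with exponent \<open>summand_weight n j\<close>, which is \<open>n + 1 - 2 (j + 1)\<close>, so over the chart \<open>c\<close> the bundle \<open>E\<close>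
  has the frame \<open>e\<^sub>j\<close>, where \<open>e\<^sub>j\<close> is that power of \<open>s\<^sub>c\<close>.\<close>

definition summand_weight :: "nat \<Rightarrow> nat \<Rightarrow> int" where
  "summand_weight n j = int n - 1 - 2 * int j"

text \<open>Positivity only looks at the real part because the quadratic form of a Hermitian matrix is real.\<close>

definition pos_def_hermitian :: "nat \<Rightarrow> complex mat \<Rightarrow> bool" where
  "pos_def_hermitian n H \<longleftrightarrow>
     H \<in> carrier_mat n n \<and> mat_adjoint H = H \<and>
     (\<forall>v \<in> carrier_vec n. v \<noteq> 0\<^sub>v n \<longrightarrow> Re ((H *\<^sub>v v) \<bullet>c v) > 0)"

text \<open>Over the chart \<open>c\<close> a metric \<open>h\<close> on \<open>E\<close> is represented by the Gram matrix
  with entry \<open>h(e\<^sub>j, e\<^sub>i)\<close> in position \<open>(i, j)\<close>, where \<open>h\<close> is linear in the first argument.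
  In coordinates, \<open>h(u, v)\<close> is then the conjugate transpose of \<open>v\<close> times the Gram matrix times \<open>u\<close>.\<close>

definition hermitian_metric ::
    "'a::t2_space chart set \<Rightarrow> ('a chart \<Rightarrow> 'a chart \<Rightarrow> 'a \<Rightarrow> complex) \<Rightarrow> nat \<Rightarrow>
     ('a chart \<Rightarrow> 'a \<Rightarrow> complex mat) \<Rightarrow> bool" where
  "hermitian_metric A S n h \<longleftrightarrow>
     (\<forall>c\<in>A. \<forall>p \<in> chart_dom c. pos_def_hermitian n (h c p)) \<and>
     (\<forall>c\<in>A. \<forall>i<n. \<forall>j<n.
        smooth_on (coord c ` chart_dom c) (\<lambda>u. h c (chart_inv c u) $$ (i, j))) \<and>
     (\<forall>c\<in>A. \<forall>d\<in>A. \<forall>p \<in> chart_dom c \<inter> chart_dom d. \<forall>i<n. \<forall>j<n.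
        h d p $$ (i, j) =
          cnj (S c d p powi summand_weight n i) * h c p $$ (i, j) * S c d p powi summand_weight n j)"

text \<open>The weights of the summands add up to \<open>0\<close>, so \<open>e\<^sub>0 \<and> \<dots> \<and> e\<^sub>n\<^sub>-\<^sub>1\<close> is the
  canonical global frame of \<open>det E = \<O>\<close>, and its square length is the determinant of the Gram matrix.\<close>

definition induces_trivial_det_metric ::
    "'a chart set \<Rightarrow> ('a chart \<Rightarrow> 'a \<Rightarrow> complex mat) \<Rightarrow> bool" where
  "induces_trivial_det_metric A h \<longleftrightarrow> (\<forall>c\<in>A. \<forall>p \<in> chart_dom c. Determinant.det (h c p) = 1)"


section \<open>The Hitchin equation\<close>

text \<open>An \<open>End E\<close>-valued two-form is represented over a chart by its coefficient of
  \<open>dz \<and> dzbar\<close>, a matrix in the frame \<open>e\<^sub>j\<close>. In a holomorphic frame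
  with Gram matrix \<open>H\<close> (in the above convention) the Chern connection is \<open>d + H\<^sup>-\<^sup>1 \<partial>H\<close>,
  with curvature \<open>\<partial>bar (H\<^sup>-\<^sup>1 \<partial>H)\<close>. The sign in \<open>chern_curvature\<close> comes from
  \<open>dzbar \<and> dz = - dz \<and> dzbar\<close>.\<close>

definition chern_connection_form ::
    "nat \<Rightarrow> (complex \<Rightarrow> complex mat) \<Rightarrow> complex \<Rightarrow> complex mat" where
  "chern_connection_form n H u = the (mat_inverse (H u)) * mat_deriv_z n H u"

definition chern_curvature ::
    "nat \<Rightarrow> ('a chart \<Rightarrow> 'a \<Rightarrow> complex mat) \<Rightarrow> 'a chart \<Rightarrow> 'a \<Rightarrow> complex mat" where
  "chern_curvature n h c p =
     - mat_deriv_zbar n (chern_connection_form n (\<lambda>u. h c (chart_inv c u))) (coord c p)"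

text \<open>\<open>higgs_field n t q c p\<close> is the coefficient of \<open>dz\<close> of the Higgs field \<open>\<phi>\<^sub>t\<close>.\<close>

definition higgs_field ::
    "nat \<Rightarrow> real \<Rightarrow> ('a chart \<Rightarrow> 'a \<Rightarrow> complex) \<Rightarrow> 'a chart \<Rightarrow> 'a \<Rightarrow> complex mat" where
  "higgs_field n t q c p = Matrix.mat n n (\<lambda>(i, j).
     if i = j + 1 then 1
     else if (i, j) = (0, n - 2) \<or> (i, j) = (1, n - 1) then of_real t * q c p
     else 0)"

text \<open>The adjoint of the matrix \<open>P\<close> with respect to the metric with Gram matrix \<open>H\<close>.\<close>

definition metric_adjoint :: "complex mat \<Rightarrow> complex mat \<Rightarrow> complex mat" where
  "metric_adjoint H P = the (mat_inverse H) * mat_adjoint P * H"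

text \<open>For \<open>\<phi> = P dz\<close> the adjoint is the metric adjoint of \<open>P\<close> times \<open>dzbar\<close>, and the graded commutator
  \<open>\<phi> \<and> \<phi>\<^sup>* + \<phi>\<^sup>* \<and> \<phi>\<close> is the matrix commutator times \<open>dz \<and> dzbar\<close>.\<close>

definition higgs_commutator ::
    "('a chart \<Rightarrow> 'a \<Rightarrow> complex mat) \<Rightarrow> ('a chart \<Rightarrow> 'a \<Rightarrow> complex mat) \<Rightarrow>
     'a chart \<Rightarrow> 'a \<Rightarrow> complex mat" where
  "higgs_commutator \<phi> h c p =
     \<phi> c p * metric_adjoint (h c p) (\<phi> c p) - metric_adjoint (h c p) (\<phi> c p) * \<phi> c p"

definition hitchin_equation ::
    "'a chart set \<Rightarrow> nat \<Rightarrow> ('a chart \<Rightarrow> 'a \<Rightarrow> complex mat) \<Rightarrow>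
     ('a chart \<Rightarrow> 'a \<Rightarrow> complex mat) \<Rightarrow> bool" where
  "hitchin_equation A n \<phi> h \<longleftrightarrow>
     (\<forall>c\<in>A. \<forall>p \<in> chart_dom c. chern_curvature n h c p + higgs_commutator \<phi> h c p = 0\<^sub>m n n)"

text \<open>Convergence to zero of \<open>End E\<close>-valued two-forms, uniformly on compact subsets of \<open>W\<close>.
  Coefficients in different charts differ by factors that are bounded on compact subsets of the
  overlap, and a compact subset of \<open>W\<close> is a finite union of compact subsets of chart domains.\<close>

definition forms_tend_to_zero_on ::
    "'a::t2_space chart set \<Rightarrow> nat \<Rightarrow> 'a set \<Rightarrow> (real \<Rightarrow> 'a chart \<Rightarrow> 'a \<Rightarrow> complex mat) \<Rightarrow> bool" where
  "forms_tend_to_zero_on A n W \<omega> \<longleftrightarrow>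
     (\<forall>c\<in>A. \<forall>C. compact C \<and> C \<subseteq> chart_dom c \<inter> W \<longrightarrow>
        (\<forall>i<n. \<forall>j<n. uniform_limit C (\<lambda>t p. \<omega> t c p $$ (i, j)) (\<lambda>p. 0) at_top))"

end

theory Submission
  imports Defs "HOL-Library.Function_Algebras" "HOL-Real_Asymp.Real_Asymp"
begin

text \<open>The statement speaks of arbitrary solutions \<open>h t\<close>, so their symmetry has to
  be extracted from the equation itself. Duality reverses products; \<open>sharp n z H\<close>
  therefore behaves like an inverse Gram matrix, and the trace comparing two metrics is polynomial
  in the entries of \<open>H\<close>. A constant trace makes the connection form and the adjoint of
  the Higgs field symmetric, but it does not diagonalise \<open>H\<close>: since
  \<open>z ^ (n - 1) = 1\<close>, the indices 0 and \<open>n - 1\<close> carry the same phase, and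
  the metric might still pair the first summand with the last. This corner entry is treated
  algebraically in \<open>corner_block\<close>. The factor 2 in \<open>ell\<close> comes from the
  characteristic polynomial x^n - 2 t q x of the Higgs field: its nonzero roots share one modulus,
  which \<open>ell\<close> scales to 1. The defect is then the excess of a sum of
  \<open>n - 1\<close> positive numbers with product 1 over its minimum \<open>n - 1\<close>.
  Consecutive numbers differ by entries of the commutator, so the defect is small where the
  commutator is small and, conversely, bounds it.\<close>

text \<open>
  Two symmetries fix the Higgs field up to a unit factor: the diagonal gauge transformation with entries
  \<open>z\<^sup>j\<close>, \<open>z\<^sup>n\<^sup>-\<^sup>1 = 1\<close>, and the duality given by the antidiagonal pairing on \<open>E\<close>. The trace comparing \<open>h\<close>
  with its image under a combination of the two is subharmonic by a Bochner formula, hence constant on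
  the closed surface, so the Chern connection and the adjoint of \<open>\<phi>\<close> inherit the symmetries. In particular
  the connection form and the curvature are diagonal.

  The rest is local, away from the zeros of \<open>q\<close>. The nonzero entries \<open>X\<close>, \<open>Y\<close> of \<open>\<phi>\<close> times its adjoint are
  positive and satisfy a Toda system. Let \<open>ell\<close> be the function \<open>\<bar>2 t q\<bar>\<close> to the power \<open>-2 / (n - 1)\<close>, whose
  logarithm is harmonic. The defect \<open>k = ell \<bar>\<phi>\<bar>\<^sup>2 - (n - 1)\<close>, which measures the failure of \<open>\<phi>\<close> to be normal, is
  nonnegative, and its Laplacian is at least a constant times both \<open>k / ell\<close> and \<open>k\<^sup>2 / ell\<close>. The quadratic
  bound makes \<open>k\<close> bounded (Keller and Osserman), the linear one then makes it decay exponentially in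
  \<open>t\<close> to the power \<open>1 / (n - 1)\<close>, which beats the polynomial growth of the factor \<open>1 / ell\<close> in the commutator.
\<close>

section \<open>Wirtinger derivatives\<close>

text \<open>One real derivative carries both Wirtinger derivatives, \<open>a\<close> in z and
  \<open>b\<close> in its conjugate, so the calculus rules are inherited from
  \<open>has_derivative\<close>.\<close>

definition has_wirt :: "(complex \<Rightarrow> complex) \<Rightarrow> complex \<Rightarrow> complex \<Rightarrow> complex \<Rightarrow> bool" where
  "has_wirt f a b u \<longleftrightarrow> (f has_derivative (\<lambda>h. a * h + b * cnj h)) (at u)"

lemma has_wirt_const [intro]: "has_wirt (\<lambda>_. c) 0 0 u"
  by (simp add: has_wirt_def)

lemma has_wirt_cong:
  assumes "has_wirt f a b u" "open W" "u \<in> W" "\<And>v. v \<in> W \<Longrightarrow> f v = g v"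
  shows "has_wirt g a b u"
  using has_derivative_transform_within_open[OF assms(1)[unfolded has_wirt_def] assms(2,3,4)]
  unfolding has_wirt_def .

lemma has_wirt_add:
  assumes "has_wirt f a b u" "has_wirt g a' b' u"
  shows "has_wirt (\<lambda>v. f v + g v) (a + a') (b + b') u"
  using has_derivative_add[OF assms[unfolded has_wirt_def]]
  unfolding has_wirt_def by (simp add: algebra_simps)

lemma has_wirt_diff:
  assumes "has_wirt f a b u" "has_wirt g a' b' u"
  shows "has_wirt (\<lambda>v. f v - g v) (a - a') (b - b') u"
  using has_derivative_diff[OF assms[unfolded has_wirt_def]]
  unfolding has_wirt_def by (simp add: algebra_simps)

lemma has_wirt_mult:
  assumes "has_wirt f a b u" "has_wirt g a' b' u"
  shows "has_wirt (\<lambda>v. f v * g v) (a * g u + f u * a') (b * g u + f u * b') u"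
  using has_derivative_mult[OF assms[unfolded has_wirt_def]]
  unfolding has_wirt_def by (simp add: algebra_simps)

lemma has_wirt_cmult:
  assumes "has_wirt f a b u"
  shows "has_wirt (\<lambda>v. c * f v) (c * a) (c * b) u"
  using has_wirt_mult[OF has_wirt_const assms, of c] by simp

lemma has_wirt_cnj:
  assumes "has_wirt f a b u"
  shows "has_wirt (\<lambda>v. cnj (f v)) (cnj b) (cnj a) u"
  using has_derivative_cnj[OF assms[unfolded has_wirt_def]]
  unfolding has_wirt_def by (simp add: algebra_simps)

lemma has_wirt_sum:
  assumes "\<And>k. k \<in> K \<Longrightarrow> has_wirt (f k) (a k) (b k) u"
  shows "has_wirt (\<lambda>v. \<Sum>k\<in>K. f k v) (\<Sum>k\<in>K. a k) (\<Sum>k\<in>K. b k) u"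
  using has_derivative_sum[OF assms[unfolded has_wirt_def], of K "\<lambda>x. x"]
  unfolding has_wirt_def by (simp add: sum.distrib sum_distrib_right)

lemma has_wirt_unique:
  assumes "has_wirt f a b u" "has_wirt f a' b' u"
  shows "a = a'" "b = b'"
proof -
  have eq: "(\<lambda>h. a * h + b * cnj h) = (\<lambda>h. a' * h + b' * cnj h)"
    using assms unfolding has_wirt_def by (rule has_derivative_unique)
  from fun_cong[OF eq, of 1] fun_cong[OF eq, of \<i>]
  have 1: "a + b = a' + b'" and "\<i> * (a - b) = \<i> * (a' - b')"
    by (simp_all add: algebra_simps)
  then have "a - b = a' - b'" by simp
  from arg_cong2[where f = "(+)", OF 1 this] have "2 * a = 2 * a'" by simp
  then show "a = a'" by simp
  with 1 show "b = b'" by simp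
qed

lemma has_wirt_holomorphic:
  assumes "f holomorphic_on W" "open W" "u \<in> W"
  shows "has_wirt f (deriv f u) 0 u"
  using holomorphic_derivI[OF assms] unfolding has_wirt_def
  by (simp add: has_field_derivative_def)

lemma real_linear_conv_wirt:
  fixes X Y h :: complex
  shows "Re h *\<^sub>R X + Im h *\<^sub>R Y = (X - \<i> * Y) / 2 * h + (X + \<i> * Y) / 2 * cnj h"
  by (simp add: complex_eq_iff field_simps)

lemma differentiable_has_wirt:
  assumes "f differentiable (at u)"
  shows "has_wirt f (deriv_z f u) (deriv_zbar f u) u"
proof -
  let ?D = "frechet_derivative f (at u)"
  have D: "(f has_derivative ?D) (at u)"
    using assms by (simp add: frechet_derivative_works)
  have lin: "linear ?D"
    using D by (rule has_derivative_linear)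
  have "?D h = deriv_z f u * h + deriv_zbar f u * cnj h" for h
  proof -
    have "h = Re h *\<^sub>R 1 + Im h *\<^sub>R \<i>" by (simp add: complex_eq_iff)
    then have "?D h = ?D (Re h *\<^sub>R 1 + Im h *\<^sub>R \<i>)" by simp
    also have "\<dots> = Re h *\<^sub>R ?D 1 + Im h *\<^sub>R ?D \<i>"
      by (simp only: linear_add[OF lin] linear_scale[OF lin])
    also have "\<dots> = deriv_z f u * h + deriv_zbar f u * cnj h"
      unfolding deriv_z_def deriv_zbar_def deriv_x_def deriv_y_def by (rule real_linear_conv_wirt)
    finally show ?thesis .
  qed
  then have "?D = (\<lambda>h. deriv_z f u * h + deriv_zbar f u * cnj h)" by (rule ext)
  with D show ?thesis unfolding has_wirt_def by simp
qed

lemma has_wirt_deriv: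
  assumes "has_wirt f a b u"
  shows "f differentiable (at u)" "deriv_z f u = a" "deriv_zbar f u = b"
proof -
  show d: "f differentiable (at u)"
    using assms unfolding has_wirt_def differentiable_def by blast
  show "deriv_z f u = a" "deriv_zbar f u = b"
    using has_wirt_unique[OF differentiable_has_wirt[OF d] assms] by auto
qed

section \<open>Subharmonic functions\<close>

text \<open>\<open>G\<close> is the Wirtinger derivative \<open>\<partial>f\<close> of the real function \<open>f\<close>, and \<open>L\<close> is \<open>\<partial>bar \<partial>f\<close>, a quarter of the Laplacian.\<close>

definition has_lap :: "complex set \<Rightarrow> (complex \<Rightarrow> real) \<Rightarrow> (complex \<Rightarrow> complex) \<Rightarrow> (complex \<Rightarrow> real) \<Rightarrow> bool" where
  "has_lap W f G L \<longleftrightarrow>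
     (\<forall>u\<in>W. (f has_derivative (\<lambda>h. 2 * Re (G u * h))) (at u) \<and> (\<exists>a b. has_wirt G a b u \<and> Re b = L u))"

lemma has_lap_subset: "has_lap W f G L \<Longrightarrow> W' \<subseteq> W \<Longrightarrow> has_lap W' f G L"
  unfolding has_lap_def by blast

lemma has_lap_cong:
  assumes "has_lap W f G L" "open W" "\<And>u. u \<in> W \<Longrightarrow> f u = g u"
  shows "has_lap W g G L"
  unfolding has_lap_def
proof (intro ballI conjI)
  fix u assume u: "u \<in> W"
  note a = assms(1)[unfolded has_lap_def, rule_format, OF u]
  show "(g has_derivative (\<lambda>h. 2 * Re (G u * h))) (at u)"
    by (rule has_derivative_transform_within_open[OF conjunct1[OF a] assms(2) u assms(3)])
  show "\<exists>a b. has_wirt G a b u \<and> Re b = L u" using a by blast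
qed

lemma has_lap_continuous_on: "has_lap W f G L \<Longrightarrow> continuous_on W f"
  unfolding has_lap_def by (meson has_derivative_continuous continuous_at_imp_continuous_on)

lemma has_lap_const: "has_lap W (\<lambda>_. c) (\<lambda>_. 0) (\<lambda>_. 0)"
  unfolding has_lap_def using has_wirt_const by fastforce

lemma has_lap_add:
  assumes "has_lap W f G L" "has_lap W f' G' L'"
  shows "has_lap W (\<lambda>u. f u + f' u) (\<lambda>u. G u + G' u) (\<lambda>u. L u + L' u)"
  unfolding has_lap_def
proof (intro ballI conjI)
  fix u assume u: "u \<in> W"
  note a = assms[unfolded has_lap_def, rule_format, OF u]
  show "((\<lambda>u. f u + f' u) has_derivative (\<lambda>h. 2 * Re ((G u + G' u) * h))) (at u)"
    using has_derivative_add[OF conjunct1[OF a(1)] conjunct1[OF a(2)]] by (simp add: algebra_simps)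
  show "\<exists>a b. has_wirt (\<lambda>u. G u + G' u) a b u \<and> Re b = L u + L' u"
    using a has_wirt_add by (metis plus_complex.simps(1))
qed

lemma has_lap_cmult:
  assumes "has_lap W f G L"
  shows "has_lap W (\<lambda>u. c * f u) (\<lambda>u. of_real c * G u) (\<lambda>u. c * L u)"
  unfolding has_lap_def
proof (intro ballI conjI)
  fix u assume u: "u \<in> W"
  note a = assms[unfolded has_lap_def, rule_format, OF u]
  show "((\<lambda>u. c * f u) has_derivative (\<lambda>h. 2 * Re (of_real c * G u * h))) (at u)"
    using has_derivative_mult_right[OF conjunct1[OF a], of c] by (simp add: algebra_simps)
  show "\<exists>a b. has_wirt (\<lambda>u. of_real c * G u) a b u \<and> Re b = c * L u"
    using a has_wirt_cmult[of G _ _ u "of_real c"] by fastforce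
qed

lemma has_lap_diff:
  assumes "has_lap W f G L" "has_lap W f' G' L'"
  shows "has_lap W (\<lambda>u. f u - f' u) (\<lambda>u. G u - G' u) (\<lambda>u. L u - L' u)"
  using has_lap_add[OF assms(1) has_lap_cmult[OF assms(2), of "-1"]] by simp

lemma has_lap_sum:
  assumes "\<And>k. k \<in> K \<Longrightarrow> has_lap W (f k) (G k) (L k)"
  shows "has_lap W (\<lambda>u. \<Sum>k\<in>K. f k u) (\<lambda>u. \<Sum>k\<in>K. G k u) (\<lambda>u. \<Sum>k\<in>K. L k u)"
  using assms
  by (induction K rule: infinite_finite_induct) (simp_all add: has_lap_const has_lap_add)

text \<open>With G = f \<sigma>, the product rule gives L = f (|\<sigma>|^2 + Re b), where
  \<open>b\<close> is the conjugate derivative of \<sigma>. This is the formula for the Laplacian of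
  an exponential, without taking the logarithm of \<open>f\<close>. The barriers below and the terms
  of the defect all have this shape.\<close>

lemma has_lap_log_derivative:
  assumes "\<And>u. u \<in> W \<Longrightarrow> (f has_derivative (\<lambda>h. 2 * Re (of_real (f u) * \<sigma> u * h))) (at u)"
    and "\<And>u. u \<in> W \<Longrightarrow> \<exists>a. has_wirt \<sigma> a (b u) u"
  shows "has_lap W f (\<lambda>u. of_real (f u) * \<sigma> u) (\<lambda>u. f u * ((cmod (\<sigma> u))\<^sup>2 + Re (b u)))"
  unfolding has_lap_def
proof (intro ballI conjI)
  fix u assume u: "u \<in> W"
  show "(f has_derivative (\<lambda>h. 2 * Re (of_real (f u) * \<sigma> u * h))) (at u)"
    by (rule assms(1)[OF u])
  obtain a where a: "has_wirt \<sigma> a (b u) u" using assms(2)[OF u] by blast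
  have eq: "of_real (2 * Re (of_real (f u) * \<sigma> u * h))
      = of_real (f u) * \<sigma> u * h + of_real (f u) * cnj (\<sigma> u) * cnj h" for h
    by (simp add: complex_eq_iff algebra_simps)
  have "has_wirt (\<lambda>v. of_real (f v)) (of_real (f u) * \<sigma> u) (of_real (f u) * cnj (\<sigma> u)) u"
    unfolding has_wirt_def
    using has_derivative_of_real[OF assms(1)[OF u], where 'a=complex] unfolding eq .
  from has_wirt_mult[OF this a]
  have "has_wirt (\<lambda>v. of_real (f v) * \<sigma> v) (of_real (f u) * \<sigma> u * \<sigma> u + of_real (f u) * a)
     (of_real (f u) * cnj (\<sigma> u) * \<sigma> u + of_real (f u) * b u) u" .
  moreover have "Re (of_real (f u) * cnj (\<sigma> u) * \<sigma> u + of_real (f u) * b u)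
      = f u * ((cmod (\<sigma> u))\<^sup>2 + Re (b u))"
    unfolding cmod_power2 by (simp add: algebra_simps power2_eq_square)
  ultimately show "\<exists>a b'. has_wirt (\<lambda>v. of_real (f v) * \<sigma> v) a b' u \<and>
      Re b' = f u * ((cmod (\<sigma> u))\<^sup>2 + Re (b u))" by blast
qed

text \<open>A positive \<open>D\<close> would make the first derivative positive just to the right
  of the critical point 0, and the mean value theorem would produce a value above the
  maximum.\<close>

lemma not_local_max_second_deriv:
  fixes \<phi> \<phi>' :: "real \<Rightarrow> real"
  assumes "e > 0" "\<And>t. \<bar>t\<bar> < e \<Longrightarrow> (\<phi> has_real_derivative \<phi>' t) (at t)"
    and "\<And>t. \<bar>t\<bar> < e \<Longrightarrow> \<phi> t \<le> \<phi> 0"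
    and "(\<phi>' has_real_derivative D) (at 0)"
  shows "D \<le> 0"
proof (rule ccontr)
  assume "\<not> D \<le> 0"
  then have D: "D > 0" by simp
  have z: "\<phi>' 0 = 0"
    by (rule DERIV_local_max[where d = e and f = \<phi> and x = 0]) (use assms in auto)
  from DERIV_pos_inc_right[OF assms(4) D] obtain d where d: "d > 0"
    "\<And>h. h > 0 \<Longrightarrow> h < d \<Longrightarrow> \<phi>' 0 < \<phi>' h" by (auto)
  define s where "s = min d e / 2"
  have s: "0 < s" "s < d" "s < e" using d assms(1) by (auto simp: s_def min_def)
  have "\<exists>z. 0 < z \<and> z < s \<and> \<phi> s - \<phi> 0 = (s - 0) * \<phi>' z"
    by (rule MVT2) (use s assms(2) in auto)
  then obtain y where "0 < y" "y < s" "\<phi> s - \<phi> 0 = s * \<phi>' y" by auto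
  moreover from this have "\<phi>' y > 0" using d(2)[of y] s z by auto
  ultimately have "\<phi> s > \<phi> 0" using s by (smt (verit) mult_pos_pos)
  with assms(3)[of s] s show False by auto
qed

lemma has_lap_local_max:
  assumes L: "has_lap W f G L" and W: "open W" "u \<in> W"
    and max: "\<And>v. v \<in> W \<Longrightarrow> f v \<le> f u"
  shows "L u \<le> 0"
proof -
  obtain e where e: "e > 0" "ball u e \<subseteq> W" using W open_contains_ball by blast
  obtain a b where ab: "has_wirt G a b u" "Re b = L u"
    using L W unfolding has_lap_def by blast
  have dir: "2 * Re ((a * w + b * cnj w) * w) \<le> 0" if w: "cmod w = 1" for w
  proof -
    have inW: "u + of_real t * w \<in> W" if "\<bar>t\<bar> < e" for t
      using e that w by (auto simp: dist_norm norm_mult subset_iff)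
    have aff: "((\<lambda>t::real. u + of_real t * w) has_derivative (\<lambda>h. of_real h * w)) (at t)" for t
      by (auto intro!: derivative_eq_intros)
    have d1: "((\<lambda>t. f (u + of_real t * w)) has_real_derivative 2 * Re (G (u + of_real t * w) * w)) (at t)"
      if "\<bar>t\<bar> < e" for t
    proof -
      have "(f has_derivative (\<lambda>h. 2 * Re (G (u + of_real t * w) * h))) (at (u + of_real t * w))"
        using L inW[OF that] unfolding has_lap_def by blast
      from has_derivative_compose[OF aff this]
      have "((\<lambda>t. f (u + of_real t * w)) has_derivative (\<lambda>h. 2 * Re (G (u + of_real t * w) * (of_real h * w)))) (at t)" .
      then show ?thesis
        unfolding has_field_derivative_def
        by (rule has_derivative_eq_rhs) (auto simp: algebra_simps)
    qed
    have d2: "((\<lambda>t. 2 * Re (G (u + of_real t * w) * w)) has_real_derivative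
         2 * Re ((a * w + b * cnj w) * w)) (at 0)"
    proof -
      have "(G has_derivative (\<lambda>h. a * h + b * cnj h)) (at (u + of_real 0 * w))"
        using ab unfolding has_wirt_def by simp
      from has_derivative_compose[OF aff this]
      have G: "((\<lambda>t. G (u + of_real t * w)) has_derivative
          (\<lambda>h. a * (of_real h * w) + b * cnj (of_real h * w))) (at 0)" .
      have "((\<lambda>t. 2 * Re (G (u + of_real t * w) * w)) has_derivative
          (\<lambda>h. 2 * Re ((a * (of_real h * w) + b * cnj (of_real h * w)) * w))) (at 0)"
        by (intro has_derivative_mult_right has_derivative_Re has_derivative_mult_left G)
      then show ?thesis
        unfolding has_field_derivative_def
        by (rule has_derivative_eq_rhs) (auto simp: algebra_simps)
    qed
    have d3: "f (u + of_real t * w) \<le> f (u + of_real 0 * w)" if "\<bar>t\<bar> < e" for t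
      using max[OF inW[OF that]] by simp
    show ?thesis
      by (rule not_local_max_second_deriv[where \<phi> = "\<lambda>t. f (u + of_real t * w)" and \<phi>' = "\<lambda>t. 2 * Re (G (u + of_real t * w) * w)", OF e(1)])
        (fact d1, fact d3, fact d2)
  qed
  \<comment> \<open>The contributions of \<open>a\<close> cancel in the sum of the two second
    derivatives, which is 4 Re b.\<close>
  from dir[of 1] dir[of \<i>] have "Re b \<le> 0" by simp
  with ab show ?thesis by simp
qed

section \<open>Barriers, interior estimates and the strong maximum principle\<close>

lemma has_derivative_cmod_square:
  "((\<lambda>v. (cmod (v - c))\<^sup>2) has_derivative (\<lambda>h. 2 * Re (cnj (u - c) * h))) (at u)"
  unfolding cmod_power2
  by (rule has_derivative_eq_rhs, (rule derivative_intros)+) (auto simp: algebra_simps)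

lemma has_lap_gaussian:
  "has_lap W (\<lambda>v. exp (a * (cmod (v - c))\<^sup>2))
     (\<lambda>v. of_real (exp (a * (cmod (v - c))\<^sup>2)) * (of_real a * cnj (v - c)))
     (\<lambda>v. exp (a * (cmod (v - c))\<^sup>2) * (a\<^sup>2 * (cmod (v - c))\<^sup>2 + a))"
proof -
  have "((\<lambda>v. exp (a * (cmod (v - c))\<^sup>2)) has_derivative
      (\<lambda>h. 2 * Re (of_real (exp (a * (cmod (u - c))\<^sup>2)) * (of_real a * cnj (u - c)) * h))) (at u)" for u
    using DERIV_exp[THEN DERIV_compose_FDERIV, OF has_derivative_mult_right[OF has_derivative_cmod_square], of a c u]
    by (rule has_derivative_eq_rhs) (auto simp: algebra_simps)
  moreover have "\<exists>b. has_wirt (\<lambda>v. of_real a * cnj (v - c)) b (of_real a) u" for u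
  proof -
    have "has_wirt (\<lambda>v. v) 1 0 u" by (simp add: has_wirt_def)
    from has_wirt_cmult[OF has_wirt_cnj[OF has_wirt_diff[OF this has_wirt_const]], of "of_real a" c]
    show ?thesis by auto
  qed
  ultimately have "has_lap W (\<lambda>v. exp (a * (cmod (v - c))\<^sup>2))
     (\<lambda>v. of_real (exp (a * (cmod (v - c))\<^sup>2)) * (of_real a * cnj (v - c)))
     (\<lambda>v. exp (a * (cmod (v - c))\<^sup>2) * ((cmod (of_real a * cnj (v - c)))\<^sup>2 + Re (of_real a)))"
    by (intro has_lap_log_derivative) auto
  then show ?thesis by (simp add: norm_mult power_mult_distrib del: complex_cnj_diff)
qed

text \<open>A barrier w that blows up at the boundary of the ball. Since 4 r^2 + 2 R^2 is at most 6
  R^2 at distance r < R from \<open>c\<close>, its L is at most (6 R^2 / B) w^2 for positive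
  \<open>B\<close>.\<close>

lemma has_lap_keller_osserman:
  assumes "R > 0"
  shows "has_lap (ball c R) (\<lambda>v. B / (R\<^sup>2 - (cmod (v - c))\<^sup>2)\<^sup>2)
     (\<lambda>v. of_real (B / (R\<^sup>2 - (cmod (v - c))\<^sup>2)\<^sup>2) * (of_real (2 / (R\<^sup>2 - (cmod (v - c))\<^sup>2)) * cnj (v - c)))
     (\<lambda>v. B / (R\<^sup>2 - (cmod (v - c))\<^sup>2)\<^sup>2 *
        (4 * (cmod (v - c))\<^sup>2 / (R\<^sup>2 - (cmod (v - c))\<^sup>2)\<^sup>2 + 2 * R\<^sup>2 / (R\<^sup>2 - (cmod (v - c))\<^sup>2)\<^sup>2))"
proof -
  define s where "s v = R\<^sup>2 - (cmod (v - c))\<^sup>2" for v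
  have pos: "s v > 0" if "v \<in> ball c R" for v
    using that assms by (simp add: s_def dist_norm norm_minus_commute power_strict_mono)
  have ds: "(s has_derivative (\<lambda>h. - (2 * Re (cnj (u - c) * h)))) (at u)" for u
    unfolding s_def using has_derivative_diff[OF has_derivative_const has_derivative_cmod_square] by simp
  have 1: "((\<lambda>v. B / (s v)\<^sup>2) has_derivative
      (\<lambda>h. 2 * Re (of_real (B / (s u)\<^sup>2) * (of_real (2 / s u) * cnj (u - c)) * h))) (at u)"
    if "u \<in> ball c R" for u
  proof -
    have "((\<lambda>x. B / x\<^sup>2) has_real_derivative (- 2 * B / (s u) ^ 3)) (at (s u))"
      using pos[OF that]
      by (auto intro!: derivative_eq_intros simp: power2_eq_square power3_eq_cube divide_simps)
    from DERIV_compose_FDERIV[OF this ds] show ?thesis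
      by (rule has_derivative_eq_rhs)
        (use pos[OF that] in \<open>auto simp: power2_eq_square power3_eq_cube divide_simps algebra_simps\<close>)
  qed
  have 2: "\<exists>b. has_wirt (\<lambda>v. of_real (2 / s v) * cnj (v - c)) b (of_real (2 * R\<^sup>2 / (s u)\<^sup>2)) u"
    if u: "u \<in> ball c R" for u
  proof -
    have i: "has_wirt (\<lambda>v. v) 1 0 u" by (simp add: has_wirt_def)
    have "((\<lambda>x. 2 / x) has_real_derivative (- 2 / (s u)\<^sup>2)) (at (s u))"
      using pos[OF u] by (auto intro!: derivative_eq_intros simp: power2_eq_square)
    from has_derivative_of_real[OF DERIV_compose_FDERIV[OF this ds], where 'a = complex]
    have "((\<lambda>v. complex_of_real (2 / s v)) has_derivative
        (\<lambda>h. of_real (- (2 * Re (cnj (u - c) * h)) * (- 2 / (s u)\<^sup>2)))) (at u)" .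
    moreover have "(\<lambda>h. of_real (- (2 * Re (cnj (u - c) * h)) * (- 2 / (s u)\<^sup>2)))
       = (\<lambda>h. of_real (2 / (s u)\<^sup>2) * cnj (u - c) * h + of_real (2 / (s u)\<^sup>2) * (u - c) * cnj h)"
      by (rule ext) (simp add: complex_eq_iff algebra_simps diff_divide_distrib add_divide_distrib)
    ultimately have "has_wirt (\<lambda>v. of_real (2 / s v)) (of_real (2 / (s u)\<^sup>2) * cnj (u - c))
        (of_real (2 / (s u)\<^sup>2) * (u - c)) u"
      unfolding has_wirt_def by simp
    from has_wirt_mult[OF this has_wirt_cnj[OF has_wirt_diff[OF i has_wirt_const[of c]]]]
    have "has_wirt (\<lambda>v. of_real (2 / s v) * cnj (v - c))
      (of_real (2 / (s u)\<^sup>2) * cnj (u - c) * cnj (u - c) + of_real (2 / s u) * cnj (0 - 0))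
      (of_real (2 / (s u)\<^sup>2) * (u - c) * cnj (u - c) + of_real (2 / s u) * cnj (1 - 0)) u" .
    moreover have "of_real (2 / (s u)\<^sup>2) * (u - c) * cnj (u - c) + of_real (2 / s u) * cnj (1 - 0)
        = complex_of_real (2 * R\<^sup>2 / (s u)\<^sup>2)"
    proof -
      have "(2 / (s u)\<^sup>2) * (cmod (u - c))\<^sup>2 + 2 / s u = 2 * ((cmod (u - c))\<^sup>2 + s u) / (s u)\<^sup>2"
        using pos[OF u] by (simp add: field_simps power2_eq_square)
      also have "(cmod (u - c))\<^sup>2 + s u = R\<^sup>2" by (simp add: s_def)
      finally have *: "(2 / (s u)\<^sup>2) * (cmod (u - c))\<^sup>2 + 2 / s u = 2 * R\<^sup>2 / (s u)\<^sup>2" .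
      have "of_real (2 / (s u)\<^sup>2) * (u - c) * cnj (u - c) + of_real (2 / s u) * cnj (1 - 0)
        = complex_of_real ((2 / (s u)\<^sup>2) * (cmod (u - c))\<^sup>2 + 2 / s u)"
        by (simp only: mult.assoc complex_norm_square[symmetric] of_real_add of_real_mult) simp
      then show ?thesis unfolding * .
    qed
    ultimately show ?thesis by auto
  qed
  have L: "has_lap (ball c R) (\<lambda>v. B / (s v)\<^sup>2)
     (\<lambda>v. of_real (B / (s v)\<^sup>2) * (of_real (2 / s v) * cnj (v - c)))
     (\<lambda>v. B / (s v)\<^sup>2 * ((cmod (of_real (2 / s v) * cnj (v - c)))\<^sup>2 + Re (of_real (2 * R\<^sup>2 / (s v)\<^sup>2))))"
    by (intro has_lap_log_derivative 1 2)
  have "(cmod (of_real (2 / s v) * cnj (v - c)))\<^sup>2 + Re (of_real (2 * R\<^sup>2 / (s v)\<^sup>2))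
      = 4 * (cmod (v - c))\<^sup>2 / (s v)\<^sup>2 + 2 * R\<^sup>2 / (s v)\<^sup>2" for v
    by (simp add: norm_mult norm_divide power_mult_distrib power_divide del: complex_cnj_diff)
  with L show ?thesis unfolding s_def by simp
qed

text \<open>No boundary values of \<open>f\<close> enter, because the barrier is infinite on the
  boundary. The barrier is a supersolution of L = C w^2 from B = 6 R^2 / C on, and its value B / R^4
  at the centre is then the bound.\<close>

lemma keller_osserman_bound:
  assumes lap: "has_lap W f G L" and sub: "cball c R \<subseteq> W" and R: "R > 0" and C: "C > 0"
    and nonneg: "\<And>v. v \<in> cball c R \<Longrightarrow> f v \<ge> 0"
    and ineq: "\<And>v. v \<in> cball c R \<Longrightarrow> L v \<ge> C * (f v)\<^sup>2"
  shows "f c \<le> 6 / (C * R\<^sup>2)"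
proof (rule ccontr)
  assume neg: "\<not> f c \<le> 6 / (C * R\<^sup>2)"
  define s where "s v = R\<^sup>2 - (cmod (v - c))\<^sup>2" for v
  have "continuous_on (cball c R) f"
    using has_lap_continuous_on[OF has_lap_subset[OF lap sub]] .
  then have "continuous_on (cball c R) (\<lambda>v. f v * (s v)\<^sup>2)"
    unfolding s_def by (intro continuous_intros)
  then obtain p where p: "p \<in> cball c R" "\<And>v. v \<in> cball c R \<Longrightarrow> f v * (s v)\<^sup>2 \<le> f p * (s p)\<^sup>2"
    using continuous_attains_sup[of "cball c R" "\<lambda>v. f v * (s v)\<^sup>2"] R by auto
  \<comment> \<open>The least \<open>B\<close> for which the barrier stays above \<open>f\<close>;
    the two touch at \<open>p\<close>, where their difference attains its maximum.\<close>
  define B where "B = f p * (s p)\<^sup>2"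
  have "6 / (C * R\<^sup>2) * (s c)\<^sup>2 < f c * (s c)\<^sup>2"
    using neg R by (intro mult_strict_right_mono) (auto simp: s_def)
  also have "\<dots> \<le> B" using p(2)[of c] R by (simp add: B_def)
  finally have B: "B > 6 * R\<^sup>2 / C"
    using R C by (simp add: s_def divide_simps power2_eq_square algebra_simps)
  have B0: "B > 0" using B R C by (smt (verit) divide_pos_pos mult_pos_pos zero_less_power)
  have sp: "s p \<noteq> 0" using B0 unfolding B_def by auto
  have pball: "p \<in> ball c R"
    using p(1) sp R by (auto simp: s_def dist_norm norm_minus_commute less_le)
  have spos: "s v > 0" if "v \<in> ball c R" for v
    using that R by (simp add: s_def dist_norm norm_minus_commute power_strict_mono)
  note lw = has_lap_keller_osserman[OF R, of c B, folded s_def]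
  have lf: "has_lap (ball c R) f G L"
    using has_lap_subset[OF lap] sub by (meson ball_subset_cball order_trans)
  have "f v - B / (s v)\<^sup>2 \<le> f p - B / (s p)\<^sup>2" if v: "v \<in> ball c R" for v
  proof -
    have "f v * (s v)\<^sup>2 \<le> B" using p(2)[of v] v by (auto simp: B_def)
    then have "f v \<le> B / (s v)\<^sup>2" using spos[OF v] by (simp add: pos_le_divide_eq)
    moreover have "f p = B / (s p)\<^sup>2" using sp by (simp add: B_def)
    ultimately show ?thesis by simp
  qed
  from has_lap_local_max[OF has_lap_diff[OF lf lw] open_ball pball this]
  have 1: "L p \<le> B / (s p)\<^sup>2 * (4 * (cmod (p - c))\<^sup>2 / (s p)\<^sup>2 + 2 * R\<^sup>2 / (s p)\<^sup>2)" by simp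
  have "(cmod (p - c))\<^sup>2 \<le> R\<^sup>2" using spos[OF pball] by (simp add: s_def)
  then have "4 * (cmod (p - c))\<^sup>2 / (s p)\<^sup>2 + 2 * R\<^sup>2 / (s p)\<^sup>2 \<le> 6 * R\<^sup>2 / (s p)\<^sup>2"
    unfolding add_divide_distrib[symmetric] by (intro divide_right_mono) auto
  then have "B / (s p)\<^sup>2 * (4 * (cmod (p - c))\<^sup>2 / (s p)\<^sup>2 + 2 * R\<^sup>2 / (s p)\<^sup>2)
     \<le> B / (s p)\<^sup>2 * (6 * R\<^sup>2 / (s p)\<^sup>2)" using B0 by (intro mult_left_mono) auto
  also have "\<dots> < B / (s p)\<^sup>2 * (C * B / (s p)\<^sup>2)"
    using B B0 C sp by (intro mult_strict_left_mono divide_strict_right_mono) (auto simp: field_simps)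
  also have "\<dots> = C * (B / (s p)\<^sup>2)\<^sup>2" by (simp add: power2_eq_square)
  also have "\<dots> \<le> L p" using ineq[OF p(1)] sp by (simp add: B_def)
  finally show False using 1 by simp
qed

text \<open>By the condition on \<open>a\<close>, the Gaussian w = exp (a |v - c|^2) satisfies L
  \<le> E w on the ball. Scaled to equal \<open>K\<close> on the boundary circle it dominates
  \<open>f\<close>, and its value at the centre is the claimed bound.\<close>

lemma exponential_decay_bound:
  assumes lap: "has_lap W f G L" and sub: "cball c R \<subseteq> W" and R: "R > 0" and K: "K \<ge> 0"
    and a: "a > 0" "a\<^sup>2 * R\<^sup>2 + a \<le> E"
    and le: "\<And>v. v \<in> cball c R \<Longrightarrow> f v \<le> K"
    and ineq: "\<And>v. v \<in> cball c R \<Longrightarrow> L v \<ge> E * f v"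
  shows "f c \<le> K * exp (- a * R\<^sup>2)"
proof (rule ccontr)
  assume neg: "\<not> f c \<le> K * exp (- a * R\<^sup>2)"
  define w where "w v = exp (a * (cmod (v - c))\<^sup>2)" for v
  define K' where "K' = K * exp (- a * R\<^sup>2)"
  have K': "K' \<ge> 0" using K by (simp add: K'_def)
  have E: "E > 0" using a by (smt (verit) mult_nonneg_nonneg zero_le_power2)
  have contf: "continuous_on (cball c R) f"
    using has_lap_continuous_on[OF has_lap_subset[OF lap sub]] .
  have "continuous_on (cball c R) (\<lambda>v. f v - K' * w v)"
    unfolding w_def by (intro continuous_intros contf)
  then obtain p where p: "p \<in> cball c R" "\<And>v. v \<in> cball c R \<Longrightarrow> f v - K' * w v \<le> f p - K' * w p"
    using continuous_attains_sup[of "cball c R" "\<lambda>v. f v - K' * w v"] R by auto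
  have "f c - K' * w c > 0" using neg by (simp add: w_def K'_def)
  with p(2)[of c] R have pos: "f p - K' * w p > 0" by simp
  have "dist c p \<noteq> R"
  proof
    assume "dist c p = R"
    then have "K' * w p = K * (exp (- a * R\<^sup>2) * exp (a * R\<^sup>2))"
      by (simp add: w_def K'_def dist_norm norm_minus_commute)
    also have "\<dots> = K" unfolding exp_add[symmetric] by simp
    finally show False using pos le[OF p(1)] by simp
  qed
  then have pball: "p \<in> ball c R" using p(1) by auto
  have lf: "has_lap (ball c R) f G L"
    using has_lap_subset[OF lap] sub by (meson ball_subset_cball order_trans)
  have "L p - K' * (w p * (a\<^sup>2 * (cmod (p - c))\<^sup>2 + a)) \<le> 0"
    using has_lap_local_max[OF has_lap_diff[OF lf has_lap_cmult[where c = K', OF has_lap_gaussian[of _ a c]]] open_ball pball]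
      p(2) by (simp add: w_def)
  moreover have "K' * (w p * (a\<^sup>2 * (cmod (p - c))\<^sup>2 + a)) \<le> E * (K' * w p)"
  proof -
    have "(cmod (p - c))\<^sup>2 \<le> R\<^sup>2" using p(1) by (simp add: dist_norm norm_minus_commute power_mono)
    then have "a\<^sup>2 * (cmod (p - c))\<^sup>2 + a \<le> E" using a(2)
      by (smt (verit) mult_left_mono zero_le_power2)
    then have "K' * w p * (a\<^sup>2 * (cmod (p - c))\<^sup>2 + a) \<le> K' * w p * E"
      using K' by (intro mult_left_mono) (auto simp: w_def)
    then show ?thesis by (simp add: algebra_simps)
  qed
  moreover have "E * (K' * w p) < E * f p" using pos E by simp
  ultimately show False using ineq[OF p(1)] by linarith
qed

text \<open>Hopf's argument: a Gaussian bump centred inside the set \<open>f < f p\<close> is added to \<open>f\<close> near a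
  boundary point of that set.\<close>

lemma subharmonic_strong_max:
  assumes lap: "has_lap W f G L" and nn: "\<And>v. v \<in> W \<Longrightarrow> L v \<ge> 0"
    and sub: "ball p R \<subseteq> W" and max: "\<And>v. v \<in> ball p R \<Longrightarrow> f v \<le> f p"
    and v: "v \<in> ball p (R / 2)"
  shows "f v = f p"
proof (rule ccontr)
  assume ne: "f v \<noteq> f p"
  have cont: "continuous_on (ball p R) f"
    using has_lap_continuous_on[OF has_lap_subset[OF lap sub]] .
  define r0 where "r0 = dist v p"
  have r0: "r0 < R / 2" using v by (simp add: r0_def dist_commute)
  \<comment> \<open>This is where the radius \<open>R / 2\<close> in the hypothesis on
    \<open>v\<close> is used: the disc about \<open>v\<close> that reaches \<open>p\<close> stays
    inside the large ball.\<close>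
  have inb: "cball v r0 \<subseteq> ball p R"
  proof
    fix x assume "x \<in> cball v r0"
    then have "dist p x \<le> r0 + r0" using dist_triangle[of p x v] by (simp add: r0_def dist_commute)
    with r0 show "x \<in> ball p R" by simp
  qed
  define Z where "Z = {x \<in> cball v r0. f x = f p}"
  have "closed (cball v r0 \<inter> f -` {f p})"
    by (rule continuous_closed_preimage[OF continuous_on_subset[OF cont inb] closed_cball closed_singleton])
  moreover have "Z = cball v r0 \<inter> (cball v r0 \<inter> f -` {f p})" by (auto simp: Z_def)
  ultimately have "compact Z" using compact_Int_closed[OF compact_cball] by metis
  moreover have "p \<in> Z" by (simp add: Z_def r0_def)
  ultimately obtain p2 where p2: "p2 \<in> Z" "\<And>y. y \<in> Z \<Longrightarrow> dist v p2 \<le> dist v y"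
    using continuous_attains_inf[of Z "dist v"] continuous_on_dist[OF continuous_on_const continuous_on_id, of Z v] by auto
  define r where "r = dist v p2"
  have r: "r > 0" "r \<le> r0" using p2 ne by (auto simp: r_def Z_def)
  have less: "f x < f p" if "dist v x < r" for x
  proof -
    have "x \<in> cball v r0" using that r by simp
    moreover have "x \<notin> Z" using p2(2)[of x] that by (auto simp: r_def)
    ultimately show ?thesis using max[of x] inb by (auto simp: Z_def less_le)
  qed
  \<comment> \<open>The disc about the midpoint is tangent from inside at \<open>p2\<close>, so
    \<open>p2\<close> is its only point with f = f p.\<close>
  define c where "c = (v + p2) / 2"
  define r' where "r' = r / 2"
  have cv: "dist v c = r'" "dist c p2 = r'"
  proof -
    have eq: "v - c = (v - p2) / 2" "c - p2 = (v - p2) / 2" by (simp_all add: c_def field_simps)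
    show "dist v c = r'" "dist c p2 = r'"
      unfolding dist_norm eq r'_def r_def norm_divide by simp_all
  qed
  have less': "f x < f p" if x: "dist c x \<le> r'" "x \<noteq> p2" for x
  proof (cases "dist v x < r")
    case True then show ?thesis by (rule less)
  next
    case False
    have "dist v x \<le> dist v c + dist c x" by (rule dist_triangle)
    with False x cv have 1: "norm ((c - v) + (x - c)) = norm (c - v) + norm (x - c)" "norm (x - c) = r'"
      by (auto simp: r'_def dist_norm norm_minus_commute)
    from 1(1) have "norm (c - v) *\<^sub>R (x - c) = norm (x - c) *\<^sub>R (c - v)"
      by (simp only: norm_triangle_eq)
    moreover have "norm (c - v) = r'" using cv by (simp add: dist_norm norm_minus_commute)
    ultimately have "x - c = c - v" using 1(2) r by (simp add: r'_def)
    then have "x = p2" by (simp add: c_def field_simps)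
    with x show ?thesis by simp
  qed
  \<comment> \<open>The first bound keeps the disc about \<open>p2\<close> away from the centre
    \<open>c\<close> of the bump, the second keeps it inside \<open>ball p R\<close>.\<close>
  define \<delta> where "\<delta> = min (r' / 2) ((R - 2 * r0) / 2)"
  have \<delta>: "\<delta> > 0" "\<delta> \<le> r' / 2" using r r0 by (auto simp: \<delta>_def r'_def)
  have "\<delta> \<le> (R - 2 * r0) / 2" unfolding \<delta>_def by (rule min.cobounded2)
  moreover have "(R - 2 * r0) / 2 < R - 2 * r0" using r0 by (simp add: field_simps)
  ultimately have \<delta>3: "\<delta> < R - 2 * r0" by (rule le_less_trans)
  have cb: "cball p2 \<delta> \<subseteq> ball p R"
  proof
    fix x assume x: "x \<in> cball p2 \<delta>"
    have "dist p x \<le> dist p v + dist v p2 + dist p2 x"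
      using dist_triangle[of p x p2] dist_triangle[of p p2 v] by linarith
    then have "dist p x < R" using x \<delta>3 r by (auto simp: r_def r0_def dist_commute)
    then show "x \<in> ball p R" by simp
  qed
  \<comment> \<open>This value gives a^2 (r' / 2)^2 + a = 8 / r'^2 > 0, so the bump is strictly
    subharmonic at distance at least r' / 2 from \<open>c\<close>, in particular on the disc of
    radius \<delta> about \<open>p2\<close>.\<close>
  define a where "a = - 8 / r'\<^sup>2"
  have r'0: "r' > 0" using r by (simp add: r'_def)
  define w where "w x = exp (a * (cmod (x - c))\<^sup>2)" for x
  have w1: "w x \<le> 1" for x
    using r'0 by (simp add: w_def a_def)
  \<comment> \<open>On the part of the small circle inside the tangent disc, \<open>f\<close> stays
    below its maximum by a margin \<eta>; on the rest of the circle the bump is smaller than at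
    \<open>p2\<close>. Adding \<eta> / 2 times the bump thus moves the maximum into the
    interior.\<close>
  obtain \<eta> where \<eta>: "\<eta> > 0" "\<And>x. x \<in> sphere p2 \<delta> \<inter> cball c r' \<Longrightarrow> f x \<le> f p - \<eta>"
  proof (cases "sphere p2 \<delta> \<inter> cball c r' = {}")
    case True then show ?thesis using that[of 1] by auto
  next
    case False
    have "continuous_on (sphere p2 \<delta> \<inter> cball c r') f"
      by (rule continuous_on_subset[OF cont]) (use cb in auto)
    moreover have "compact (sphere p2 \<delta> \<inter> cball c r')" by (intro compact_Int_closed) auto
    ultimately obtain y where y: "y \<in> sphere p2 \<delta> \<inter> cball c r'"
      "\<And>x. x \<in> sphere p2 \<delta> \<inter> cball c r' \<Longrightarrow> f x \<le> f y"
      using continuous_attains_sup[of "sphere p2 \<delta> \<inter> cball c r'" f] False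
      by blast
    have "f y < f p" using y(1) \<delta>(1) by (intro less') auto
    then show ?thesis using that[of "f p - f y"] y(2) by auto
  qed
  define F where "F x = f x + \<eta> / 2 * (w x - w p2)" for x
  have "continuous_on (cball p2 \<delta>) F"
    unfolding F_def w_def by (intro continuous_intros continuous_on_subset[OF cont cb])
  then obtain m where m: "m \<in> cball p2 \<delta>" "\<And>x. x \<in> cball p2 \<delta> \<Longrightarrow> F x \<le> F m"
    using continuous_attains_sup[of "cball p2 \<delta>" F] \<delta> by auto
  have Fm: "F m \<ge> f p" using m(2)[of p2] p2(1) \<delta>(1) by (simp add: F_def Z_def)
  have wp2: "w p2 = exp (a * r'\<^sup>2)" using cv by (simp add: w_def dist_norm norm_minus_commute)
  have "m \<notin> sphere p2 \<delta>"
  proof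
    assume ms: "m \<in> sphere p2 \<delta>"
    show False
    proof (cases "m \<in> cball c r'")
      case True
      have "w p2 > 0" by (simp add: w_def)
      then have "\<eta> / 2 * (w m - w p2) < \<eta> / 2 * 1" using w1[of m] \<eta>(1) by (intro mult_strict_left_mono) auto
      moreover have "f m \<le> f p - \<eta>" using \<eta>(2) True ms by blast
      ultimately show False using Fm \<eta>(1) unfolding F_def by linarith
    next
      case False
      then have "r' < cmod (m - c)" by (simp add: dist_norm norm_minus_commute)
      then have "r'\<^sup>2 < (cmod (m - c))\<^sup>2" using r'0 by (intro power_strict_mono) auto
      moreover have "a < 0" using r'0 by (simp add: a_def)
      ultimately have "w m < w p2" by (subst wp2) (simp add: w_def)
      then have "\<eta> / 2 * (w m - w p2) < 0" using \<eta>(1) by (simp add: mult_pos_neg)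
      moreover have "f m \<le> f p" using max cb m(1) by auto
      ultimately show False using Fm by (simp add: F_def)
    qed
  qed
  then have mb: "m \<in> ball p2 \<delta>" using m(1) by auto
  have "has_lap (ball p2 \<delta>) f G L"
    using has_lap_subset[OF lap] sub cb by (meson ball_subset_cball order_trans)
  note ll = has_lap_add[OF this has_lap_cmult[where c = "\<eta> / 2", OF has_lap_diff[OF has_lap_gaussian[of _ a c] has_lap_const[of _ "w p2"]]]]
  have "L m + \<eta> / 2 * (exp (a * (cmod (m - c))\<^sup>2) * (a\<^sup>2 * (cmod (m - c))\<^sup>2 + a) - 0) \<le> 0"
    by (rule has_lap_local_max[OF ll open_ball mb]) (use m(2) in \<open>auto simp: F_def w_def\<close>)
  moreover have "L m \<ge> 0" using nn sub cb m(1) by blast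
  moreover have "a\<^sup>2 * (cmod (m - c))\<^sup>2 + a > 0"
  proof -
    have "dist c p2 \<le> dist c m + dist m p2" by (rule dist_triangle)
    then have "r' / 2 \<le> cmod (m - c)" using m(1) \<delta>(2) cv by (simp add: dist_norm norm_minus_commute)
    then have "(r' / 2)\<^sup>2 \<le> (cmod (m - c))\<^sup>2" using r'0 by (intro power_mono) auto
    then have "a\<^sup>2 * (r' / 2)\<^sup>2 \<le> a\<^sup>2 * (cmod (m - c))\<^sup>2" by (intro mult_left_mono) auto
    moreover have "a\<^sup>2 * (r' / 2)\<^sup>2 + a > 0"
      using r'0 by (simp add: a_def field_simps power2_eq_square)
    ultimately show ?thesis by linarith
  qed
  moreover have "\<eta> / 2 * (exp (a * (cmod (m - c))\<^sup>2) * (a\<^sup>2 * (cmod (m - c))\<^sup>2 + a)) > 0"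
    if "a\<^sup>2 * (cmod (m - c))\<^sup>2 + a > 0"
    using that \<eta>(1) by (intro mult_pos_pos) auto
  ultimately show False by fastforce
qed

section \<open>Matrices as functions of their indices\<close>

text \<open>Matrix products are cut off to indices below \<open>n\<close>, so that the ring laws hold as
  unconditional equations between functions.\<close>

type_synonym fmat = "nat \<Rightarrow> nat \<Rightarrow> complex"

definition mm :: "nat \<Rightarrow> fmat \<Rightarrow> fmat \<Rightarrow> fmat" where
  "mm n X Y = (\<lambda>i j. if i < n \<and> j < n then \<Sum>k<n. X i k * Y k j else 0)"

definition adj :: "fmat \<Rightarrow> fmat" where
  "adj X = (\<lambda>i j. cnj (X j i))"

definition tr :: "nat \<Rightarrow> fmat \<Rightarrow> complex" where
  "tr n X = (\<Sum>i<n. X i i)"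

definition smul :: "complex \<Rightarrow> fmat \<Rightarrow> fmat" where
  "smul c X = (\<lambda>i j. c * X i j)"

definition one :: "nat \<Rightarrow> fmat" where
  "one n = (\<lambda>i j. if i < n \<and> i = j then 1 else 0)"

definition supported :: "nat \<Rightarrow> fmat \<Rightarrow> bool" where
  "supported n X \<longleftrightarrow> (\<forall>i j. \<not> (i < n \<and> j < n) \<longrightarrow> X i j = 0)"

text \<open>Conjugation of the transpose by the antidiagonal unitary matrix with entries \<open>z\<^sup>j\<close>.\<close>

definition sharp :: "nat \<Rightarrow> complex \<Rightarrow> fmat \<Rightarrow> fmat" where
  "sharp n z X = (\<lambda>i j. if i < n \<and> j < n then cnj (z ^ i) * z ^ j * X (n - 1 - j) (n - 1 - i) else 0)"

lemma mm_assoc: "mm n (mm n X Y) Z = mm n X (mm n Y Z)"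
proof (intro ext)
  fix i j
  have "(\<Sum>k<n. (\<Sum>l<n. X i l * Y l k) * Z k j) = (\<Sum>l<n. X i l * (\<Sum>k<n. Y l k * Z k j))"
    unfolding sum_distrib_left sum_distrib_right
    by (subst sum.swap) (simp add: mult.assoc)
  then show "mm n (mm n X Y) Z i j = mm n X (mm n Y Z) i j"
    by (simp add: mm_def)
qed

lemma mm_add_left: "mm n (X + Y) Z = mm n X Z + mm n Y Z"
  by (intro ext) (simp add: mm_def algebra_simps sum.distrib)

lemma mm_add_right: "mm n X (Y + Z) = mm n X Y + mm n X Z"
  by (intro ext) (simp add: mm_def algebra_simps sum.distrib)

lemma mm_diff_left: "mm n (X - Y) Z = mm n X Z - mm n Y Z"
  by (intro ext) (simp add: mm_def algebra_simps sum_subtractf)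

lemma mm_diff_right: "mm n X (Y - Z) = mm n X Y - mm n X Z"
  by (intro ext) (simp add: mm_def algebra_simps sum_subtractf)

lemma mm_smul_left: "mm n (smul c X) Y = smul c (mm n X Y)"
  by (intro ext) (simp add: mm_def smul_def sum_distrib_left mult.assoc)

lemma mm_smul_right: "mm n X (smul c Y) = smul c (mm n X Y)"
  by (intro ext) (simp add: mm_def smul_def sum_distrib_left mult.left_commute)

lemma smul_smul: "smul c (smul d X) = smul (c * d) X"
  by (intro ext) (simp add: smul_def mult.assoc)

lemma smul_one: "smul 1 X = X"
  by (intro ext) (simp add: smul_def)

lemma adj_mm: "adj (mm n X Y) = mm n (adj Y) (adj X)"
  by (intro ext) (simp add: mm_def adj_def mult.commute)

lemma adj_adj: "adj (adj X) = X"
  by (simp add: adj_def)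

lemma adj_add: "adj (X + Y) = adj X + adj Y"
  by (intro ext) (simp add: adj_def)

lemma adj_diff: "adj (X - Y) = adj X - adj Y"
  by (intro ext) (simp add: adj_def)

lemma adj_smul: "adj (smul c X) = smul (cnj c) (adj X)"
  by (intro ext) (simp add: adj_def smul_def)

lemma tr_mm_commute: "tr n (mm n X Y) = tr n (mm n Y X)"
  unfolding tr_def mm_def by (simp, subst sum.swap) (simp add: mult.commute)

lemma tr_add: "tr n (X + Y) = tr n X + tr n Y"
  by (simp add: tr_def sum.distrib)

lemma tr_diff: "tr n (X - Y) = tr n X - tr n Y"
  by (simp add: tr_def sum_subtractf)

lemma tr_adj: "tr n (adj X) = cnj (tr n X)"
  by (simp add: tr_def adj_def)

lemma supported_mm: "supported n (mm n X Y)"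
  by (simp add: supported_def mm_def)

lemma mm_one_left: "supported n X \<Longrightarrow> mm n (one n) X = X"
  by (intro ext) (auto simp: mm_def one_def supported_def if_distrib[of "\<lambda>x. x * _"] sum.delta' cong: if_cong)

lemma supported_eqI:
  assumes "supported n X" "supported n Y" "\<And>i j. i < n \<Longrightarrow> j < n \<Longrightarrow> X i j = Y i j"
  shows "X = Y"
  using assms unfolding supported_def by (intro ext) metis

lemma sum_reverse: "(\<Sum>k<n. f (n - 1 - k :: nat)) = (\<Sum>k<n. f k :: complex)"
  by (rule sum.reindex_bij_witness[of _ "\<lambda>k. n - 1 - k" "\<lambda>k. n - 1 - k"]) auto

text \<open>Transposition reverses the product, and |z| = 1 cancels the phases attached to the
  summation index.\<close>

lemma sharp_mm:
  assumes "cmod z = 1"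
  shows "sharp n z (mm n X Y) = mm n (sharp n z Y) (sharp n z X)"
proof (intro ext)
  fix i j
  show "sharp n z (mm n X Y) i j = mm n (sharp n z Y) (sharp n z X) i j"
  proof (cases "i < n \<and> j < n")
    case True
    have u: "z ^ k * cnj (z ^ k) = 1" for k
      unfolding complex_cnj_power power_mult_distrib[symmetric] complex_norm_square[symmetric]
      using assms by simp
    have "(\<Sum>k<n. X (n - 1 - j) k * Y k (n - 1 - i))
        = (\<Sum>k<n. X (n - 1 - j) (n - 1 - k) * Y (n - 1 - k) (n - 1 - i))"
      by (rule sum_reverse[symmetric])
    also have "\<dots> = (\<Sum>k<n. (z ^ k * cnj (z ^ k)) * (X (n - 1 - j) (n - 1 - k) * Y (n - 1 - k) (n - 1 - i)))"
      unfolding u by simp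
    finally have "cnj (z ^ i) * z ^ j * (\<Sum>k<n. X (n - 1 - j) k * Y k (n - 1 - i)) =
      (\<Sum>k<n. cnj (z ^ i) * z ^ k * Y (n - 1 - k) (n - 1 - i) * (cnj (z ^ k) * z ^ j * X (n - 1 - j) (n - 1 - k)))"
      by (simp add: sum_distrib_left ac_simps)
    with True show ?thesis by (simp add: sharp_def mm_def)
  qed (auto simp: sharp_def mm_def)
qed

lemma sharp_adj: "sharp n z (adj X) = adj (sharp n z X)"
  by (intro ext) (simp add: sharp_def adj_def)

lemma sharp_diff: "sharp n z (X - Y) = sharp n z X - sharp n z Y"
  by (intro ext) (simp add: sharp_def algebra_simps)

lemma supported_sharp: "supported n (sharp n z X)"
  by (simp add: supported_def sharp_def)

section \<open>Positive definite forms\<close>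

definition form :: "nat \<Rightarrow> fmat \<Rightarrow> (nat \<Rightarrow> complex) \<Rightarrow> complex" where
  "form n H x = (\<Sum>i<n. \<Sum>j<n. cnj (x i) * H i j * x j)"

definition posd :: "nat \<Rightarrow> fmat \<Rightarrow> bool" where
  "posd n H \<longleftrightarrow> (\<forall>i<n. \<forall>j<n. H j i = cnj (H i j)) \<and>
     (\<forall>x. (\<exists>i<n. x i \<noteq> 0) \<longrightarrow> Re (form n H x) > 0)"

lemma form_zero: "(\<And>i. i < n \<Longrightarrow> x i = 0) \<Longrightarrow> form n H x = 0"
  by (simp add: form_def)

lemma posd_form_nonneg: "posd n H \<Longrightarrow> Re (form n H x) \<ge> 0"
  by (metis form_zero less_eq_real_def posd_def zero_complex.simps(1))

lemma posd_form_eq_0: "posd n H \<Longrightarrow> Re (form n H x) = 0 \<Longrightarrow> i < n \<Longrightarrow> x i = 0"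
  by (metis less_irrefl posd_def)

lemma posd_diag:
  assumes "posd n H" "i < n"
  shows "Re (H i i) > 0" "Im (H i i) = 0" 
proof -
  have "form n H (\<lambda>k. if k = i then 1 else 0) = H i i"
    unfolding form_def using assms(2)
    by (simp add: if_distrib[of "\<lambda>x. _ * x"] if_distrib[of "\<lambda>x. x * _"] if_distrib[of cnj] sum.delta' cong: if_cong)
  then show "Re (H i i) > 0" using assms unfolding posd_def
    by (metis (mono_tags, lifting) one_neq_zero)
  have "H i i = cnj (H i i)" using assms unfolding posd_def by blast
  then show "Im (H i i) = 0" by (simp add: complex_eq_iff)
qed

text \<open>The form of \<open>sharp n z H\<close> at \<open>x\<close> is the form of
  \<open>H\<close> at the vector \<open>y\<close> obtained from \<open>x\<close> by multiplying with
  powers of \<open>z\<close>, reversing and conjugating.\<close>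

lemma posd_sharp:
  assumes "posd n H" "cmod z = 1"
  shows "posd n (sharp n z H)"
  unfolding posd_def
proof (intro conjI allI impI)
  fix i j assume ij: "i < n" "j < n"
  then have "n - 1 - i < n" "n - 1 - j < n" by auto
  then have "H (n - 1 - i) (n - 1 - j) = cnj (H (n - 1 - j) (n - 1 - i))"
    using assms(1) unfolding posd_def by blast
  with ij show "sharp n z H j i = cnj (sharp n z H i j)"
    unfolding sharp_def by (simp only: if_True simp_thms complex_cnj_mult complex_cnj_cnj ac_simps)
next
  fix x :: "nat \<Rightarrow> complex" assume x: "\<exists>i<n. x i \<noteq> 0"
  define y where "y k = cnj (z ^ (n - 1 - k) * x (n - 1 - k))" for k
  have z0: "z \<noteq> 0" using assms(2) by auto
  have "form n (sharp n z H) x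
      = (\<Sum>i<n. \<Sum>j<n. y (n - 1 - i) * H (n - 1 - j) (n - 1 - i) * cnj (y (n - 1 - j)))"
    unfolding form_def
  proof (intro sum.cong refl)
    fix i j assume "i \<in> {..<n}" "j \<in> {..<n}"
    then have "y (n - 1 - i) = cnj (z ^ i * x i)" "y (n - 1 - j) = cnj (z ^ j * x j)"
      "sharp n z H i j = cnj (z ^ i) * z ^ j * H (n - 1 - j) (n - 1 - i)"
      by (auto simp: y_def sharp_def)
    then show "cnj (x i) * sharp n z H i j * x j = y (n - 1 - i) * H (n - 1 - j) (n - 1 - i) * cnj (y (n - 1 - j))"
      by (simp only: complex_cnj_mult complex_cnj_cnj ac_simps)
  qed
  also have "\<dots> = (\<Sum>i<n. \<Sum>j<n. y i * H j i * cnj (y j))"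
  proof -
    have "(\<Sum>j<n. y (n - 1 - i) * H (n - 1 - j) (n - 1 - i) * cnj (y (n - 1 - j)))
        = (\<Sum>j<n. y (n - 1 - i) * H j (n - 1 - i) * cnj (y j))" for i
      by (rule sum_reverse[of "\<lambda>j. y (n - 1 - i) * H j (n - 1 - i) * cnj (y j)"])
    then show ?thesis
      using sum_reverse[of "\<lambda>i. \<Sum>j<n. y i * H j i * cnj (y j)" n] by (simp only:)
  qed
  also have "\<dots> = form n H y"
    unfolding form_def by (subst sum.swap) (intro sum.cong refl, simp only: ac_simps)
  finally have eq: "form n (sharp n z H) x = form n H y" .
  obtain i where "i < n" "x i \<noteq> 0" using x by blast
  then have "n - 1 - i < n" "y (n - 1 - i) \<noteq> 0" using z0 by (auto simp: y_def)
  then show "Re (form n (sharp n z H) x) > 0"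
    unfolding eq using assms(1) unfolding posd_def by blast
qed

lemma posd_schur_complement:
  assumes H: "posd (Suc n) H"
  shows "posd n (\<lambda>i j. H i j - H i n * cnj (H j n) / H n n)"
proof -
  define d where "d = Re (H n n)"
  have d: "H n n = of_real d" "d > 0"
    using posd_diag[OF H, of n] by (auto simp: d_def complex_eq_iff)
  have herm: "H j i = cnj (H i j)" if "i \<le> n" "j \<le> n" for i j
    using H that unfolding posd_def by (meson le_imp_less_Suc)
  show ?thesis
    unfolding posd_def
  proof (intro conjI allI impI)
    fix i j assume "i < n" "j < n"
    then show "H j i - H j n * cnj (H i n) / H n n = cnj (H i j - H i n * cnj (H j n) / H n n)"
      using herm[of i j] by (simp add: d)
  next
    fix x :: "nat \<Rightarrow> complex" assume x: "\<exists>i<n. x i \<noteq> 0"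
    define S where "S = (\<Sum>j<n. cnj (H j n) * x j)"
    \<comment> \<open>The last coordinate is the one that minimises the form of \<open>H\<close> for
      given \<open>x\<close>; completing the square there leaves the Schur complement.\<close>
    define y where "y k = (if k < n then x k else - S / H n n)" for k
    have yx: "y k = x k" if "k < n" for k using that by (simp add: y_def)
    have yn: "y n = - S / H n n" by (simp add: y_def)
    have col: "(\<Sum>i<n. cnj (y i) * H i n) = cnj S"
      by (simp add: S_def yx mult.commute)
    have row: "(\<Sum>j<n. H n j * y j) = S" unfolding S_def
      by (intro sum.cong refl arg_cong2[where f = "(*)"] herm) (auto simp: yx)
    have alg: "cnj S * y n + cnj (y n) * S + cnj (y n) * H n n * y n = - (cnj S * S / H n n)"
      unfolding yn d(1) using d(2) by (simp add: field_simps)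
    have "form (Suc n) H y = form n H y + (\<Sum>i<n. cnj (y i) * H i n) * y n
        + cnj (y n) * (\<Sum>j<n. H n j * y j) + cnj (y n) * H n n * y n"
      unfolding form_def by (simp add: sum.distrib sum_distrib_left sum_distrib_right mult.assoc)
    also have "form n H y = form n H x"
      unfolding form_def by (intro sum.cong refl) (simp add: yx)
    finally have "form (Suc n) H y = form n H x - cnj S * S / H n n"
      unfolding col row using alg by (simp add: add.assoc)
    also have "\<dots> = form n (\<lambda>i j. H i j - H i n * cnj (H j n) / H n n) x"
    proof -
      have "cnj S = (\<Sum>i<n. cnj (x i) * H i n)" by (simp add: S_def mult.commute)
      then have "cnj S * S / H n n = (\<Sum>i<n. \<Sum>j<n. cnj (x i) * (H i n * cnj (H j n) / H n n) * x j)"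
        unfolding S_def sum_product sum_divide_distrib
        by (simp only: sum_product sum_divide_distrib) (intro sum.cong refl, simp add: ac_simps)
      then show ?thesis
        unfolding form_def by (simp add: algebra_simps sum_subtractf)
    qed
    finally have eq: "form n (\<lambda>i j. H i j - H i n * cnj (H j n) / H n n) x = form (Suc n) H y" by simp
    obtain i where "i < n" "x i \<noteq> 0" using x by blast
    then have "i < Suc n" "y i \<noteq> 0" by (auto simp: y_def)
    then show "Re (form n (\<lambda>i j. H i j - H i n * cnj (H j n) / H n n) x) > 0"
      unfolding eq using H unfolding posd_def by blast
  qed
qed

text \<open>Splitting off the last column leaves the Schur complement for the induction. The
  factorisation serves to turn a trace against a positive matrix into a sum of values of a
  form.\<close>

lemma posd_cholesky:
  assumes "posd n H"
  shows "\<exists>V. \<forall>i<n. \<forall>j<n. H i j = (\<Sum>k<n. V i k * cnj (V j k))"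
  using assms
proof (induction n arbitrary: H)
  case (Suc n)
  obtain V where V: "\<And>i j. i < n \<Longrightarrow> j < n \<Longrightarrow>
      H i j - H i n * cnj (H j n) / H n n = (\<Sum>k<n. V i k * cnj (V j k))"
    using Suc.IH[OF posd_schur_complement[OF Suc.prems]] by blast
  define d where "d = Re (H n n)"
  have d: "H n n = of_real d" "d > 0"
    using posd_diag[OF Suc.prems, of n] by (auto simp: d_def complex_eq_iff)
  have sq: "complex_of_real (sqrt d) * of_real (sqrt d) = of_real d"
    using d by (simp flip: of_real_mult)
  have herm: "H j i = cnj (H i j)" if "i < Suc n" "j < Suc n" for i j
    using Suc.prems that unfolding posd_def by blast
  define U where "U i k = (if k = n then H i n / of_real (sqrt d) else if i = n then 0 else V i k)" for i k
  have s0: "complex_of_real (sqrt d) \<noteq> 0" using d by simp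
  have "H i j = (\<Sum>k<Suc n. U i k * cnj (U j k))" if ij: "i < Suc n" "j < Suc n" for i j
  proof -
    have last: "U i n * cnj (U j n) = H i n * cnj (H j n) / H n n"
      by (simp add: U_def d sq)
    consider "i < n" "j < n" | "i = n" | "j = n" using ij by linarith
    then show ?thesis
    proof cases
      case 1
      then have "(\<Sum>k<n. U i k * cnj (U j k)) = (\<Sum>k<n. V i k * cnj (V j k))"
        by (intro sum.cong) (auto simp: U_def)
      with V[OF 1] last show ?thesis by (simp add: diff_eq_eq)
    next
      case 2
      then have "(\<Sum>k<n. U i k * cnj (U j k)) = 0"
        by (intro sum.neutral) (auto simp: U_def)
      with last 2 d herm[of j n] ij show ?thesis by simp
    next
      case 3
      then have "(\<Sum>k<n. U i k * cnj (U j k)) = 0"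
        by (intro sum.neutral) (auto simp: U_def)
      with last 3 d herm[of j n] ij show ?thesis by simp
    qed
  qed
  then show ?case by blast
qed simp

lemma tr_adj_mm_form: "tr n (mm n (adj W) (mm n H W)) = (\<Sum>k<n. form n H (\<lambda>i. W i k))"
  unfolding tr_def mm_def adj_def form_def
  by (intro sum.cong refl) (auto simp: sum_distrib_left mult.assoc)

text \<open>With N = V V* the trace is the sum of the values of the form \<open>H\<close> at the
  columns of Y V. If it vanishes then Y V = 0, hence Y N = 0, and positivity of \<open>N\<close>
  applied to the conjugated rows of \<open>Y\<close> gives Y = 0.\<close>

lemma posd_trace:
  assumes N: "posd n N" "supported n N" and H: "posd n H"
  shows "Re (tr n (mm n N (mm n (adj Y) (mm n H Y)))) \<ge> 0" (is "?t \<ge> 0")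
    and "Re (tr n (mm n N (mm n (adj Y) (mm n H Y)))) = 0 \<Longrightarrow> i < n \<Longrightarrow> j < n \<Longrightarrow> Y i j = 0"
proof -
  obtain V where V: "\<And>i j. i < n \<Longrightarrow> j < n \<Longrightarrow> N i j = (\<Sum>k<n. V i k * cnj (V j k))"
    using posd_cholesky[OF N(1)] by blast
  have NV: "N = mm n V (adj V)"
    by (rule supported_eqI[OF N(2) supported_mm]) (simp add: V mm_def adj_def)
  define W where "W = mm n Y V"
  have "tr n (mm n N (mm n (adj Y) (mm n H Y))) = tr n (mm n (adj W) (mm n H W))"
    unfolding NV W_def adj_mm mm_assoc by (subst tr_mm_commute) (simp only: mm_assoc)
  then have eq: "?t = (\<Sum>k<n. Re (form n H (\<lambda>i. W i k)))" by (simp add: tr_adj_mm_form)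
  show "?t \<ge> 0" unfolding eq by (intro sum_nonneg posd_form_nonneg H)
  assume t0: "?t = 0" and ij: "i < n" "j < n"
  have "\<forall>k\<in>{..<n}. Re (form n H (\<lambda>i. W i k)) = 0"
    using t0 posd_form_nonneg[OF H] unfolding eq by (subst (asm) sum_nonneg_eq_0_iff) auto
  then have "W i k = 0" if "i < n" "k < n" for i k
    using posd_form_eq_0[OF H _ that(1), of "\<lambda>i. W i k"] that(2) by auto
  then have "W = 0"
    by (intro ext) (metis W_def supported_def supported_mm zero_fun_def)
  then have YN: "mm n Y N = 0"
    unfolding NV mm_assoc[symmetric] W_def[symmetric] by (intro ext) (simp add: mm_def)
  have "form n N (\<lambda>k. cnj (Y i k)) = (\<Sum>q<n. (\<Sum>p<n. Y i p * N p q) * cnj (Y i q))"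
    unfolding form_def by (subst sum.swap) (simp add: sum_distrib_right)
  also have "\<dots> = (\<Sum>q<n. mm n Y N i q * cnj (Y i q))"
    using ij by (intro sum.cong) (auto simp: mm_def)
  also have "\<dots> = 0" by (simp add: YN)
  finally have "cnj (Y i j) = 0"
    using posd_form_eq_0[OF N(1) _ ij(2), of "\<lambda>k. cnj (Y i k)"] by simp
  then show "Y i j = 0" by simp
qed

section \<open>Wirtinger calculus for matrix-valued functions\<close>

definition mwirt :: "nat \<Rightarrow> (complex \<Rightarrow> fmat) \<Rightarrow> fmat \<Rightarrow> fmat \<Rightarrow> complex \<Rightarrow> bool" where
  "mwirt n M Mz Mb u \<longleftrightarrow> (\<forall>i<n. \<forall>j<n. has_wirt (\<lambda>v. M v i j) (Mz i j) (Mb i j) u)"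

lemma mwirt_mm:
  assumes "mwirt n M Mz Mb u" "mwirt n N Nz Nb u"
  shows "mwirt n (\<lambda>v. mm n (M v) (N v)) (mm n Mz (N u) + mm n (M u) Nz) (mm n Mb (N u) + mm n (M u) Nb) u"
  unfolding mwirt_def
proof (intro allI impI)
  fix i j assume ij: "i < n" "j < n"
  have "has_wirt (\<lambda>v. \<Sum>k<n. M v i k * N v k j)
      (\<Sum>k<n. Mz i k * N u k j + M u i k * Nz k j) (\<Sum>k<n. Mb i k * N u k j + M u i k * Nb k j) u"
    by (intro has_wirt_sum has_wirt_mult) (use assms ij in \<open>auto simp: mwirt_def\<close>)
  then show "has_wirt (\<lambda>v. mm n (M v) (N v) i j) ((mm n Mz (N u) + mm n (M u) Nz) i j)
      ((mm n Mb (N u) + mm n (M u) Nb) i j) u"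
    using ij by (simp add: mm_def sum.distrib)
qed

lemma mwirt_add:
  "mwirt n M Mz Mb u \<Longrightarrow> mwirt n N Nz Nb u \<Longrightarrow> mwirt n (\<lambda>v. M v + N v) (Mz + Nz) (Mb + Nb) u"
  by (simp add: mwirt_def has_wirt_add)

lemma mwirt_sharp:
  assumes "mwirt n M Mz Mb u"
  shows "mwirt n (\<lambda>v. sharp n z (M v)) (sharp n z Mz) (sharp n z Mb) u"
  unfolding mwirt_def
proof (intro allI impI)
  fix i j assume "i < n" "j < n"
  moreover from this have "n - 1 - j < n" "n - 1 - i < n" by auto
  ultimately show "has_wirt (\<lambda>v. sharp n z (M v) i j) (sharp n z Mz i j) (sharp n z Mb i j) u"
    using assms has_wirt_cmult unfolding mwirt_def sharp_def by simp
qed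

lemma mwirt_tr:
  assumes "mwirt n M Mz Mb u"
  shows "has_wirt (\<lambda>v. tr n (M v)) (tr n Mz) (tr n Mb) u"
  unfolding tr_def by (intro has_wirt_sum) (use assms in \<open>auto simp: mwirt_def\<close>)

lemma mwirt_unique:
  assumes "mwirt n M Mz Mb u" "mwirt n M Mz' Mb' u" "i < n" "j < n"
  shows "Mz i j = Mz' i j" "Mb i j = Mb' i j"
proof -
  have "has_wirt (\<lambda>v. M v i j) (Mz i j) (Mb i j) u" "has_wirt (\<lambda>v. M v i j) (Mz' i j) (Mb' i j) u"
    using assms by (simp_all add: mwirt_def)
  then show "Mz i j = Mz' i j" "Mb i j = Mb' i j" by (rule has_wirt_unique)+
qed

lemma has_wirt_Re:
  assumes "has_wirt f a (cnj a) u"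
  shows "((\<lambda>v. Re (f v)) has_derivative (\<lambda>h. 2 * Re (a * h))) (at u)"
  using has_derivative_Re[OF assms[unfolded has_wirt_def]]
  by (rule has_derivative_eq_rhs) (simp add: algebra_simps)

section \<open>Local solutions of the Hitchin equation\<close>

text \<open>\<open>H\<close> is the Gram matrix, \<open>A = H\<^sup>-\<^sup>1 \<partial>H\<close> the connection form, and \<open>P = H\<^sup>-\<^sup>1 \<phi>\<^sup>\<dagger> H\<close> the adjoint of \<open>\<phi>\<close>;
  \<open>dA\<close> is the Hitchin equation \<open>\<partial>bar A = [\<phi>, P]\<close>.\<close>

locale local_hitchin =
  fixes n :: nat and W :: "complex set" and \<phi> H A P :: "complex \<Rightarrow> fmat"
  assumes open_W: "open W"
    and posd_H: "u \<in> W \<Longrightarrow> posd n (H u)"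
    and supp_H: "supported n (H u)"
    and supp_P: "supported n (P u)"
    and HP: "u \<in> W \<Longrightarrow> mm n (H u) (P u) = mm n (adj (\<phi> u)) (H u)"
    and dH: "u \<in> W \<Longrightarrow> mwirt n H (mm n (H u) (A u)) (mm n (adj (A u)) (H u)) u"
    and dA: "u \<in> W \<Longrightarrow> \<exists>a. mwirt n A a (mm n (\<phi> u) (P u) - mm n (P u) (\<phi> u)) u"

lemma posd_adj: "posd n H \<Longrightarrow> supported n H \<Longrightarrow> adj H = H"
  by (intro ext) (metis adj_def complex_cnj_zero posd_def supported_def)

text \<open>Bochner formula for the trace of the comparison of \<open>H\<close> with the metric dual to it under \<open>sharp\<close>.\<close>

lemma (in local_hitchin) bochner:
  assumes z: "cmod z = 1" and \<phi>: "\<And>u. u \<in> W \<Longrightarrow> sharp n z (\<phi> u) = smul (cnj z) (\<phi> u)"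
  defines "N \<equiv> \<lambda>u. sharp n z (H u)"
    and "Y \<equiv> \<lambda>u. A u + sharp n z (A u)"
    and "Z \<equiv> \<lambda>u. P u - smul (cnj z) (sharp n z (P u))"
  shows "has_lap W (\<lambda>u. Re (tr n (mm n (N u) (H u)))) (\<lambda>u. tr n (mm n (mm n (N u) (H u)) (Y u)))
     (\<lambda>u. Re (tr n (mm n (N u) (mm n (adj (Y u)) (mm n (H u) (Y u)))))
        + Re (tr n (mm n (N u) (mm n (adj (Z u)) (mm n (H u) (Z u))))))"
  unfolding has_lap_def
proof (intro ballI conjI)
  fix u assume u: "u \<in> W"
  have zz: "z * cnj z = 1" using z by (simp add: complex_norm_square[symmetric])
  have adjH: "adj (H u) = H u" by (rule posd_adj[OF posd_H[OF u] supp_H])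
  have adjN: "adj (N u) = N u" unfolding N_def sharp_adj[symmetric] adjH ..
  define C where "C = mm n (\<phi> u) (P u) - mm n (P u) (\<phi> u)"
  \<comment> \<open>As \<open>sharp\<close> reverses products, the connection term of
    \<open>N\<close> stands on the left. By cyclicity the trace of N H then collects A + sharp A,
    which is \<open>Y\<close>.\<close>
  have dN: "mwirt n N (mm n (sharp n z (A u)) (N u)) (mm n (N u) (adj (sharp n z (A u)))) u"
    using mwirt_sharp[OF dH[OF u], of z] unfolding sharp_mm[OF z] sharp_adj N_def .
  have dK: "mwirt n (\<lambda>u. mm n (N u) (H u))
      (mm n (mm n (sharp n z (A u)) (N u)) (H u) + mm n (N u) (mm n (H u) (A u)))
      (mm n (N u) (mm n (adj (Y u)) (H u))) u"
    using mwirt_mm[OF dN dH[OF u]] by (simp add: Y_def adj_add mm_add_left mm_add_right mm_assoc add.commute)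
  have 1: "tr n (mm n (mm n (sharp n z (A u)) (N u)) (H u) + mm n (N u) (mm n (H u) (A u)))
      = tr n (mm n (mm n (N u) (H u)) (Y u))"
    using tr_mm_commute[of n "sharp n z (A u)" "mm n (N u) (H u)"]
    by (simp add: Y_def tr_add mm_add_right mm_assoc add.commute)
  have 2: "tr n (mm n (N u) (mm n (adj (Y u)) (H u))) = cnj (tr n (mm n (mm n (N u) (H u)) (Y u)))"
    unfolding tr_adj[symmetric] adj_mm adjN adjH
    using tr_mm_commute[of n "N u" "mm n (adj (Y u)) (H u)"] by (simp add: mm_assoc)
  show "((\<lambda>u. Re (tr n (mm n (N u) (H u)))) has_derivative
      (\<lambda>h. 2 * Re (tr n (mm n (mm n (N u) (H u)) (Y u)) * h))) (at u)"
    using mwirt_tr[OF dK] unfolding 1 2 by (rule has_wirt_Re)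
  obtain a where a: "mwirt n A a C u" using dA[OF u] unfolding C_def by blast
  have dY: "mwirt n Y (a + sharp n z a) (C + sharp n z C) u"
    unfolding Y_def by (intro mwirt_add a mwirt_sharp)
  \<comment> \<open>Reversing products changes the sign of a commutator, and the phase of \<phi> is
    passed on to the adjoint. This is why the sum in \<open>Y\<close> goes with the difference in
    \<open>Z\<close>.\<close>
  have CZ: "C + sharp n z C = mm n (\<phi> u) (Z u) - mm n (Z u) (\<phi> u)"
    unfolding C_def sharp_diff sharp_mm[OF z] \<phi>[OF u] Z_def
    by (simp add: mm_smul_left mm_smul_right mm_diff_left mm_diff_right) 
  have PH: "mm n (adj (P u)) (H u) = mm n (H u) (\<phi> u)"
    using arg_cong[OF HP[OF u], of adj] by (simp add: adj_mm adj_adj adjH)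
  have NP: "mm n (N u) (adj (sharp n z (P u))) = smul (cnj z) (mm n (\<phi> u) (N u))"
    using arg_cong[OF PH, of "sharp n z"] unfolding sharp_mm[OF z] \<phi>[OF u]
    by (simp add: N_def sharp_adj mm_smul_left)
  have NZ: "mm n (N u) (mm n (adj (Z u)) (H u)) = mm n (N u) (mm n (H u) (\<phi> u)) - mm n (\<phi> u) (mm n (N u) (H u))"
  proof -
    have "mm n (N u) (mm n (adj (Z u)) (H u)) = mm n (N u) (mm n (adj (P u)) (H u))
        - smul z (mm n (mm n (N u) (adj (sharp n z (P u)))) (H u))"
      by (simp add: Z_def adj_diff adj_smul mm_diff_left mm_diff_right mm_smul_left mm_smul_right mm_assoc)
    then show ?thesis unfolding PH NP by (simp add: mm_smul_left smul_smul zz smul_one mm_assoc)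
  qed
  \<comment> \<open>By cyclicity the trace against the commutator of \<phi> and \<open>Z\<close>
    becomes the trace of (N H \<phi> - \<phi> N H) Z, and \<open>NZ\<close> identifies the bracket
    as N Z* H: the curvature term is a square.\<close>
  have "tr n (mm n (mm n (N u) (H u)) (C + sharp n z C)) = tr n (mm n (mm n (N u) (mm n (adj (Z u)) (H u))) (Z u))"
    unfolding CZ NZ
    using tr_mm_commute[of n "\<phi> u" "mm n (N u) (mm n (H u) (Z u))"]
    by (simp add: mm_diff_left mm_diff_right tr_diff mm_assoc)
  then have "tr n (mm n (mm n (N u) (mm n (adj (Y u)) (H u))) (Y u) + mm n (mm n (N u) (H u)) (C + sharp n z C))
      = tr n (mm n (N u) (mm n (adj (Y u)) (mm n (H u) (Y u))))
        + tr n (mm n (N u) (mm n (adj (Z u)) (mm n (H u) (Z u))))"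
    by (simp add: tr_add mm_assoc)
  note eq = this
  show "\<exists>a b. has_wirt (\<lambda>u. tr n (mm n (mm n (N u) (H u)) (Y u))) a b u \<and>
      Re b = Re (tr n (mm n (N u) (mm n (adj (Y u)) (mm n (H u) (Y u)))))
        + Re (tr n (mm n (N u) (mm n (adj (Z u)) (mm n (H u) (Z u)))))"
    by (rule exI, rule exI, rule conjI, rule mwirt_tr[OF mwirt_mm[OF dK dY]])
      (simp only: eq plus_complex.simps)
qed

section \<open>Scalar inequalities\<close>

lemma ln_upper_quadratic:
  fixes b :: real
  assumes "b > 0"
  shows "b - 1 - ln b \<le> (b - 1)\<^sup>2 / b"
proof -
  have "ln (1 / b) \<le> 1 / b - 1" using assms by (intro ln_le_minus_one) auto
  then have "b - 1 - ln b \<le> b - 2 + 1 / b" using assms by (simp add: ln_div)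
  also have "\<dots> = (b - 1)\<^sup>2 / b" using assms by (simp add: field_simps power2_eq_square)
  finally show ?thesis .
qed

text \<open>Applying ln s \<le> s - 1 to s = sqrt b leaves exactly (s - 1)^2, and b - 1 = (s + 1) (s
  - 1).\<close>

lemma ln_lower_quadratic:
  fixes b :: real
  assumes "b > 0" "b \<le> B"
  shows "(b - 1)\<^sup>2 \<le> (1 + sqrt B)\<^sup>2 * (b - 1 - ln b)"
proof -
  define s where "s = sqrt b"
  have s: "s > 0" "b = s\<^sup>2" "s \<le> sqrt B" using assms by (auto simp: s_def)
  have "ln b = 2 * ln s" using s by (simp add: ln_realpow)
  also have "\<dots> \<le> 2 * (s - 1)" using ln_le_minus_one[OF s(1)] by simp
  finally have 1: "(s - 1)\<^sup>2 \<le> b - 1 - ln b" using s(2) by (simp add: power2_diff)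
  have "(b - 1)\<^sup>2 = (1 + s)\<^sup>2 * (s - 1)\<^sup>2" unfolding s(2) by (simp add: power2_eq_square algebra_simps)
  also have "\<dots> \<le> (1 + sqrt B)\<^sup>2 * (b - 1 - ln b)"
    using s 1 by (intro mult_mono power_mono) auto
  finally show ?thesis .
qed

lemma steps_bound:
  fixes b :: "nat \<Rightarrow> real"
  assumes "\<And>j. Suc j < m \<Longrightarrow> \<bar>b (Suc j) - b j\<bar> \<le> e" "i \<le> j" "j < m"
  shows "\<bar>b j - b i\<bar> \<le> (real j - real i) * e"
  using assms(2,3)
proof (induction j rule: dec_induct)
  case (step k)
  have "\<bar>b (Suc k) - b i\<bar> \<le> \<bar>b (Suc k) - b k\<bar> + \<bar>b k - b i\<bar>" by simp
  with step assms(1)[of k] show ?case by (simp add: algebra_simps)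
qed simp

text \<open>The logarithms sum to 0, so \<open>k\<close> is the sum of the nonnegative numbers b j -
  1 - ln (b j), each comparable to (b j - 1)^2. Some \<open>b j\<close> is at most 1 and some is at
  least 1, so all deviations from 1 are at most the oscillation, which is at most m e.\<close>

lemma product_one_bounds:
  fixes b :: "nat \<Rightarrow> real"
  assumes pos: "\<And>j. j < m \<Longrightarrow> b j > 0" and prod: "(\<Prod>j<m. b j) = 1"
    and step: "\<And>j. Suc j < m \<Longrightarrow> \<bar>b (Suc j) - b j\<bar> \<le> e" and "e \<ge> 0" and "m \<ge> 1"
  defines "k \<equiv> (\<Sum>j<m. b j) - m"
  shows "0 \<le> k" and "k \<le> 2 * real m ^ 3 * e\<^sup>2" and "k\<^sup>2 \<le> real m ^ 4 * e\<^sup>2"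
    and "j < m \<Longrightarrow> (b j - 1)\<^sup>2 \<le> (1 + sqrt (k + m))\<^sup>2 * k"
proof -
  have "(\<Sum>j<m. ln (b j)) = ln (\<Prod>j<m. b j)"
    using pos by (subst ln_prod) (auto simp: less_imp_neq[symmetric])
  then have sl: "(\<Sum>j<m. ln (b j)) = 0" by (simp add: prod)
  then have k: "k = (\<Sum>j<m. b j - 1 - ln (b j))"
    by (simp add: k_def sum_subtractf)
  have nn: "b j - 1 - ln (b j) \<ge> 0" if "j < m" for j
    using ln_le_minus_one[OF pos[OF that]] by simp
  show k0: "0 \<le> k" unfolding k using nn by (intro sum_nonneg) auto
  define w where "w = real m * e"
  have w0: "w \<ge> 0" using assms by (simp add: w_def)
  have osc: "\<bar>b j - b i\<bar> \<le> w" if "i < m" "j < m" for i j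
  proof -
    have *: "\<bar>b j - b i\<bar> \<le> w" if "i \<le> j" "j < m" for i j
    proof -
      have "\<bar>b j - b i\<bar> \<le> (real j - real i) * e" using steps_bound[of m b e i j] step that by blast
      also have "\<dots> \<le> real m * e" using that \<open>e \<ge> 0\<close> by (intro mult_right_mono) auto
      finally show ?thesis by (simp add: w_def)
    qed
    show ?thesis using *[of i j] *[of j i] that by (cases "i \<le> j") (auto simp: abs_minus_commute)
  qed
  have low: "\<exists>i<m. b i \<le> 1"
  proof (rule ccontr)
    assume "\<not> ?thesis"
    then have "(\<Sum>j<m. ln (b j)) > 0" using \<open>m \<ge> 1\<close> by (intro sum_pos) (auto simp: not_le lessThan_empty_iff)
    with sl show False by simp
  qed
  have high: "\<exists>i<m. b i \<ge> 1"
  proof (rule ccontr)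
    assume "\<not> ?thesis"
    then have "(\<Sum>j<m. - ln (b j)) > 0" using \<open>m \<ge> 1\<close> pos by (intro sum_pos) (auto simp: not_le lessThan_empty_iff)
    with sl show False by (simp add: sum_negf)
  qed
  have dev: "\<bar>b j - 1\<bar> \<le> w" if j: "j < m" for j
  proof -
    obtain p q where "p < m" "b p \<le> 1" "q < m" "b q \<ge> 1" using low high by blast
    with osc[OF _ j, of p] osc[OF _ j, of q] show ?thesis by (simp add: abs_le_iff)
  qed
  have "k = (\<Sum>j<m. b j - 1)" by (simp add: k_def sum_subtractf)
  also have "\<dots> \<le> (\<Sum>j<m. w)" using dev by (intro sum_mono) (auto simp: abs_le_iff)
  finally have kw: "k \<le> real m * w" by simp
  show "k\<^sup>2 \<le> real m ^ 4 * e\<^sup>2"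
  proof -
    have "k\<^sup>2 \<le> (real m * w)\<^sup>2" using kw k0 by (intro power_mono) auto
    also have "\<dots> = real m ^ 4 * e\<^sup>2" by (simp add: w_def power_mult_distrib power2_eq_square eval_nat_numeral)
    finally show ?thesis .
  qed
  have "k \<le> 2 * real m * w\<^sup>2"
  \<comment> \<open>For small oscillation the \<open>b j\<close> stay above 1 / 2 and the quadratic
    estimate applies; otherwise 1 < 2 w turns the linear bound m w into a quadratic one.\<close>
  proof (cases "w \<le> 1 / 2")
    case True
    have "b j - 1 - ln (b j) \<le> 2 * w\<^sup>2" if j: "j < m" for j
    proof -
      have b: "b j \<ge> 1 / 2" using dev[OF j] True by (simp add: abs_le_iff)
      have "b j - 1 - ln (b j) \<le> (b j - 1)\<^sup>2 / b j" by (rule ln_upper_quadratic[OF pos[OF j]])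
      also have "\<dots> \<le> w\<^sup>2 / (1 / 2)"
        using b dev[OF j] by (intro frac_le) (auto simp: abs_le_square_iff[symmetric] w0)
      finally show ?thesis by simp
    qed
    then have "k \<le> (\<Sum>j<m. 2 * w\<^sup>2)" unfolding k by (intro sum_mono) auto
    then show ?thesis by simp
  next
    case False
    then have "real m * w * 1 \<le> real m * w * (2 * w)" using w0 by (intro mult_left_mono) auto
    with kw show ?thesis by (simp add: power2_eq_square)
  qed
  then show "k \<le> 2 * real m ^ 3 * e\<^sup>2"
    by (simp add: w_def power_mult_distrib power2_eq_square power3_eq_cube mult.assoc mult.left_commute)
  assume j: "j < m"
  have "b j \<le> (\<Sum>j<m. b j)" using pos j by (intro member_le_sum) (auto simp: less_imp_le)
  then have "b j \<le> k + m" by (simp add: k_def)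
  from ln_lower_quadratic[OF pos[OF j] this]
  have "(b j - 1)\<^sup>2 \<le> (1 + sqrt (k + m))\<^sup>2 * (b j - 1 - ln (b j))" .
  also have "\<dots> \<le> (1 + sqrt (k + m))\<^sup>2 * k"
    unfolding k using nn j by (intro mult_left_mono member_le_sum) auto
  finally show "(b j - 1)\<^sup>2 \<le> (1 + sqrt (k + m))\<^sup>2 * k" .
qed

text \<open>The entries of \<open>H P = \<phi>\<^sup>\<dagger> H\<close> in the two-dimensional block of indices \<open>0\<close> and \<open>n - 1\<close>, where
  \<open>H\<close> has diagonal entries \<open>a\<close>, \<open>d\<close> and off-diagonal entry \<open>b\<close>.\<close>

lemma corner_block:
  fixes a d h1 h2 :: real and b x y \<alpha> :: complex
  assumes pos: "a > 0" "d > 0" "h1 > 0" "h2 > 0" "(cmod b)\<^sup>2 < a * d" and \<alpha>: "\<alpha> \<noteq> 0"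
    and e1: "of_real a * x + b * y = of_real h1"
    and e2: "cnj b * x + of_real d * y = cnj \<alpha> * of_real h1"
    and e3: "of_real h2 * x = of_real d + cnj \<alpha> * b"
    and e4: "of_real h2 * y = cnj b + cnj \<alpha> * of_real a"
  shows "\<exists>X Y. X > 0 \<and> Y > 0 \<and> x = of_real X \<and> \<alpha> * y = of_real Y \<and> Y * X * h2 = (cmod \<alpha>)\<^sup>2 * h1"
proof -
  define r where "r = Re (cnj \<alpha> * b)"
  define s where "s = (cmod \<alpha>)\<^sup>2"
  have s: "s > 0" using \<alpha> by (simp add: s_def)
  have s_eq: "\<alpha> * cnj \<alpha> = of_real s" unfolding s_def by (rule complex_norm_square[symmetric])
  have b_eq: "b * cnj b = of_real ((cmod b)\<^sup>2)" by (rule complex_norm_square[symmetric])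
  have "of_real h2 * (of_real a * x + b * y) = of_real a * (of_real h2 * x) + b * (of_real h2 * y)"
    by (simp add: algebra_simps)
  also have "\<dots> = of_real (a * d) + of_real (2 * a) * (cnj \<alpha> * b) + b * cnj b"
    unfolding e3 e4 by (simp add: algebra_simps)
  finally have 1: "of_real (h1 * h2) = of_real (a * d) + of_real (2 * a) * (cnj \<alpha> * b) + of_real ((cmod b)\<^sup>2)"
    unfolding e1 b_eq by (simp add: mult.commute)
  \<comment> \<open>The left side of \<open>1\<close> is real, and so are all terms on the right
    except the middle one, whose imaginary part must therefore vanish.\<close>
  have "Im (of_real (a * d) + of_real (2 * a) * t + of_real ((cmod b)\<^sup>2)) = 2 * a * Im t" for t
    by simp
  from this[of "cnj \<alpha> * b"] have "2 * a * Im (cnj \<alpha> * b) = 0"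
    unfolding 1[symmetric] by (simp only: Im_complex_of_real)
  then have "Im (cnj \<alpha> * b) = 0" using pos(1) by (simp only: mult_eq_0_iff) simp
  then have r: "cnj \<alpha> * b = of_real r" by (simp add: r_def complex_eq_iff)
  have r': "\<alpha> * cnj b = of_real r" using arg_cong[OF r, of cnj] by simp
  have h12: "h1 * h2 = a * d + 2 * a * r + (cmod b)\<^sup>2"
    using 1 unfolding r of_real_mult[symmetric] of_real_add[symmetric] of_real_eq_iff .
  have rb: "r\<^sup>2 = s * (cmod b)\<^sup>2"
  proof -
    have "complex_of_real (r\<^sup>2) = (cnj \<alpha> * b) * (\<alpha> * cnj b)" unfolding r r' by (simp add: power2_eq_square)
    also have "\<dots> = (\<alpha> * cnj \<alpha>) * (b * cnj b)" by (simp only: ac_simps)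
    finally show ?thesis unfolding s_eq b_eq by (simp only: of_real_mult[symmetric] of_real_eq_iff)
  qed
  have x: "x = of_real ((d + r) / h2)"
    using e3 pos(4) unfolding r by (simp add: field_simps)
  have y: "\<alpha> * y = of_real ((r + s * a) / h2)"
  proof -
    have "of_real h2 * (\<alpha> * y) = \<alpha> * (of_real h2 * y)" by (simp only: ac_simps)
    also have "\<dots> = \<alpha> * cnj b + \<alpha> * cnj \<alpha> * of_real a" unfolding e4 by (simp only: distrib_left mult.assoc)
    finally show ?thesis unfolding r' s_eq using pos(4) by (simp add: field_simps)
  qed
  have "\<alpha> * cnj b * x + of_real d * (\<alpha> * y) = \<alpha> * cnj \<alpha> * of_real h1"
    using arg_cong[OF e2, of "\<lambda>t. \<alpha> * t"] by (simp only: distrib_left ac_simps)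
  then have "r * ((d + r) / h2) + d * ((r + s * a) / h2) = s * h1"
    unfolding r' s_eq x y by (simp only: of_real_mult[symmetric] of_real_add[symmetric] of_real_eq_iff)
  then have "(r * (d + r) + d * (r + s * a)) / h2 = s * h1"
    unfolding times_divide_eq_right add_divide_distrib[symmetric] .
  then have "r * (d + r) + d * (r + s * a) = s * (h1 * h2)"
    using pos(4) by (simp add: divide_eq_eq mult.assoc)
  \<comment> \<open>Either \<open>b\<close> vanishes, which is the case r = 0, or d = a s.\<close>
  then have key: "r * d = r * (a * s)" unfolding h12 using rb by (simp add: algebra_simps power2_eq_square)
  \<comment> \<open>If \<open>r\<close> is nonzero, then d = a s, and positivity of the determinant
    of the block gives |r| < a s.\<close>
  have pp: "d + r > 0 \<and> r + s * a > 0"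
  proof (cases "r = 0")
    case True then show ?thesis using pos s by simp
  next
    case False
    then have d: "d = a * s" using key by simp
    have "r\<^sup>2 < s * (a * d)" unfolding rb using pos(5) s by simp
    also have "\<dots> = (a * s)\<^sup>2" by (simp add: d power2_eq_square)
    finally have "\<bar>r\<bar>\<^sup>2 < (a * s)\<^sup>2" by (simp only: power2_abs)
    then have "\<bar>r\<bar> < a * s" by (rule power_less_imp_less_base) (use pos(1) s in simp)
    moreover have "s * a = a * s" by (rule mult.commute)
    ultimately show ?thesis unfolding d by linarith
  qed
  have "(r + s * a) / h2 * ((d + r) / h2) * h2 = (r + s * a) * (d + r) / h2"
    using pos(4) by simp
  also have "(r + s * a) * (d + r) = s * (h1 * h2)"
    unfolding h12 using key rb by (simp add: algebra_simps power2_eq_square)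
  also have "s * (h1 * h2) / h2 = (cmod \<alpha>)\<^sup>2 * h1" using pos(4) by (simp add: s_def)
  finally have "(r + s * a) / h2 * ((d + r) / h2) * h2 = (cmod \<alpha>)\<^sup>2 * h1" .
  moreover have "(d + r) / h2 > 0" "(r + s * a) / h2 > 0" using pp pos(4) by auto
  ultimately show ?thesis using x y by blast
qed

section \<open>The diagonal equations\<close>

definition higgs :: "nat \<Rightarrow> complex \<Rightarrow> fmat" where
  "higgs n a = (\<lambda>i j. if i < n \<and> j < n then
     if i = j + 1 then 1 else if (i, j) = (0, n - 2) \<or> (i, j) = (1, n - 1) then a else 0 else 0)"

lemma posd_cancel:
  assumes "posd n H" "mm n H Z = 0" "i < n" "j < n"
  shows "Z i j = 0"
proof -
  have "form n H (\<lambda>k. Z k j) = (\<Sum>p<n. cnj (Z p j) * mm n H Z p j)"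
    unfolding form_def using assms(4) by (simp add: mm_def sum_distrib_left mult.assoc)
  then have "Re (form n H (\<lambda>k. Z k j)) = 0" by (simp add: assms(2))
  from posd_form_eq_0[OF assms(1) this assms(3)] show ?thesis .
qed

lemma posd_minor:
  assumes "posd n H" "i < n - 1"
  shows "(cmod (H i (n - 1)))\<^sup>2 < Re (H i i) * Re (H (n - 1) (n - 1))"
proof -
  obtain p where p: "n = Suc p" using assms(2) by (cases n) auto
  have "Re (H i i - H i p * cnj (H i p) / H p p) > 0"
    using posd_diag(1)[OF posd_schur_complement[of p H], of i] assms p by simp
  moreover have "H p p = of_real (Re (H p p))" "Re (H p p) > 0"
    using posd_diag[OF assms(1), of p] p by (auto simp: complex_eq_iff)
  moreover have "H i p * cnj (H i p) / of_real (Re (H p p)) = of_real ((cmod (H i p))\<^sup>2 / Re (H p p))"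
    by (simp only: complex_norm_square[symmetric] of_real_divide)
  ultimately have "Re (H i i) - (cmod (H i p))\<^sup>2 / Re (H p p) > 0"
    by (metis Re_complex_of_real minus_complex.simps(1))
  with \<open>Re (H p p) > 0\<close> show ?thesis using p by (simp add: field_simps)
qed

text \<open>What a solution satisfies once its symmetries are known. \<open>A\<close> is diagonal,
  whereas \<open>H\<close> may have a corner entry \<open>H u 0 (n - 1)\<close>, since the phases do
  not separate the indices 0 and \<open>n - 1\<close>.\<close>

locale toda = local_hitchin +
  fixes \<alpha> :: "complex \<Rightarrow> complex"
  assumes n3: "n \<ge> 3"
    and \<alpha>_hol: "\<alpha> holomorphic_on W"
    and \<alpha>_nz: "u \<in> W \<Longrightarrow> \<alpha> u \<noteq> 0"
    and \<phi>_eq: "\<phi> u = higgs n (\<alpha> u)"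
    and A_off: "u \<in> W \<Longrightarrow> i < n \<Longrightarrow> j < n \<Longrightarrow> i \<noteq> j \<Longrightarrow> A u i j = 0"
    and P_pattern: "u \<in> W \<Longrightarrow> i < n \<Longrightarrow> j < n \<Longrightarrow> P u i j \<noteq> 0 \<Longrightarrow>
       j = i + 1 \<or> (i = n - 2 \<and> j = 0) \<or> (i = n - 1 \<and> j = 1)"
    and P_sym: "u \<in> W \<Longrightarrow> i < n \<Longrightarrow> j < n \<Longrightarrow> P u i j = P u (n - 1 - j) (n - 1 - i)"
    and P_diff: "u \<in> W \<Longrightarrow> \<exists>a b. mwirt n P a b u"
begin

text \<open>A sum of conditionals, because the row with index 1 has two nonzero entries.\<close>

lemma sum_higgs_left:
  assumes "i < n"
  shows "(\<Sum>k<n. \<phi> u i k * f k) = (if i \<ge> 1 then f (i - 1) else 0)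
    + (if i = 0 then \<alpha> u * f (n - 2) else 0) + (if i = 1 then \<alpha> u * f (n - 1) else 0)"
proof -
  have "\<phi> u i k * f k = (if k = i - 1 then if i \<ge> 1 then f k else 0 else 0)
     + (if k = n - 2 then if i = 0 then \<alpha> u * f k else 0 else 0)
     + (if k = n - 1 then if i = 1 then \<alpha> u * f k else 0 else 0)" if "k < n" for k
    using n3 assms that by (auto simp: \<phi>_eq higgs_def)
  then have "(\<Sum>k<n. \<phi> u i k * f k) = (\<Sum>k<n. (if k = i - 1 then if i \<ge> 1 then f k else 0 else 0)
     + (if k = n - 2 then if i = 0 then \<alpha> u * f k else 0 else 0)
     + (if k = n - 1 then if i = 1 then \<alpha> u * f k else 0 else 0))"
    by (intro sum.cong) auto
  also have "\<dots> = (if i \<ge> 1 then f (i - 1) else 0)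
    + (if i = 0 then \<alpha> u * f (n - 2) else 0) + (if i = 1 then \<alpha> u * f (n - 1) else 0)"
    using n3 assms by (auto simp: sum.distrib sum.delta)
  finally show ?thesis .
qed

lemma sum_higgs_right:
  assumes "i < n"
  shows "(\<Sum>k<n. f k * \<phi> u k i) = (if i + 1 < n then f (i + 1) else 0)
    + (if i = n - 2 then \<alpha> u * f 0 else 0) + (if i = n - 1 then \<alpha> u * f 1 else 0)"
proof -
  have "f k * \<phi> u k i = (if k = i + 1 then f k else 0)
     + (if k = 0 then if i = n - 2 then \<alpha> u * f k else 0 else 0)
     + (if k = 1 then if i = n - 1 then \<alpha> u * f k else 0 else 0)" if "k < n" for k
    using n3 assms that by (auto simp: \<phi>_eq higgs_def)
  then have "(\<Sum>k<n. f k * \<phi> u k i) = (\<Sum>k<n. (if k = i + 1 then f k else 0)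
     + (if k = 0 then if i = n - 2 then \<alpha> u * f k else 0 else 0)
     + (if k = 1 then if i = n - 1 then \<alpha> u * f k else 0 else 0))"
    by (intro sum.cong) auto
  also have "\<dots> = (if i + 1 < n then f (i + 1) else 0)
    + (if i = n - 2 then \<alpha> u * f 0 else 0) + (if i = n - 1 then \<alpha> u * f 1 else 0)"
    using n3 assms by (auto simp: sum.distrib sum.delta)
  finally show ?thesis .
qed

lemma sum_adjoint_right:
  assumes "u \<in> W" "j < n"
  shows "(\<Sum>k<n. f k * P u k j) = (if j \<ge> 1 then f (j - 1) * P u (j - 1) j else 0)
    + (if j = 0 then f (n - 2) * P u (n - 2) 0 else 0) + (if j = 1 then f (n - 1) * P u (n - 1) 1 else 0)"
proof -
  have "f k * P u k j = (if k = j - 1 then if j \<ge> 1 then f (j - 1) * P u (j - 1) j else 0 else 0)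
     + (if k = n - 2 then if j = 0 then f (n - 2) * P u (n - 2) 0 else 0 else 0)
     + (if k = n - 1 then if j = 1 then f (n - 1) * P u (n - 1) 1 else 0 else 0)" (is "_ = ?r k") if k: "k < n" for k
  proof -
    consider "P u k j = 0" "\<not> (k = j - 1 \<and> j \<ge> 1)" "\<not> (k = n - 2 \<and> j = 0)" "\<not> (k = n - 1 \<and> j = 1)"
      | "k = j - 1" "j \<ge> 1" | "k = n - 2" "j = 0" | "k = n - 1" "j = 1"
      using P_pattern[OF assms(1) k assms(2)] by fastforce
    then show ?thesis
    proof cases
      case 1 then show ?thesis using n3 by auto
    next
      case 2 then show ?thesis using n3 assms(2) by (cases "j = 1") auto
    next
      case 3 then show ?thesis using n3 by simp
    next
      case 4 then show ?thesis using n3 by simp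
    qed
  qed
  then have "(\<Sum>k<n. f k * P u k j) = (\<Sum>k<n. ?r k)"
    by (intro sum.cong) auto
  also have "\<dots> = (if j \<ge> 1 then f (j - 1) * P u (j - 1) j else 0)
    + (if j = 0 then f (n - 2) * P u (n - 2) 0 else 0) + (if j = 1 then f (n - 1) * P u (n - 1) 1 else 0)"
    unfolding sum.distrib sum.delta[OF finite_lessThan] using n3 assms(2) by auto
  finally show ?thesis .
qed

lemma HP_entry:
  assumes "u \<in> W" "i < n" "j < n"
  shows "(if j \<ge> 1 then H u i (j - 1) * P u (j - 1) j else 0)
    + (if j = 0 then H u i (n - 2) * P u (n - 2) 0 else 0) + (if j = 1 then H u i (n - 1) * P u (n - 1) 1 else 0)
    = (if i + 1 < n then H u (i + 1) j else 0)
    + (if i = n - 2 then cnj (\<alpha> u) * H u 0 j else 0) + (if i = n - 1 then cnj (\<alpha> u) * H u 1 j else 0)"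
proof -
  have "(\<Sum>k<n. H u i k * P u k j) = (\<Sum>k<n. cnj (\<phi> u k i) * H u k j)"
    using fun_cong[OF fun_cong[OF HP[OF assms(1)], of i], of j] assms by (simp add: mm_def adj_def)
  also have "\<dots> = cnj (\<Sum>k<n. cnj (H u k j) * \<phi> u k i)" by (simp add: mult.commute)
  finally show ?thesis
    unfolding sum_adjoint_right[OF assms(1,3)] sum_higgs_right[OF assms(2)]
    using n3 by (simp split: if_splits)
qed

definition X :: "nat \<Rightarrow> complex \<Rightarrow> real" where
  "X i u = Re (P u i (i + 1))"

definition Y :: "complex \<Rightarrow> real" where
  "Y u = Re (\<alpha> u * P u (n - 2) 0)"

lemma P_corner: "u \<in> W \<Longrightarrow> P u (n - 1) 1 = P u (n - 2) 0"
proof -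
  assume "u \<in> W"
  from P_sym[OF this, of "n - 1" 1] show ?thesis using n3 by (simp add: diff_diff_left numeral_2_eq_2)
qed

lemma X_sym:
  assumes "u \<in> W" "i < n - 1"
  shows "X (n - 2 - i) u = X i u"
proof -
  have "n - 1 - (i + 1) = n - 2 - i" "n - 1 - i = n - 2 - i + 1" using assms(2) by auto
  with P_sym[OF assms(1), of i "i + 1"] assms(2) show ?thesis by (simp add: X_def)
qed

text \<open>For 1 \<le> i < n - 2 the entry is a ratio of consecutive diagonal entries of
  \<open>H\<close>; the remaining entries come from \<open>corner_block\<close>. The ratios
  telescope in the product, whose corner part supplies |\<alpha>|^2. The product stops before
  \<open>X (n - 2)\<close>, which equals \<open>X 0\<close> by \<open>X_sym\<close>.\<close>

lemma adjoint_positive: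
  assumes u: "u \<in> W"
  shows "i < n - 1 \<Longrightarrow> X i u > 0 \<and> P u i (i + 1) = of_real (X i u)"
    and "Y u > 0" and "\<alpha> u * P u (n - 2) 0 = of_real (Y u)"
    and "Y u * (\<Prod>i<n - 2. X i u) = (cmod (\<alpha> u))\<^sup>2"
proof -
  define h where "h i = Re (H u i i)" for i
  have h: "h i > 0" "H u i i = of_real (h i)" if "i < n" for i
    using posd_diag[OF posd_H[OF u] that] by (auto simp: h_def complex_eq_iff)
  note e = HP_entry[OF u]
  have herm: "H u (n - 1) 0 = cnj (H u 0 (n - 1))"
  proof -
    have "0 < n" "n - 1 < n" using n3 by auto
    then show ?thesis using posd_H[OF u] unfolding posd_def by blast
  qed
  have x0: "P u (n - 2) (n - 1) = P u 0 1"
    using P_sym[OF u, of 0 1] n3 by (simp add: diff_diff_left numeral_2_eq_2)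
  have "\<exists>X Y. X > 0 \<and> Y > 0 \<and> P u 0 1 = of_real X \<and> \<alpha> u * P u (n - 2) 0 = of_real Y
      \<and> Y * X * h (n - 2) = (cmod (\<alpha> u))\<^sup>2 * h 1"
  proof (rule corner_block)
    show "h 0 > 0" "h (n - 1) > 0" "h 1 > 0" "h (n - 2) > 0" using h n3 by auto
    show "(cmod (H u 0 (n - 1)))\<^sup>2 < h 0 * h (n - 1)"
      using posd_minor[OF posd_H[OF u], of 0] n3 by (simp add: h_def)
    show "\<alpha> u \<noteq> 0" by (rule \<alpha>_nz[OF u])
    show "of_real (h 0) * P u 0 1 + H u 0 (n - 1) * P u (n - 2) 0 = of_real (h 1)"
      using e[of 0 1] h[of 0] h[of 1] n3 P_corner[OF u] by simp
    show "cnj (H u 0 (n - 1)) * P u 0 1 + of_real (h (n - 1)) * P u (n - 2) 0 = cnj (\<alpha> u) * of_real (h 1)"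
      using e[of "n - 1" 1] h[of "n - 1"] h[of 1] n3 P_corner[OF u] herm by (simp split: if_splits)
    show "of_real (h (n - 2)) * P u 0 1 = of_real (h (n - 1)) + cnj (\<alpha> u) * H u 0 (n - 1)"
    proof -
      have "n - 1 - 1 = n - 2" "n - 2 + 1 = n - 1" "n - 2 \<noteq> n - 1" "n - 1 \<noteq> 1" "n - 1 \<noteq> 0" "n - 1 \<ge> 1" "n - 1 < n" using n3 by auto
      then show ?thesis using e[of "n - 2" "n - 1"] h(2)[of "n - 2"] h(2)[of "n - 1"] n3 x0 by simp
    qed
    show "of_real (h (n - 2)) * P u (n - 2) 0 = cnj (H u 0 (n - 1)) + cnj (\<alpha> u) * of_real (h 0)"
    proof -
      have "n - 2 + 1 = n - 1" "n - 2 \<noteq> n - 1" "n - 1 < n" using n3 by auto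
      then show ?thesis using e[of "n - 2" 0] h(2)[of "n - 2"] h(2)[of 0] n3 herm by simp
    qed
  qed
  then obtain X0 Y0 where xy: "X0 > 0" "Y0 > 0" "P u 0 1 = of_real X0" "\<alpha> u * P u (n - 2) 0 = of_real Y0"
      "Y0 * X0 * h (n - 2) = (cmod (\<alpha> u))\<^sup>2 * h 1" by blast
  have X0: "X 0 u = X0" using xy(3) by (simp add: X_def)
  have Y0: "Y u = Y0" using xy(4) by (simp add: Y_def)
  show "Y u > 0" "\<alpha> u * P u (n - 2) 0 = of_real (Y u)" using xy Y0 by simp_all
  have mid: "P u i (i + 1) = of_real (h (i + 1) / h i)" if i: "1 \<le> i" "i < n - 2" for i
  proof -
    have "H u i i * P u i (i + 1) = H u (i + 1) (i + 1)"
      using e[of i "i + 1"] i n3 by (simp split: if_splits)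
    moreover have "i < n" "i + 1 < n" using i by auto
    ultimately show ?thesis using h[of i] h(2)[of "i + 1"] by (simp add: field_simps)
  qed
  have Xmid: "X i u = h (i + 1) / h i" if "1 \<le> i" "i < n - 2" for i
    unfolding X_def mid[OF that] by simp
  show "X i u > 0 \<and> P u i (i + 1) = of_real (X i u)" if i: "i < n - 1"
  proof -
    consider "i = 0" | "1 \<le> i" "i < n - 2" | "i = n - 2" using i by linarith
    then show ?thesis
    proof cases
      case 1 then show ?thesis using xy X0 by simp
    next
      case 2
      then have "h (i + 1) > 0" "h i > 0" using h by auto
      then show ?thesis unfolding Xmid[OF 2] mid[OF 2] by simp
    next
      case 3
      then have "i + 1 = n - 1" using n3 by simp
      then show ?thesis using x0 xy 3 by (simp add: X_def)
    qed
  qed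
  have "h 1 * (\<Prod>i=1..<k. X i u) = h k" if "1 \<le> k" "k \<le> n - 2" for k
    using that
  proof (induction k rule: dec_induct)
    case (step k)
    then have "(\<Prod>i=1..<Suc k. X i u) = (\<Prod>i=1..<k. X i u) * (h (k + 1) / h k)"
      using Xmid[of k] by (simp add: prod.atLeastLessThan_Suc)
    moreover have "h k > 0" using h step by auto
    moreover have "h 1 * (\<Prod>i=1..<k. X i u) = h k" using step by simp
    ultimately have "h 1 * (\<Prod>i=1..<Suc k. X i u) = h k * (h (k + 1) / h k)"
      by (simp only: mult.assoc[symmetric])
    then show ?case using \<open>h k > 0\<close> by simp
  qed simp
  from this[of "n - 2"] have tele: "h 1 * (\<Prod>i=1..<n - 2. X i u) = h (n - 2)" using n3 by simp
  have "(\<Prod>i<n - 2. X i u) = X 0 u * (\<Prod>i=1..<n - 2. X i u)"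
    using n3 by (subst lessThan_atLeast0, subst prod.atLeast_Suc_lessThan) auto
  then have "h 1 * (Y u * (\<Prod>i<n - 2. X i u)) = Y0 * X0 * h (n - 2)"
    unfolding tele[symmetric] by (simp add: X0 Y0)
  also have "\<dots> = h 1 * (cmod (\<alpha> u))\<^sup>2" unfolding xy(5) by simp
  finally show "Y u * (\<Prod>i<n - 2. X i u) = (cmod (\<alpha> u))\<^sup>2"
    using h(1)[of 1] n3 by simp
qed

end

lemma real_log_derivative:
  assumes "open W" "u \<in> W" "\<And>v. v \<in> W \<Longrightarrow> g v = of_real (r v)"
    and "has_wirt g (g u * \<sigma>) b u"
  shows "(r has_derivative (\<lambda>h. 2 * Re (of_real (r u) * \<sigma> * h))) (at u)"
proof -
  have w: "has_wirt (\<lambda>v. of_real (r v)) (g u * \<sigma>) b u"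
    by (rule has_wirt_cong[OF assms(4,1,2,3)])
  from has_wirt_cnj[OF this] have "has_wirt (\<lambda>v. of_real (r v)) (cnj b) (cnj (g u * \<sigma>)) u" by simp
  from has_wirt_unique(2)[OF w this] w
  have "has_wirt (\<lambda>v. of_real (r v)) (g u * \<sigma>) (cnj (g u * \<sigma>)) u" by simp
  from has_wirt_Re[OF this] show ?thesis using assms(3)[OF assms(2)] by simp
qed

section \<open>Wirtinger derivatives and Laplacians of the terms in the squared norm\<close>

context toda
begin

text \<open>The conjugate transpose of the holomorphic \<phi> has no z-derivative. Differentiating
  the relation \<open>HP\<close> and cancelling \<open>H\<close> leaves the commutator of
  \<open>P\<close> and \<open>A\<close>.\<close>

lemma dP:
  assumes u: "u \<in> W"
  shows "\<exists>b. mwirt n P (mm n (P u) (A u) - mm n (A u) (P u)) b u"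
proof -
  obtain p b where p: "mwirt n P p b u" using P_diff[OF u] by blast
  obtain p' where *: "mwirt n \<phi> p' 0 u"
  proof
    show "mwirt n \<phi> (\<lambda>i j. if (i, j) = (0, n - 2) \<or> (i, j) = (1, n - 1) then deriv \<alpha> u else 0) 0 u"
      unfolding mwirt_def
    proof (intro allI impI)
      fix i j assume ij: "i < n" "j < n"
      have "has_wirt \<alpha> (deriv \<alpha> u) 0 u" by (rule has_wirt_holomorphic[OF \<alpha>_hol open_W u])
      then show "has_wirt (\<lambda>v. \<phi> v i j) (if (i, j) = (0, n - 2) \<or> (i, j) = (1, n - 1) then deriv \<alpha> u else 0) ((0 :: fmat) i j) u"
        using n3 ij has_wirt_const[of 0 u] has_wirt_const[of 1 u] unfolding \<phi>_eq higgs_def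
        by (cases "i = j + 1"; cases "(i, j) = (0, n - 2) \<or> (i, j) = (1, n - 1)") auto
    qed
  qed
  have d\<phi>: "mwirt n (\<lambda>v. adj (\<phi> v)) 0 (adj p') u"
    unfolding mwirt_def adj_def using * has_wirt_cnj[of "\<lambda>v. \<phi> v _ _"] unfolding mwirt_def by fastforce
  have l: "mwirt n (\<lambda>v. mm n (H v) (P v)) (mm n (mm n (H u) (A u)) (P u) + mm n (H u) p)
      (mm n (mm n (adj (A u)) (H u)) (P u) + mm n (H u) b) u"
    by (rule mwirt_mm[OF dH[OF u] p])
  have "mwirt n (\<lambda>v. mm n (adj (\<phi> v)) (H v)) (mm n 0 (H u) + mm n (adj (\<phi> u)) (mm n (H u) (A u)))
      (mm n (adj p') (H u) + mm n (adj (\<phi> u)) (mm n (adj (A u)) (H u))) u"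
    by (rule mwirt_mm[OF d\<phi> dH[OF u]])
  then have r: "mwirt n (\<lambda>v. mm n (H v) (P v)) (mm n 0 (H u) + mm n (adj (\<phi> u)) (mm n (H u) (A u)))
      (mm n (adj p') (H u) + mm n (adj (\<phi> u)) (mm n (adj (A u)) (H u))) u"
    unfolding mwirt_def using has_wirt_cong[OF _ open_W u] HP by (metis (no_types, lifting))
  have z: "mm n 0 (H u) = 0" by (intro ext) (simp add: mm_def)
  have "mm n (mm n (H u) (A u)) (P u) + mm n (H u) p = mm n (adj (\<phi> u)) (mm n (H u) (A u))"
  proof (rule supported_eqI)
    show "supported n (mm n (mm n (H u) (A u)) (P u) + mm n (H u) p)"
      by (simp add: supported_def mm_def)
    show "(mm n (mm n (H u) (A u)) (P u) + mm n (H u) p) i j = mm n (adj (\<phi> u)) (mm n (H u) (A u)) i j"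
      if "i < n" "j < n" for i j
      using mwirt_unique(1)[OF l r that] unfolding z by simp
  qed (rule supported_mm)
  also have "\<dots> = mm n (H u) (mm n (P u) (A u))"
    unfolding mm_assoc[symmetric] HP[OF u] ..
  finally have "mm n (H u) (p - (mm n (P u) (A u) - mm n (A u) (P u))) = 0"
    by (simp add: mm_diff_right mm_add_right mm_assoc algebra_simps)
  from posd_cancel[OF posd_H[OF u] this]
  have "p i j = (mm n (P u) (A u) - mm n (A u) (P u)) i j" if "i < n" "j < n" for i j
    using that by simp
  then have "mwirt n P (mm n (P u) (A u) - mm n (A u) (P u)) b u"
    using p unfolding mwirt_def by simp
  then show ?thesis by blast
qed

lemma dP_entry:
  assumes u: "u \<in> W" and ij: "i < n" "j < n"
  shows "\<exists>b. has_wirt (\<lambda>v. P v i j) (P u i j * (A u j j - A u i i)) b u"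
proof -
  obtain b where b: "mwirt n P (mm n (P u) (A u) - mm n (A u) (P u)) b u" using dP[OF u] by blast
  have "(\<Sum>k<n. P u i k * A u k j) = (\<Sum>k<n. if k = j then P u i j * A u j j else 0)"
    using A_off[OF u _ ij(2)] by (intro sum.cong) auto
  moreover have "(\<Sum>k<n. A u i k * P u k j) = (\<Sum>k<n. if k = i then A u i i * P u i j else 0)"
    using A_off[OF u ij(1)] by (intro sum.cong) auto
  ultimately have "(mm n (P u) (A u) - mm n (A u) (P u)) i j = P u i j * (A u j j - A u i i)"
    using ij by (simp add: mm_def sum.delta algebra_simps)
  with b ij show ?thesis unfolding mwirt_def by metis
qed

text \<open>The diagonal of the commutator, read as a net inflow: \<open>X k\<close> flows from
  \<open>k\<close> to \<open>k + 1\<close>, and \<open>Y\<close> flows from \<open>n - 2\<close> to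
  0 and from \<open>n - 1\<close> to 1.\<close>

definition D :: "nat \<Rightarrow> complex \<Rightarrow> real" where
  "D i u = (if i \<ge> 1 then X (i - 1) u else 0) + (if i = 0 \<or> i = 1 then Y u else 0)
     - (if i + 1 < n then X i u else 0) - (if i = n - 2 \<or> i = n - 1 then Y u else 0)"

lemma commutator_diag:
  assumes u: "u \<in> W" and i: "i < n"
  shows "(mm n (\<phi> u) (P u) - mm n (P u) (\<phi> u)) i i = of_real (D i u)"
proof -
  have 1: "mm n (\<phi> u) (P u) i i = of_real ((if i \<ge> 1 then X (i - 1) u else 0) + (if i = 0 \<or> i = 1 then Y u else 0))"
  proof -
    have "mm n (\<phi> u) (P u) i i = (\<Sum>k<n. \<phi> u i k * P u k i)" using i by (simp add: mm_def)
    also have "\<dots> = (if i \<ge> 1 then P u (i - 1) i else 0) + (if i = 0 then \<alpha> u * P u (n - 2) i else 0)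
        + (if i = 1 then \<alpha> u * P u (n - 1) i else 0)"
      by (rule sum_higgs_left[OF i])
    also have "\<dots> = of_real ((if i \<ge> 1 then X (i - 1) u else 0) + (if i = 0 \<or> i = 1 then Y u else 0))"
      using adjoint_positive(1)[OF u, of "i - 1"] adjoint_positive(3)[OF u] P_corner[OF u] i
      by (auto simp: le_Suc_eq)
    finally show ?thesis .
  qed
  have 2: "mm n (P u) (\<phi> u) i i = of_real ((if i + 1 < n then X i u else 0) + (if i = n - 2 \<or> i = n - 1 then Y u else 0))"
  proof -
    have "mm n (P u) (\<phi> u) i i = (\<Sum>k<n. P u i k * \<phi> u k i)" using i by (simp add: mm_def)
    also have "\<dots> = (if i + 1 < n then P u i (i + 1) else 0) + (if i = n - 2 then \<alpha> u * P u i 0 else 0)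
        + (if i = n - 1 then \<alpha> u * P u i 1 else 0)"
      by (rule sum_higgs_right[OF i])
    also have "\<dots> = of_real ((if i + 1 < n then X i u else 0) + (if i = n - 2 \<or> i = n - 1 then Y u else 0))"
      using adjoint_positive(1)[OF u, of i] adjoint_positive(3)[OF u] P_corner[OF u] i n3
      by auto
    finally show ?thesis .
  qed
  show ?thesis unfolding D_def by (simp add: 1 2 diff_diff_eq)
qed

lemma dA_diag:
  assumes u: "u \<in> W" and i: "i < n"
  shows "\<exists>a. has_wirt (\<lambda>v. A v i i) a (of_real (D i u)) u"
proof -
  obtain a where "mwirt n A a (mm n (\<phi> u) (P u) - mm n (P u) (\<phi> u)) u" using dA[OF u] by blast
  then show ?thesis using i commutator_diag[OF assms] unfolding mwirt_def by metis
qed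

text \<open>The scaling factor that normalises the non-zero eigenvalues of \<open>\<phi>\<close> to roots of unity; its
  logarithm is harmonic.\<close>

definition ell :: "complex \<Rightarrow> real" where
  "ell u = exp (- 2 / real (n - 1) * ln (cmod (2 * \<alpha> u)))"

text \<open>The logarithmic z-derivative of \<open>ell\<close>; it is holomorphic, which expresses
  that ln ell is harmonic.\<close>

definition mu :: "complex \<Rightarrow> complex" where
  "mu u = - of_real (1 / real (n - 1)) * (deriv \<alpha> u / \<alpha> u)"

lemma ell_pos: "ell u > 0"
  by (simp add: ell_def)

text \<open>The nonzero eigenvalues x of \<phi> satisfy x^(n - 1) = 2 \<alpha>, so
  \<open>ell u\<close> is the inverse of their common squared modulus.\<close>

lemma ell_power:
  assumes "u \<in> W"
  shows "ell u ^ (n - 1) * (4 * (cmod (\<alpha> u))\<^sup>2) = 1"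
proof -
  have c: "cmod (2 * \<alpha> u) > 0" using \<alpha>_nz[OF assms] by simp
  have "ell u ^ (n - 1) = exp (- 2 * ln (cmod (2 * \<alpha> u)))"
    unfolding ell_def exp_of_nat_mult[symmetric] using n3 by simp
  also have "\<dots> = 1 / (cmod (2 * \<alpha> u))\<^sup>2"
  proof -
    have "exp (2 * ln (cmod (2 * \<alpha> u))) = (cmod (2 * \<alpha> u))\<^sup>2"
      unfolding exp_double using c by (simp only: exp_ln)
    then show ?thesis by (simp only: mult_minus_left exp_minus inverse_eq_divide)
  qed
  finally show ?thesis using c by (simp add: norm_mult power_mult_distrib)
qed

lemma dell:
  assumes u: "u \<in> W"
  shows "(ell has_derivative (\<lambda>h. 2 * Re (of_real (ell u) * mu u * h))) (at u)"
proof -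
  define c where "c = 1 / real (n - 1)"
  have eq: "ell v = exp (- c * ln (4 * (cmod (\<alpha> v))\<^sup>2))" if "v \<in> W" for v
  proof -
    have "4 * (cmod (\<alpha> v))\<^sup>2 = (cmod (2 * \<alpha> v))\<^sup>2" by (simp add: norm_mult power_mult_distrib)
    moreover have "cmod (2 * \<alpha> v) > 0" using \<alpha>_nz[OF that] by simp
    ultimately have "ln (4 * (cmod (\<alpha> v))\<^sup>2) = 2 * ln (cmod (2 * \<alpha> v))"
      by (simp only: ln_realpow)
    then show ?thesis by (simp add: ell_def c_def)
  qed
  have d\<alpha>: "(\<alpha> has_derivative (\<lambda>h. deriv \<alpha> u * h)) (at u)"
    using holomorphic_derivI[OF \<alpha>_hol open_W u] by (simp add: has_field_derivative_def)
  have "((\<lambda>v. (cmod (\<alpha> v - 0))\<^sup>2) has_derivative (\<lambda>h. 2 * Re (cnj (\<alpha> u - 0) * (deriv \<alpha> u * h)))) (at u)"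
    by (rule has_derivative_compose[OF d\<alpha> has_derivative_cmod_square])
  then have 1: "((\<lambda>v. 4 * (cmod (\<alpha> v))\<^sup>2) has_derivative (\<lambda>h. 4 * (2 * Re (cnj (\<alpha> u) * (deriv \<alpha> u * h))))) (at u)"
    by (intro has_derivative_mult_right) simp
  have "((\<lambda>x. exp (- c * ln x)) has_real_derivative exp (- c * ln y) * (- c * (1 / y))) (at y)" if "y > 0" for y
    using that by (auto intro!: derivative_eq_intros)
  then have 2: "((\<lambda>x. exp (- c * ln x)) has_real_derivative
      exp (- c * ln (4 * (cmod (\<alpha> u))\<^sup>2)) * (- c * (1 / (4 * (cmod (\<alpha> u))\<^sup>2)))) (at (4 * (cmod (\<alpha> u))\<^sup>2))"
    using \<alpha>_nz[OF u] by simp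
  have "((\<lambda>v. exp (- c * ln (4 * (cmod (\<alpha> v))\<^sup>2))) has_derivative
      (\<lambda>h. 4 * (2 * Re (cnj (\<alpha> u) * (deriv \<alpha> u * h))) *
        (exp (- c * ln (4 * (cmod (\<alpha> u))\<^sup>2)) * (- c * (1 / (4 * (cmod (\<alpha> u))\<^sup>2)))))) (at u)"
    using DERIV_compose_FDERIV[where g = "\<lambda>v. 4 * (cmod (\<alpha> v))\<^sup>2" and x = u, OF 2 1] .
  moreover have "4 * (2 * Re (cnj (\<alpha> u) * (deriv \<alpha> u * h))) *
        (exp (- c * ln (4 * (cmod (\<alpha> u))\<^sup>2)) * (- c * (1 / (4 * (cmod (\<alpha> u))\<^sup>2))))
      = 2 * Re (of_real (ell u) * mu u * h)" for h
  proof -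
    have R: "Re (of_real x * w) = x * Re w" for x w by simp
    have "cnj (\<alpha> u) = of_real ((cmod (\<alpha> u))\<^sup>2) / \<alpha> u"
      using \<alpha>_nz[OF u] unfolding complex_norm_square by simp
    then have "Re (cnj (\<alpha> u) * (deriv \<alpha> u * h)) = Re (of_real ((cmod (\<alpha> u))\<^sup>2) * (deriv \<alpha> u / \<alpha> u * h))"
      by (simp only: times_divide_eq_left times_divide_eq_right mult.assoc)
    also have "\<dots> = (cmod (\<alpha> u))\<^sup>2 * Re (deriv \<alpha> u / \<alpha> u * h)" by (rule R)
    finally have 1: "Re (cnj (\<alpha> u) * (deriv \<alpha> u * h)) = (cmod (\<alpha> u))\<^sup>2 * Re (deriv \<alpha> u / \<alpha> u * h)" .
    have "of_real (ell u) * mu u * h = of_real (- ell u * c) * (deriv \<alpha> u / \<alpha> u * h)"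
      unfolding mu_def c_def by (simp only: of_real_mult of_real_minus mult_minus_left mult_minus_right mult.assoc)
    then have 2: "Re (of_real (ell u) * mu u * h) = (- ell u * c) * Re (deriv \<alpha> u / \<alpha> u * h)"
      by (simp only: R)
    have "4 * (2 * (N * R)) * (E * (- c * (1 / (4 * N)))) = 2 * ((- E * c) * R)" if "N > 0" for N R E :: real
      using that by (simp add: field_simps)
    then show ?thesis unfolding 1 2 eq[OF u, symmetric] using \<alpha>_nz[OF u] by simp
  qed
  ultimately have "((\<lambda>v. exp (- c * ln (4 * (cmod (\<alpha> v))\<^sup>2))) has_derivative
      (\<lambda>h. 2 * Re (of_real (ell u) * mu u * h))) (at u)" by (simp only:)
  then show ?thesis
    by (rule has_derivative_transform_within_open[OF _ open_W u]) (simp only: eq)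
qed

lemma log_holomorphic_deriv: "(\<lambda>u. deriv \<alpha> u / \<alpha> u) holomorphic_on W"
  using \<alpha>_nz by (intro holomorphic_intros \<alpha>_hol open_W) auto

text \<open>Each term of the squared norm of \<open>\<phi>\<close> is the exponential of a function whose Laplacian is a
  difference of diagonal entries of the commutator.\<close>

lemma term_lap:
  assumes ij: "i < n" "j < n"
    and g: "\<And>v. v \<in> W \<Longrightarrow> g v * P v i j = of_real (r v)"
    and g_hol: "g holomorphic_on W" and g_nz: "\<And>v. v \<in> W \<Longrightarrow> g v \<noteq> 0"
    and r: "\<And>v. v \<in> W \<Longrightarrow> r v > 0"
  shows "\<exists>G L. has_lap W (\<lambda>u. ell u * r u) G L \<and> (\<forall>u\<in>W. L u \<ge> ell u * r u * (D j u - D i u))"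
proof -
  define \<sigma> where "\<sigma> v = deriv g v / g v + (A v j j - A v i i) + mu v" for v
  have dr: "(r has_derivative (\<lambda>h. 2 * Re (of_real (r u) * (deriv g u / g u + (A u j j - A u i i)) * h))) (at u)"
    if u: "u \<in> W" for u
  proof -
    obtain b where "has_wirt (\<lambda>v. P v i j) (P u i j * (A u j j - A u i i)) b u" using dP_entry[OF u ij] by blast
    from has_wirt_mult[OF has_wirt_holomorphic[OF g_hol open_W u] this]
    have "\<exists>b. has_wirt (\<lambda>v. g v * P v i j) (deriv g u * P u i j + g u * (P u i j * (A u j j - A u i i))) b u"
      by blast
    moreover have "deriv g u * P u i j + g u * (P u i j * (A u j j - A u i i))
       = (g u * P u i j) * (deriv g u / g u + (A u j j - A u i i))"
      using g_nz[OF u] by (simp add: field_simps)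
    ultimately obtain b where b: "has_wirt (\<lambda>v. g v * P v i j) ((g u * P u i j) * (deriv g u / g u + (A u j j - A u i i))) b u"
      by auto
    show ?thesis by (rule real_log_derivative[where g = "\<lambda>v. g v * P v i j", OF open_W u g b])
  qed
  have d: "((\<lambda>u. ell u * r u) has_derivative (\<lambda>h. 2 * Re (of_real (ell u * r u) * \<sigma> u * h))) (at u)"
    if u: "u \<in> W" for u
    using has_derivative_mult[OF dell[OF u] dr[OF u]]
  proof (rule has_derivative_eq_rhs)
    have "e * (2 * Re (of_real x * s * h)) + 2 * Re (of_real e * m * h) * x = 2 * Re (of_real (e * x) * (s + m) * h)"
      for e x :: real and s m h :: complex by (simp add: algebra_simps)
    then show "(\<lambda>h. ell u * (2 * Re (of_real (r u) * (deriv g u / g u + (A u j j - A u i i)) * h))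
        + 2 * Re (of_real (ell u) * mu u * h) * r u) = (\<lambda>h. 2 * Re (of_real (ell u * r u) * \<sigma> u * h))"
      unfolding \<sigma>_def by (rule ext)
  qed
  have s: "\<exists>a. has_wirt \<sigma> a (of_real (D j u - D i u)) u" if u: "u \<in> W" for u
  proof -
    have "(\<lambda>u. deriv g u / g u) holomorphic_on W"
      using g_nz by (intro holomorphic_intros g_hol open_W) auto
    from has_wirt_holomorphic[OF this open_W u]
    obtain a1 where 1: "has_wirt (\<lambda>u. deriv g u / g u) a1 0 u" by blast
    obtain a2 where 2: "has_wirt (\<lambda>v. A v j j) a2 (of_real (D j u)) u" using dA_diag[OF u ij(2)] by blast
    obtain a3 where 3: "has_wirt (\<lambda>v. A v i i) a3 (of_real (D i u)) u" using dA_diag[OF u ij(1)] by blast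
    obtain a4 where 4: "has_wirt mu a4 0 u"
      using has_wirt_cmult[OF has_wirt_holomorphic[OF log_holomorphic_deriv open_W u], of "- of_real (1 / real (n - 1))"]
      unfolding mu_def by auto
    \<comment> \<open>The logarithmic derivatives of \<open>g\<close> and \<open>ell\<close> are
      holomorphic, so only the diagonal entries of \<open>A\<close> contribute to the conjugate
      derivative.\<close>
    from has_wirt_add[OF has_wirt_add[OF 1 has_wirt_diff[OF 2 3]] 4] show ?thesis
      unfolding \<sigma>_def by auto
  qed
  have "has_lap W (\<lambda>u. ell u * r u) (\<lambda>u. of_real (ell u * r u) * \<sigma> u)
     (\<lambda>u. ell u * r u * ((cmod (\<sigma> u))\<^sup>2 + Re (of_real (D j u - D i u))))"
    by (rule has_lap_log_derivative[OF d s])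
  \<comment> \<open>Dropping |\<sigma>|^2 is harmless: the maximum principle needs only a lower
    bound.\<close>
  moreover have "ell u * r u * ((cmod (\<sigma> u))\<^sup>2 + Re (of_real (D j u - D i u))) \<ge> ell u * r u * (D j u - D i u)"
    if "u \<in> W" for u
    using r[OF that] ell_pos[of u] by (intro mult_left_mono) auto
  ultimately show ?thesis by blast
qed

end

section \<open>The defect and its exponential decay\<close>

context toda
begin

text \<open>The bracket is the squared norm of \<phi>, with one \<open>Y\<close> for each of the two
  corner entries. For a normal \<phi> the scaled norm would be the sum of the squared moduli of the
  scaled eigenvalues, which is \<open>n - 1\<close>.\<close>

definition defect :: "complex \<Rightarrow> real" where
  "defect u = ell u * ((\<Sum>k<n - 1. X k u) + Y u + Y u) - real (n - 1)"

text \<open>Summation by parts: in terms of flows, each weight is multiplied by the difference of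
  \<open>D\<close> between the head and the tail of its arrow.\<close>

lemma sum_D_square:
  "(\<Sum>i<n. (D i u)\<^sup>2) = (\<Sum>k<n - 1. X k u * (D (k + 1) u - D k u))
     + Y u * (D 0 u - D (n - 2) u) + Y u * (D 1 u - D (n - 1) u)"
proof -
  obtain m where m: "n = Suc m" using n3 by (cases n) auto
  have 1: "(\<Sum>i<n. D i u * (if i \<ge> 1 then X (i - 1) u else 0)) = (\<Sum>k<m. D (k + 1) u * X k u)"
    unfolding m sum.lessThan_Suc_shift by simp
  have 2: "(\<Sum>i<n. D i u * (if i + 1 < n then X i u else 0)) = (\<Sum>k<m. D k u * X k u)"
    unfolding m by simp
  have 3: "(\<Sum>i<n. D i u * (if i = 0 \<or> i = 1 then Y u else 0)) = (D 0 u + D 1 u) * Y u"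
  proof -
    have "D i u * (if i = 0 \<or> i = 1 then Y u else 0)
       = (if i = 0 then D 0 u * Y u else 0) + (if i = 1 then D 1 u * Y u else 0)" for i by auto
    then show ?thesis using n3 by (simp add: sum.distrib sum.delta distrib_right)
  qed
  have 4: "(\<Sum>i<n. D i u * (if i = n - 2 \<or> i = n - 1 then Y u else 0)) = (D (n - 2) u + D (n - 1) u) * Y u"
  proof -
    have "D i u * (if i = n - 2 \<or> i = n - 1 then Y u else 0)
       = (if i = n - 2 then D (n - 2) u * Y u else 0) + (if i = n - 1 then D (n - 1) u * Y u else 0)" for i
      using n3 by auto
    then show ?thesis using n3 by (simp add: sum.distrib sum.delta distrib_right)
  qed
  have "(D i u)\<^sup>2 = D i u * (if i \<ge> 1 then X (i - 1) u else 0) + D i u * (if i = 0 \<or> i = 1 then Y u else 0)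
     - D i u * (if i + 1 < n then X i u else 0) - D i u * (if i = n - 2 \<or> i = n - 1 then Y u else 0)" for i
    unfolding power2_eq_square by (subst (2) D_def) (simp only: distrib_left right_diff_distrib)
  then have "(\<Sum>i<n. (D i u)\<^sup>2) = (\<Sum>k<m. D (k + 1) u * X k u) + (D 0 u + D 1 u) * Y u
     - (\<Sum>k<m. D k u * X k u) - (D (n - 2) u + D (n - 1) u) * Y u"
    by (simp only: sum.distrib sum_subtractf 1 2 3 4)
  also have "\<dots> = (\<Sum>k<n - 1. X k u * (D (k + 1) u - D k u))
     + Y u * (D 0 u - D (n - 2) u) + Y u * (D 1 u - D (n - 1) u)"
    by (simp add: m algebra_simps sum_subtractf)
  finally show ?thesis .
qed

text \<open>\<open>term_lap\<close> bounds the contribution of each arrow by its scaled weight times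
  the difference of \<open>D\<close> along it, and \<open>sum_D_square\<close> adds these up to a
  sum of squares.\<close>

lemma defect_lap:
  "\<exists>G L. has_lap W defect G L \<and> (\<forall>u\<in>W. L u \<ge> ell u * (\<Sum>i<n. (D i u)\<^sup>2))"
proof -
  have "\<exists>G L. has_lap W (\<lambda>u. ell u * X k u) G L \<and> (\<forall>u\<in>W. L u \<ge> ell u * X k u * (D (k + 1) u - D k u))"
    if k: "k < n - 1" for k
  proof (rule term_lap[where g = "\<lambda>_. 1"])
    fix v assume v: "v \<in> W"
    show "1 * P v k (k + 1) = of_real (X k v)" "X k v > 0"
      using adjoint_positive(1)[OF v k] by simp_all
  qed (use k in simp_all)
  then have "\<forall>k\<in>{..<n - 1}. \<exists>GL. has_lap W (\<lambda>u. ell u * X k u) (fst GL) (snd GL)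
      \<and> (\<forall>u\<in>W. snd GL u \<ge> ell u * X k u * (D (k + 1) u - D k u))" by simp
  from bchoice[OF this] obtain GL where "\<forall>k\<in>{..<n - 1}. has_lap W (\<lambda>u. ell u * X k u) (fst (GL k)) (snd (GL k))
      \<and> (\<forall>u\<in>W. snd (GL k) u \<ge> ell u * X k u * (D (k + 1) u - D k u))" ..
  then obtain G L where GL: "\<And>k. k < n - 1 \<Longrightarrow> has_lap W (\<lambda>u. ell u * X k u) (G k) (L k)"
    "\<And>k u. k < n - 1 \<Longrightarrow> u \<in> W \<Longrightarrow> L k u \<ge> ell u * X k u * (D (k + 1) u - D k u)"
    using that[of "\<lambda>k. fst (GL k)" "\<lambda>k. snd (GL k)"] by simp
  have "\<exists>G L. has_lap W (\<lambda>u. ell u * Y u) G L \<and> (\<forall>u\<in>W. L u \<ge> ell u * Y u * (D 0 u - D (n - 2) u))"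
  proof (rule term_lap[where g = \<alpha>])
    show "\<alpha> v * P v (n - 2) 0 = of_real (Y v)" "Y v > 0" "\<alpha> v \<noteq> 0" if "v \<in> W" for v
      using adjoint_positive(2,3)[OF that] \<alpha>_nz[OF that] by simp_all
  qed (use n3 in \<open>simp_all add: \<alpha>_hol\<close>)
  then obtain G1 L1 where 1: "has_lap W (\<lambda>u. ell u * Y u) G1 L1"
    "\<And>u. u \<in> W \<Longrightarrow> L1 u \<ge> ell u * Y u * (D 0 u - D (n - 2) u)" by blast
  have "\<exists>G L. has_lap W (\<lambda>u. ell u * Y u) G L \<and> (\<forall>u\<in>W. L u \<ge> ell u * Y u * (D 1 u - D (n - 1) u))"
  proof (rule term_lap[where g = \<alpha>])
    show "\<alpha> v * P v (n - 1) 1 = of_real (Y v)" if "v \<in> W" for v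
      unfolding P_corner[OF that] by (rule adjoint_positive(3)[OF that])
    show "Y v > 0" "\<alpha> v \<noteq> 0" if "v \<in> W" for v
      using adjoint_positive(2)[OF that] \<alpha>_nz[OF that] by simp_all
  qed (use n3 in \<open>simp_all add: \<alpha>_hol\<close>)
  then obtain G2 L2 where 2: "has_lap W (\<lambda>u. ell u * Y u) G2 L2"
    "\<And>u. u \<in> W \<Longrightarrow> L2 u \<ge> ell u * Y u * (D 1 u - D (n - 1) u)" by blast
  have "has_lap W (\<lambda>u. \<Sum>k<n - 1. ell u * X k u) (\<lambda>u. \<Sum>k<n - 1. G k u) (\<lambda>u. \<Sum>k<n - 1. L k u)"
    by (rule has_lap_sum) (use GL in auto)
  from has_lap_diff[OF has_lap_add[OF has_lap_add[OF this 1(1)] 2(1)] has_lap_const[of W "real (n - 1)"]]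
  have "has_lap W defect (\<lambda>u. (\<Sum>k<n - 1. G k u) + G1 u + G2 u - 0) (\<lambda>u. (\<Sum>k<n - 1. L k u) + L1 u + L2 u - 0)"
    unfolding defect_def by (simp only: sum_distrib_left distrib_left)
  moreover have "(\<Sum>k<n - 1. L k u) + L1 u + L2 u - 0 \<ge> ell u * (\<Sum>i<n. (D i u)\<^sup>2)" if u: "u \<in> W" for u
  proof -
    have "ell u * (\<Sum>i<n. (D i u)\<^sup>2) = (\<Sum>k<n - 1. ell u * X k u * (D (k + 1) u - D k u))
       + ell u * Y u * (D 0 u - D (n - 2) u) + ell u * Y u * (D 1 u - D (n - 1) u)"
      unfolding sum_D_square by (simp only: distrib_left sum_distrib_left mult.assoc)
    moreover have "(\<Sum>k<n - 1. ell u * X k u * (D (k + 1) u - D k u)) \<le> (\<Sum>k<n - 1. L k u)"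
      by (rule sum_mono) (use GL(2)[OF _ u] in auto)
    ultimately show ?thesis using 1(2)[OF u] 2(2)[OF u] by linarith
  qed
  ultimately show ?thesis by blast
qed

text \<open>The reflection of the indices reverses all arrows and keeps their weights.\<close>

lemma D_antisym:
  assumes u: "u \<in> W" and i: "i < n"
  shows "D (n - 1 - i) u = - D i u"
proof -
  have 1: "(if n - 1 - i \<ge> 1 then X (n - 1 - i - 1) u else 0) = (if i + 1 < n then X i u else 0)"
  proof (cases "i + 1 < n")
    case True
    then have "n - 1 - i \<ge> 1" "n - 1 - i - 1 = n - 2 - i" by auto
    with True X_sym[OF u, of i] show ?thesis by simp
  qed simp
  have 2: "(if n - 1 - i + 1 < n then X (n - 1 - i) u else 0) = (if i \<ge> 1 then X (i - 1) u else 0)"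
  proof (cases "i \<ge> 1")
    case True
    then have "n - 1 - i + 1 < n" "n - 1 - i = n - 2 - (i - 1)" using i by auto
    with True X_sym[OF u, of "i - 1"] i show ?thesis by simp
  qed (use n3 in simp)
  have 3: "(n - 1 - i = 0 \<or> n - 1 - i = 1) = (i = n - 2 \<or> i = n - 1)"
    "(n - 1 - i = n - 2 \<or> n - 1 - i = n - 1) = (i = 0 \<or> i = 1)" using i n3 by auto
  show ?thesis unfolding D_def 1 2 3 by simp
qed

text \<open>\<open>product_one_bounds\<close> is applied to m = n - 1 scaled weights whose
  successive differences are combinations of entries of \<open>D\<close>. The constants 8 and 4
  contain the factor 4 of e^2 = 4 (ell u)^2 S.\<close>

lemma defect_bounds:
  assumes u: "u \<in> W"
  defines "S \<equiv> (\<Sum>i<n. (D i u)\<^sup>2)" and "m \<equiv> n - 1"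
  shows "0 \<le> defect u" and "defect u \<le> 8 * real m ^ 3 * (ell u)\<^sup>2 * S"
    and "(defect u)\<^sup>2 \<le> 4 * real m ^ 4 * (ell u)\<^sup>2 * S"
    and "i < n \<Longrightarrow> (ell u * D i u)\<^sup>2 \<le> 4 * ((1 + sqrt (defect u + m))\<^sup>2 * defect u)"
proof -
  define l where "l = ell u"
  have l: "l > 0" by (simp add: l_def ell_pos)
  obtain p where p: "n = p + 3" using n3 by (metis add.commute le_Suc_ex)
  have m: "m = Suc (Suc p)" by (simp add: m_def p)
  \<comment> \<open>\<open>Y\<close> counts twice in the norm, and \<open>X 0\<close> recurs as
    \<open>X (n - 2)\<close>; doubling both makes the sum of the \<open>b j\<close> the scaled norm.
    The resulting factor 4 in the product is the one in \<open>ell_power\<close>.\<close>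
  define b where "b j = (if j = 0 then 2 * l * Y u else if j = 1 then 2 * l * X 0 u else l * X (j - 1) u)" for j
  define e where "e = 2 * l * sqrt S"
  have b2: "b (Suc (Suc j)) = l * X (Suc j) u" for j by (simp add: b_def)
  have b01: "b 0 = 2 * l * Y u" "b 1 = 2 * l * X 0 u" "b (Suc 0) = 2 * l * X 0 u" by (simp_all add: b_def)
  have Xpos: "X i u > 0" if "i < m" for i using adjoint_positive(1)[OF u, of i] that by (simp add: m_def)
  have bpos: "b j > 0" if "j < m" for j
    using that Xpos[of "j - 1"] Xpos[of 0] adjoint_positive(2)[OF u] l m by (auto simp: b_def)
  have S: "S \<ge> 0" unfolding S_def by (intro sum_nonneg) auto
  have Dle: "\<bar>D i u\<bar> \<le> sqrt S" if "i < n" for i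
  proof -
    have "(D i u)\<^sup>2 \<le> S" unfolding S_def using that by (intro member_le_sum) auto
    then show ?thesis by (rule real_le_rsqrt[of "\<bar>D i u\<bar>", unfolded power2_abs])
  qed
  have D0: "D 0 u = Y u - X 0 u" unfolding D_def by (simp add: p)
  have D1: "D (Suc 0) u = X 0 u + Y u - X (Suc 0) u" if "p \<ge> 1" using that unfolding D_def by (simp add: p)
  have Di: "D i u = X (i - 1) u - X i u" if "2 \<le> i" "i \<le> p" for i using that unfolding D_def by (simp add: p)
  have step: "\<bar>b (Suc j) - b j\<bar> \<le> e" if "Suc j < m" for j
  proof -
    consider "j = 0" | "j = 1" "p \<ge> 1" | "j \<ge> 2" "j \<le> p" using \<open>Suc j < m\<close> m by linarith
    then show ?thesis
    proof cases
      case 1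
      then have "b (Suc j) - b j = 2 * l * (- D 0 u)" by (simp add: b01 D0 algebra_simps)
      then have "\<bar>b (Suc j) - b j\<bar> = 2 * l * \<bar>D 0 u\<bar>" using l by (simp add: abs_mult)
      then show ?thesis using Dle[of 0] l p by (simp add: e_def)
    next
      case 2
      then have "b (Suc j) - b j = l * (D 0 u - D 1 u)" by (simp add: b_def D0 D1 algebra_simps)
      then have "\<bar>b (Suc j) - b j\<bar> = l * \<bar>D 0 u - D 1 u\<bar>" using l by (simp add: abs_mult)
      also have "\<dots> \<le> l * (sqrt S + sqrt S)" using Dle[of 0] Dle[of 1] l p by (intro mult_left_mono) auto
      finally show ?thesis by (simp add: e_def)
    next
      case 3
      then have "b (Suc j) - b j = l * (- D j u)" by (simp add: b_def Di algebra_simps)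
      then have "\<bar>b (Suc j) - b j\<bar> = l * \<bar>D j u\<bar>" using l by (simp add: abs_mult)
      also have "\<dots> \<le> (2 * l) * sqrt S" using Dle[of j] l 3 p S by (intro mult_mono) auto
      finally show ?thesis by (simp add: e_def)
    qed
  qed
  have prod: "(\<Prod>j<m. b j) = 1"
  proof -
    have "(\<Prod>j<m. b j) = b 0 * (b 1 * (\<Prod>j<p. l * X (Suc j) u))"
      unfolding m prod.lessThan_Suc_shift by (simp add: b2)
    also have "\<dots> = l ^ Suc (Suc p) * (4 * (Y u * (X 0 u * (\<Prod>j<p. X (Suc j) u))))"
      unfolding b01 prod.distrib by simp
    also have "X 0 u * (\<Prod>j<p. X (Suc j) u) = (\<Prod>i<n - 2. X i u)"
      by (simp add: p prod.lessThan_Suc_shift del: prod.lessThan_Suc)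
    also have "Y u * (\<Prod>i<n - 2. X i u) = (cmod (\<alpha> u))\<^sup>2" by (rule adjoint_positive(4)[OF u])
    also have "l ^ Suc (Suc p) * (4 * (cmod (\<alpha> u))\<^sup>2) = 1"
      using ell_power[OF u] by (simp add: l_def p)
    finally show ?thesis .
  qed
  have sumb: "(\<Sum>j<m. b j) - m = defect u"
  proof -
    have "(\<Sum>j<m. b j) = b 0 + (b 1 + (\<Sum>j<p. l * X (Suc j) u))"
      unfolding m sum.lessThan_Suc_shift by (simp add: b2)
    also have "\<dots> = l * (X 0 u + (\<Sum>j<p. X (Suc j) u) + X 0 u + Y u + Y u)"
      unfolding b01 sum_distrib_left[symmetric] by (simp add: algebra_simps)
    also have "X 0 u + (\<Sum>j<p. X (Suc j) u) + X 0 u = (\<Sum>k<n - 1. X k u)"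
    proof -
      have "X (Suc p) u = X 0 u" using X_sym[OF u, of 0] by (simp add: p)
      moreover have "n - 1 = Suc (Suc p)" by (simp add: p)
      moreover have "(\<Sum>k<Suc (Suc p). X k u) = (\<Sum>k<Suc p. X k u) + X (Suc p) u" by (rule sum.lessThan_Suc)
      moreover have "(\<Sum>k<Suc p. X k u) = X 0 u + (\<Sum>j<p. X (Suc j) u)" by (rule sum.lessThan_Suc_shift)
      ultimately show ?thesis by simp
    qed
    finally show ?thesis by (simp add: defect_def l_def m_def)
  qed
  have e0: "e \<ge> 0" using l S by (simp add: e_def)
  have m1: "m \<ge> 1" by (simp add: m)
  have e2: "e\<^sup>2 = 4 * l\<^sup>2 * S" using S by (simp add: e_def power_mult_distrib)
  note pb = product_one_bounds[OF bpos prod step e0 m1, unfolded sumb]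
  show "0 \<le> defect u" by (rule pb(1))
  show "defect u \<le> 8 * real m ^ 3 * (ell u)\<^sup>2 * S" using pb(2) unfolding e2 by (simp add: l_def)
  show "(defect u)\<^sup>2 \<le> 4 * real m ^ 4 * (ell u)\<^sup>2 * S" using pb(3) unfolding e2 by (simp add: l_def)
  define Q where "Q = (1 + sqrt (defect u + m))\<^sup>2 * defect u"
  have Q: "\<bar>b j - 1\<bar> \<le> sqrt Q" if "j < m" for j
  proof -
    have "(b j - 1)\<^sup>2 \<le> Q" unfolding Q_def by (rule pb(4)) (use that in auto)
    then show ?thesis by (rule real_le_rsqrt[of "\<bar>b j - 1\<bar>", unfolded power2_abs])
  qed
  have Q0: "Q \<ge> 0" using pb(1) by (simp add: Q_def)
  have sQ: "sqrt Q \<ge> 0" using Q0 by simp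
  have low: "\<bar>l * D i u\<bar> \<le> 2 * sqrt Q" if ip: "i \<le> p" for i
  proof -
    consider "i = 0" | "i = 1" "p \<ge> 1" | "i \<ge> 2" "i \<le> p" using ip by linarith
    then show ?thesis
    proof cases
      case 1
      then have "2 * (l * D i u) = b 0 - b 1" by (simp add: b01 D0 right_diff_distrib)
      moreover have lm: "0 < m" "1 < m" using m by auto
      ultimately show ?thesis using Q[OF lm(1)] Q[OF lm(2)] sQ by linarith
    next
      case 2
      then have "2 * (l * D i u) = b 0 + b 1 - 2 * b 2"
        by (simp add: b_def D1 right_diff_distrib distrib_left)
      moreover have lm: "0 < m" "1 < m" "2 < m" using m 2 by auto
      ultimately show ?thesis using Q[OF lm(1)] Q[OF lm(2)] Q[OF lm(3)] sQ by linarith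
    next
      case 3
      then have "l * D i u = b i - b (Suc i)"
        by (simp add: b_def Di right_diff_distrib)
      moreover have lm: "i < m" "Suc i < m" using m 3 by auto
      ultimately show ?thesis using Q[OF lm(1)] Q[OF lm(2)] sQ by linarith
    qed
  qed
  assume i: "i < n"
  have "\<bar>l * D i u\<bar> \<le> 2 * sqrt Q"
  proof (cases "i \<le> p")
    case False
    then have *: "n - 1 - i \<le> 1" "D (n - 1 - i) u = - D i u" using D_antisym[OF u i] p i by auto
    show ?thesis
    proof (cases "n - 1 - i \<le> p")
      case True
      with low[OF True] *(2) show ?thesis by simp
    next
      case False
      \<comment> \<open>This happens only for n = 3 and i = 1, the index fixed by the
        reflection.\<close>
      then have "i = n - 1 - i" using i * p \<open>\<not> i \<le> p\<close> by linarith
      with *(2) have "D i u = 0" by simp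
      then show ?thesis using Q0 by simp
    qed
  qed (rule low)
  then have "\<bar>l * D i u\<bar>\<^sup>2 \<le> (2 * sqrt Q)\<^sup>2" by (intro power_mono) auto
  then show "(ell u * D i u)\<^sup>2 \<le> 4 * ((1 + sqrt (defect u + m))\<^sup>2 * defect u)"
    using Q0 by (simp add: power_mult_distrib l_def Q_def)
qed

text \<open>The bound on \<open>ell\<close> turns both estimates of \<open>defect_bounds\<close>
  into lower bounds for the Laplacian, E k^2 and E k, with the same \<open>E\<close>. The ball has
  radius 2 R because the quadratic bound is first used on a ball of radius \<open>R\<close> about
  every point of \<open>cball c R\<close>, so that the linear one can start there from the bound
  \<open>K\<close>.\<close>

lemma commutator_decay:
  fixes E :: real
  assumes sub: "cball c (2 * R) \<subseteq> W" and R: "R > 0"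
    and ell: "\<And>u. u \<in> cball c (2 * R) \<Longrightarrow> 8 * real (n - 1) ^ 4 * ell u * E \<le> 1"
    and E: "E > 0" and a: "a > 0" "a\<^sup>2 * R\<^sup>2 + a \<le> E" and i: "i < n"
  defines "K \<equiv> 6 / (E * R\<^sup>2)"
  shows "(ell c * D i c)\<^sup>2 \<le> 4 * ((1 + sqrt (K + (n - 1)))\<^sup>2 * (K * exp (- a * R\<^sup>2)))"
proof -
  define m where "m = real (n - 1)"
  have m: "m \<ge> 1" using n3 by (simp add: m_def)
  obtain G L where lap: "has_lap W defect G L"
    and L: "\<And>u. u \<in> W \<Longrightarrow> L u \<ge> ell u * (\<Sum>i<n. (D i u)\<^sup>2)" using defect_lap by blast
  have ineq: "L u \<ge> E * (defect u)\<^sup>2 \<and> L u \<ge> E * defect u" if u: "u \<in> cball c (2 * R)" for u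
  proof -
    define S where "S = (\<Sum>i<n. (D i u)\<^sup>2)"
    have S: "S \<ge> 0" unfolding S_def by (intro sum_nonneg) auto
    have uW: "u \<in> W" using u sub by blast
    note b = defect_bounds[OF uW, folded S_def m_def]
    have l: "ell u > 0" by (rule ell_pos)
    have e: "8 * m ^ 4 * ell u * E \<le> 1" using ell[OF u] by (simp add: m_def)
    have "E * (defect u)\<^sup>2 \<le> E * (4 * m ^ 4 * (ell u)\<^sup>2 * S)" using b(3) E by (intro mult_left_mono) auto
    also have "\<dots> \<le> E * (8 * m ^ 4 * (ell u)\<^sup>2 * S)" using E m l S by (intro mult_left_mono mult_right_mono) auto
    also have "\<dots> = (8 * m ^ 4 * ell u * E) * (ell u * S)" by (simp add: power2_eq_square)
    also have "\<dots> \<le> 1 * (ell u * S)" using e l S by (intro mult_right_mono) auto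
    finally have 1: "E * (defect u)\<^sup>2 \<le> ell u * S" by simp
    have m34: "m ^ 3 \<le> m ^ 4" using m by (intro power_increasing) auto
    have "E * defect u \<le> E * (8 * m ^ 3 * (ell u)\<^sup>2 * S)" using b(2) E by (intro mult_left_mono) auto
    also have "\<dots> \<le> E * (8 * m ^ 4 * (ell u)\<^sup>2 * S)" using E m l S m34 by (intro mult_left_mono mult_right_mono) auto
    also have "\<dots> = (8 * m ^ 4 * ell u * E) * (ell u * S)" by (simp add: power2_eq_square)
    also have "\<dots> \<le> 1 * (ell u * S)" using e l S by (intro mult_right_mono) auto
    finally have 2: "E * defect u \<le> ell u * S" by simp
    show ?thesis using 1 2 L[OF uW] unfolding S_def by linarith
  qed
  have K: "K \<ge> 0" using E by (simp add: K_def)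
  have bound: "defect v \<le> K" if v: "v \<in> cball c R" for v
  proof -
    have s: "cball v R \<subseteq> cball c (2 * R)"
    proof
      fix x assume "x \<in> cball v R"
      then show "x \<in> cball c (2 * R)" using dist_triangle[of c x v] v by simp
    qed
    show ?thesis unfolding K_def
    proof (rule keller_osserman_bound[OF lap _ R E])
      show "cball v R \<subseteq> W" using s sub by blast
      show "0 \<le> defect x" if "x \<in> cball v R" for x using that s sub defect_bounds(1) by blast
      show "E * (defect x)\<^sup>2 \<le> L x" if "x \<in> cball v R" for x using that s ineq by blast
    qed
  qed
  have s: "cball c R \<subseteq> cball c (2 * R)" using R by auto
  have c: "defect c \<le> K * exp (- a * R\<^sup>2)"
  proof (rule exponential_decay_bound[OF lap _ R K a bound])
    show "cball c R \<subseteq> W" using s sub by blast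
    show "E * defect v \<le> L v" if "v \<in> cball c R" for v using that s ineq by blast
  qed
  have cW: "c \<in> W" using sub R by auto
  have d0: "defect c \<ge> 0" by (rule defect_bounds(1)[OF cW])
  have dK: "defect c \<le> K" using bound[of c] R by simp
  have "(ell c * D i c)\<^sup>2 \<le> 4 * ((1 + sqrt (defect c + (n - 1)))\<^sup>2 * defect c)"
    by (rule defect_bounds(4)[OF cW i])
  also have "\<dots> \<le> 4 * ((1 + sqrt (K + (n - 1)))\<^sup>2 * (K * exp (- a * R\<^sup>2)))"
    using c d0 dK by (intro mult_left_mono mult_mono power_mono add_left_mono real_sqrt_le_mono) auto
  finally show ?thesis .
qed

end

section \<open>Gram matrices in a chart\<close>

definition fm :: "nat \<Rightarrow> complex mat \<Rightarrow> fmat" where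
  "fm n M = (\<lambda>i j. if i < n \<and> j < n then M $$ (i, j) else 0)"

lemma supported_fm: "supported n (fm n M)"
  by (simp add: supported_def fm_def)

lemma fm_mult:
  assumes "X \<in> carrier_mat n n" "Y \<in> carrier_mat n n"
  shows "fm n (X * Y) = mm n (fm n X) (fm n Y)"
  using assms by (intro ext) (auto simp: fm_def mm_def scalar_prod_def lessThan_atLeast0 intro!: sum.cong)

lemma fm_minus:
  assumes "X \<in> carrier_mat n n" "Y \<in> carrier_mat n n"
  shows "fm n (X - Y) = fm n X - fm n Y"
  using assms by (intro ext) (auto simp: fm_def)

lemma fm_one: "fm n (1\<^sub>m n) = one n"
  by (intro ext) (auto simp: fm_def one_def)

lemma mat_adjoint_carrier: "X \<in> carrier_mat n n \<Longrightarrow> mat_adjoint X \<in> carrier_mat n n"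
  by (auto simp: mat_adjoint_def)

lemma fm_adjoint:
  assumes "X \<in> carrier_mat n n"
  shows "fm n (mat_adjoint X) = adj (fm n X)"
  using assms by (intro ext) (auto simp: fm_def adj_def mat_adjoint_def mat_of_rows_index)

lemma posd_fm:
  assumes "pos_def_hermitian n J"
  shows "posd n (fm n J)"
  unfolding posd_def
proof (intro conjI allI impI)
  have J: "J \<in> carrier_mat n n" "mat_adjoint J = J" using assms by (auto simp: pos_def_hermitian_def)
  show "fm n J j i = cnj (fm n J i j)" if "i < n" "j < n" for i j
    using fun_cong[OF fun_cong[OF fm_adjoint[OF J(1)]], of j i] unfolding J(2) by (simp add: adj_def)
  fix x :: "nat \<Rightarrow> complex" assume "\<exists>i<n. x i \<noteq> 0"
  then obtain i where i: "i < n" "x i \<noteq> 0" by blast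
  define v where "v = Matrix.vec n x"
  have v: "v \<in> carrier_vec n" by (simp add: v_def)
  have "v \<noteq> 0\<^sub>v n"
  proof
    assume "v = 0\<^sub>v n"
    then have "vec_index v i = vec_index (0\<^sub>v n) i" by simp
    with i show False by (simp add: v_def)
  qed
  then have "Re ((J *\<^sub>v v) \<bullet>c v) > 0" using assms v unfolding pos_def_hermitian_def by blast
  also have "(J *\<^sub>v v) \<bullet>c v = form n (fm n J) x"
    using J v by (auto simp: form_def fm_def scalar_prod_def v_def lessThan_atLeast0 sum_distrib_left sum_distrib_right
      intro!: sum.cong)
  finally show "Re (form n (fm n J) x) > 0" .
qed

text \<open>For determinant 1 the inverse is the adjugate, whose entries are polynomials in those of
  \<open>J\<close>; differentiability of the inverse follows from this.\<close>

lemma mat_inverse_det_one: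
  fixes J :: "complex mat"
  assumes J: "J \<in> carrier_mat n n" and det: "Determinant.det J = 1"
  shows "the (mat_inverse J) = adj_mat J" "J * adj_mat J = 1\<^sub>m n" "adj_mat J * J = 1\<^sub>m n"
    "adj_mat J \<in> carrier_mat n n"
proof -
  note a = adj_mat[OF J, unfolded det]
  show inv: "J * adj_mat J = 1\<^sub>m n" "adj_mat J * J = 1\<^sub>m n" "adj_mat J \<in> carrier_mat n n"
    using a by auto
  have "J \<in> Units (ring_mat TYPE(complex) n n)"
    unfolding Units_def using J inv by (auto simp: ring_mat_simps)
  then obtain B where B: "mat_inverse J = Some B" using mat_inverse(1)[OF J, where b = n] by (cases "mat_inverse J") auto
  from mat_inverse(2)[OF J B] have *: "B * J = 1\<^sub>m n" "B \<in> carrier_mat n n" by auto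
  have "B = B * (J * adj_mat J)" using * inv by simp
  also have "\<dots> = (B * J) * adj_mat J" using assoc_mult_mat[OF *(2) J inv(3)] by simp
  also have "\<dots> = adj_mat J" using * inv by simp
  finally show "the (mat_inverse J) = adj_mat J" using B by simp
qed

lemma differentiable_prod:
  fixes f :: "'i \<Rightarrow> complex \<Rightarrow> complex"
  assumes "\<And>i. i \<in> I \<Longrightarrow> f i differentiable (at u)"
  shows "(\<lambda>v. \<Prod>i\<in>I. f i v) differentiable (at u)"
  using assms by (induction I rule: infinite_finite_induct) (auto intro!: differentiable_mult)

lemma permutes_less: "p permutes {0..<k} \<Longrightarrow> (i :: nat) < k \<Longrightarrow> p i < k"
  using permutes_in_image[of p "{0..<k}" i] by simp

lemma differentiable_det:
  fixes u :: complex
  assumes "\<And>i j. i < k \<Longrightarrow> j < k \<Longrightarrow> f i j differentiable (at u)"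
  shows "(\<lambda>v. Determinant.det (Matrix.mat k k (\<lambda>(i, j). f i j v :: complex))) differentiable (at u)"
proof -
  have "(\<lambda>v. Determinant.det (Matrix.mat k k (\<lambda>(i, j). f i j v)))
      = (\<lambda>v. \<Sum>p | p permutes {0..<k}. signof p * (\<Prod>i = 0..<k. f i (p i) v))"
    by (rule ext, subst det_def'[of _ k])
      (auto intro!: sum.cong prod.cong simp: permutes_less)
  moreover have "(\<lambda>v. \<Prod>i = 0..<k. f i (p i) v) differentiable (at u)" if "p permutes {0..<k}" for p
    by (rule differentiable_prod, rule assms) (use permutes_less[OF that] in auto)
  then have "(\<lambda>v. \<Sum>p | p permutes {0..<k}. signof p * (\<Prod>i = 0..<k. f i (p i) v)) differentiable (at u)"
    by (intro differentiable_sum differentiable_mult finite_permutations ballI) auto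
  ultimately show ?thesis by simp
qed

lemma differentiable_cofactor:
  fixes u :: complex
  assumes "\<And>v. J v \<in> carrier_mat n n" and "i < n" "j < n"
    and "\<And>i j. i < n \<Longrightarrow> j < n \<Longrightarrow> (\<lambda>v. J v $$ (i, j) :: complex) differentiable (at u)"
  shows "(\<lambda>v. adj_mat (J v) $$ (i, j)) differentiable (at u)"
proof -
  \<comment> \<open>The adjugate is transposed: row \<open>j\<close> and column \<open>i\<close> are
    deleted.\<close>
  have "adj_mat (J v) $$ (i, j) = (-1) ^ (j + i) * Determinant.det (Matrix.mat (n - 1) (n - 1)
      (\<lambda>(i', j'). J v $$ (if i' < j then i' else Suc i', if j' < i then j' else Suc j')))" for v
    using assms(1)[of v] assms(2,3) by (auto simp: adj_mat_def cofactor_def mat_delete_def)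
  moreover have "(\<lambda>v. (-1) ^ (j + i) * Determinant.det (Matrix.mat (n - 1) (n - 1)
      (\<lambda>(i', j'). J v $$ (if i' < j then i' else Suc i', if j' < i then j' else Suc j')))) differentiable (at u)"
    by (intro differentiable_mult differentiable_det) (auto intro!: assms(4))
  ultimately show ?thesis by simp
qed

lemma smooth_on_differentiable:
  assumes "smooth_on W f" "u \<in> W"
  shows "f differentiable (at u)" "deriv_z f differentiable (at u)"
proof -
  have "Ck_on (Suc (Suc 0)) W f" using assms(1) unfolding smooth_on_def by blast
  then have *: "f differentiable (at u)" "deriv_x f differentiable (at u)" "deriv_y f differentiable (at u)"
    using assms(2) by auto
  show "f differentiable (at u)" by (rule *(1))
  have "(\<lambda>v. (deriv_x f v - \<i> * deriv_y f v) * (1 / 2)) differentiable (at u)"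
    using * by (intro differentiable_mult differentiable_diff) auto
  then show "deriv_z f differentiable (at u)" by (simp add: deriv_z_def[abs_def])
qed

lemma differentiable_cong_open:
  assumes "f differentiable (at u)" "open W" "u \<in> W" "\<And>v. v \<in> W \<Longrightarrow> f v = g v"
  shows "g differentiable (at u)"
  using assms has_derivative_transform_within_open[of f _ u UNIV W g] unfolding differentiable_def by blast

section \<open>Solutions of the Hitchin equation in a chart\<close>

lemma fm_higgs:
  "fm n (higgs_field n t q c p) = higgs n (of_real t * q c p)"
  by (intro ext) (auto simp: fm_def higgs_def higgs_field_def)

lemma metric_adjoint_carrier:
  assumes "J \<in> carrier_mat n n" "Determinant.det J = 1" "M \<in> carrier_mat n n"
  shows "metric_adjoint J M \<in> carrier_mat n n"
    and "J * metric_adjoint J M = mat_adjoint M * J"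
    and "metric_adjoint J M = adj_mat J * mat_adjoint M * J"
proof -
  note inv = mat_inverse_det_one[OF assms(1,2)]
  note c = mat_adjoint_carrier[OF assms(3)]
  show eq: "metric_adjoint J M = adj_mat J * mat_adjoint M * J" by (simp add: metric_adjoint_def inv(1))
  show "metric_adjoint J M \<in> carrier_mat n n" unfolding eq using inv(4) c assms(1) by auto
  have "J * (adj_mat J * mat_adjoint M * J) = J * (adj_mat J * (mat_adjoint M * J))"
    using assoc_mult_mat[OF inv(4) c assms(1)] by simp
  also have "\<dots> = (J * adj_mat J) * (mat_adjoint M * J)"
    using assoc_mult_mat[OF assms(1) inv(4) mult_carrier_mat[OF c assms(1)]] by simp
  also have "\<dots> = mat_adjoint M * J"
    unfolding inv(2) by (rule left_mult_one_mat) (use c assms(1) in auto)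
  finally show "J * metric_adjoint J M = mat_adjoint M * J" unfolding eq .
qed

text \<open>The data seen by a single chart; transported to the coordinate domain they form a
  \<open>local_hitchin\<close>.\<close>

locale hitchin_chart =
  fixes n :: nat and t :: real and q :: "'a::t2_space chart \<Rightarrow> 'a \<Rightarrow> complex"
    and h :: "'a chart \<Rightarrow> 'a \<Rightarrow> complex mat" and c :: "'a chart"
  assumes chart: "is_chart c"
    and q_hol: "(\<lambda>u. q c (chart_inv c u)) holomorphic_on coord c ` chart_dom c"
    and posdef: "p \<in> chart_dom c \<Longrightarrow> pos_def_hermitian n (h c p)"
    and smooth: "i < n \<Longrightarrow> j < n \<Longrightarrow>
      smooth_on (coord c ` chart_dom c) (\<lambda>u. h c (chart_inv c u) $$ (i, j))"
    and det_one: "p \<in> chart_dom c \<Longrightarrow> Determinant.det (h c p) = 1"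
    and hitchin: "p \<in> chart_dom c \<Longrightarrow>
      chern_curvature n h c p + higgs_commutator (higgs_field n t q) h c p = 0\<^sub>m n n"
begin

abbreviation W :: "complex set" where
  "W \<equiv> coord c ` chart_dom c"

abbreviation J :: "complex \<Rightarrow> complex mat" where
  "J u \<equiv> h c (chart_inv c u)"

definition \<alpha> :: "complex \<Rightarrow> complex" where
  "\<alpha> u = of_real t * q c (chart_inv c u)"

definition \<phi> :: "complex \<Rightarrow> fmat" where
  "\<phi> u = higgs n (\<alpha> u)"

definition H :: "complex \<Rightarrow> fmat" where
  "H u = fm n (J u)"

definition B :: "complex \<Rightarrow> fmat" where
  "B u = fm n (adj_mat (J u))"

definition A :: "complex \<Rightarrow> fmat" where
  "A u = fm n (chern_connection_form n J u)"

definition P :: "complex \<Rightarrow> fmat" where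
  "P u = fm n (metric_adjoint (J u) (higgs_field n t q c (chart_inv c u)))"

lemma open_W: "open W"
  using chart by (simp add: is_chart_def)

lemma chart_inv_mem: "u \<in> W \<Longrightarrow> chart_inv c u \<in> chart_dom c"
  unfolding chart_inv_def by (rule inv_into_into)

lemma coord_chart_inv: "u \<in> W \<Longrightarrow> coord c (chart_inv c u) = u"
  unfolding chart_inv_def by (rule f_inv_into_f)

lemma chart_inv_coord: "p \<in> chart_dom c \<Longrightarrow> chart_inv c (coord c p) = p"
  using chart by (simp add: is_chart_def homeomorphism_def)

lemma J_carrier: "u \<in> W \<Longrightarrow> J u \<in> carrier_mat n n"
  using posdef[OF chart_inv_mem] by (simp add: pos_def_hermitian_def)

lemma J_det: "u \<in> W \<Longrightarrow> Determinant.det (J u) = 1"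
  using det_one[OF chart_inv_mem] .

lemma higgs_carrier: "higgs_field n t q c p \<in> carrier_mat n n"
  by (simp add: higgs_field_def)

lemma \<phi>_fm: "\<phi> u = fm n (higgs_field n t q c (chart_inv c u))"
  by (simp add: \<phi>_def \<alpha>_def fm_higgs)

lemma \<alpha>_holomorphic: "\<alpha> holomorphic_on W"
  unfolding \<alpha>_def[abs_def] by (intro holomorphic_intros q_hol)

lemma B_H:
  assumes "u \<in> W"
  shows "mm n (H u) (B u) = one n"
  unfolding H_def B_def using mat_inverse_det_one[OF J_carrier J_det] J_carrier assms
  by (simp add: fm_mult[symmetric] fm_one)

lemma connection_carrier:
  assumes "u \<in> W"
  shows "chern_connection_form n J u \<in> carrier_mat n n"
    and "A u = mm n (B u) (fm n (mat_deriv_z n J u))"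
proof -
  note inv = mat_inverse_det_one[OF J_carrier[OF assms] J_det[OF assms]]
  have d: "mat_deriv_z n J u \<in> carrier_mat n n" by (simp add: mat_deriv_z_def)
  have eq: "chern_connection_form n J u = adj_mat (J u) * mat_deriv_z n J u"
    by (simp add: chern_connection_form_def inv(1))
  show "chern_connection_form n J u \<in> carrier_mat n n" unfolding eq using inv(4) d by auto
  show "A u = mm n (B u) (fm n (mat_deriv_z n J u))"
    unfolding A_def eq B_def by (rule fm_mult[OF inv(4) d])
qed

lemma H_differentiable:
  assumes "u \<in> W" "i < n" "j < n"
  shows "(\<lambda>v. H v i j) differentiable (at u)"
    and "(\<lambda>v. fm n (mat_deriv_z n J v) i j) differentiable (at u)"
  using smooth_on_differentiable[OF smooth[OF assms(2,3)] assms(1)] assms(2,3)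
  by (simp_all add: H_def fm_def mat_deriv_z_def)

lemma B_differentiable:
  assumes "u \<in> W" "i < n" "j < n"
  shows "(\<lambda>v. B v i j) differentiable (at u)"
proof -
  \<comment> \<open>Off the chart image \<open>J v\<close> need not have dimension \<open>n\<close>;
    \<open>J'\<close> does everywhere and agrees with \<open>J\<close> on the image.\<close>
  define J' where "J' v = Matrix.mat n n (\<lambda>(i, j). H v i j)" for v
  have d: "(\<lambda>v. adj_mat (J' v) $$ (i, j)) differentiable (at u)"
    by (rule differentiable_cofactor) (use assms H_differentiable in \<open>auto simp: J'_def\<close>)
  have eq: "J' v = J v" if "v \<in> W" for v
    using J_carrier[OF that] by (intro eq_matI) (auto simp: J'_def H_def fm_def)
  have "(\<lambda>v. adj_mat (J v) $$ (i, j)) differentiable (at u)"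
    by (rule differentiable_cong_open[OF d open_W assms(1)]) (simp only: eq)
  then show ?thesis using assms by (simp add: B_def fm_def)
qed

lemma mm_differentiable:
  assumes "i < n" "j < n"
    and "\<And>i j. i < n \<Longrightarrow> j < n \<Longrightarrow> (\<lambda>v. M v i j) differentiable (at u)"
    and "\<And>i j. i < n \<Longrightarrow> j < n \<Longrightarrow> (\<lambda>v. N v i j) differentiable (at u)"
  shows "(\<lambda>v. mm n (M v) (N v) i j) differentiable (at u)"
  using assms by (auto simp: mm_def intro!: differentiable_sum differentiable_mult)

lemma A_differentiable:
  assumes "u \<in> W" "i < n" "j < n"
  shows "(\<lambda>v. A v i j) differentiable (at u)"
proof (rule differentiable_cong_open[OF _ open_W assms(1)])
  show "(\<lambda>v. mm n (B v) (fm n (mat_deriv_z n J v)) i j) differentiable (at u)"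
    by (rule mm_differentiable) (use assms B_differentiable H_differentiable in auto)
  show "mm n (B v) (fm n (mat_deriv_z n J v)) i j = A v i j" if "v \<in> W" for v
    using connection_carrier(2)[OF that] by simp
qed

lemma \<phi>_differentiable:
  assumes "u \<in> W" "i < n" "j < n"
  shows "(\<lambda>v. \<phi> v i j) differentiable (at u)"
proof -
  have "\<alpha> differentiable (at u)"
    using has_wirt_deriv(1)[OF has_wirt_holomorphic[OF \<alpha>_holomorphic open_W assms(1)]] .
  then have "(\<lambda>v. if P then 1 else if Q then \<alpha> v else 0) differentiable (at u)" for P Q
    by (cases P; cases Q) auto
  then show ?thesis using assms by (simp add: \<phi>_def higgs_def)
qed

lemma P_eq:
  assumes "u \<in> W"
  shows "P u = mm n (mm n (B u) (adj (\<phi> u))) (H u)"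
proof -
  note inv = mat_inverse_det_one[OF J_carrier[OF assms] J_det[OF assms]]
  note c = mat_adjoint_carrier[OF higgs_carrier]
  show ?thesis
    unfolding P_def metric_adjoint_carrier(3)[OF J_carrier[OF assms] J_det[OF assms] higgs_carrier]
      fm_mult[OF mult_carrier_mat[OF inv(4) c] J_carrier[OF assms]] fm_mult[OF inv(4) c]
      fm_adjoint[OF higgs_carrier] B_def H_def \<phi>_fm ..
qed

lemma P_differentiable:
  assumes "u \<in> W" "i < n" "j < n"
  shows "(\<lambda>v. P v i j) differentiable (at u)"
proof (rule differentiable_cong_open[OF _ open_W assms(1)])
  have "(\<lambda>v. adj (\<phi> v) i j) differentiable (at u)" if "i < n" "j < n" for i j
    using has_wirt_deriv(1)[OF has_wirt_cnj[OF differentiable_has_wirt[OF \<phi>_differentiable[OF assms(1) that(2,1)]]]]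
    by (simp add: adj_def)
  then show "(\<lambda>v. mm n (mm n (B v) (adj (\<phi> v))) (H v) i j) differentiable (at u)"
    by (intro mm_differentiable) (use assms B_differentiable H_differentiable in auto)
  show "mm n (mm n (B v) (adj (\<phi> v))) (H v) i j = P v i j" if "v \<in> W" for v
    using P_eq[OF that] by simp
qed

lemma commutator_fm:
  assumes "u \<in> W"
  shows "fm n (higgs_commutator (higgs_field n t q) h c (chart_inv c u)) = mm n (\<phi> u) (P u) - mm n (P u) (\<phi> u)"
proof -
  note m = metric_adjoint_carrier(1)[OF J_carrier[OF assms] J_det[OF assms] higgs_carrier[of "chart_inv c u"]]
  show ?thesis
    unfolding higgs_commutator_def fm_minus[OF mult_carrier_mat[OF higgs_carrier m] mult_carrier_mat[OF m higgs_carrier]]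
      fm_mult[OF higgs_carrier m] fm_mult[OF m higgs_carrier] \<phi>_fm P_def ..
qed

lemma curvature_eq:
  assumes "p \<in> chart_dom c" "i < n" "j < n"
  shows "chern_curvature n h c p $$ (i, j) = - higgs_commutator (higgs_field n t q) h c p $$ (i, j)"
proof -
  have u: "coord c p \<in> W" using assms(1) by blast
  note Jp = J_carrier[OF u] J_det[OF u]
  have m: "metric_adjoint (h c p) (higgs_field n t q c p) \<in> carrier_mat n n"
    using metric_adjoint_carrier(1)[OF Jp higgs_carrier[of p]] chart_inv_coord[OF assms(1)] by simp
  have "higgs_commutator (higgs_field n t q) h c p \<in> carrier_mat n n"
    unfolding higgs_commutator_def by (intro minus_carrier_mat mult_carrier_mat[OF m higgs_carrier])
  moreover have "(chern_curvature n h c p + higgs_commutator (higgs_field n t q) h c p) $$ (i, j) = 0\<^sub>m n n $$ (i, j)"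
    using hitchin[OF assms(1)] by simp
  ultimately show ?thesis using assms(2,3) by (simp add: eq_neg_iff_add_eq_0)
qed

sublocale local_hitchin n W \<phi> H A P
proof
  fix u
  show "open W" by (rule open_W)
  show "supported n (H u)" "supported n (P u)" by (simp_all add: H_def P_def supported_fm)
  assume u: "u \<in> W"
  show "posd n (H u)" unfolding H_def by (rule posd_fm[OF posdef[OF chart_inv_mem[OF u]]])
  show "mm n (H u) (P u) = mm n (adj (\<phi> u)) (H u)"
    unfolding P_eq[OF u] mm_assoc[symmetric] B_H[OF u]
    by (simp add: mm_assoc mm_one_left supported_mm)
  show "\<exists>a. mwirt n A a (mm n (\<phi> u) (P u) - mm n (P u) (\<phi> u)) u"
  proof -
    have "has_wirt (\<lambda>v. A v i j) (deriv_z (\<lambda>v. A v i j) u) ((mm n (\<phi> u) (P u) - mm n (P u) (\<phi> u)) i j) u"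
      if ij: "i < n" "j < n" for i j
    proof -
      have "deriv_zbar (\<lambda>v. A v i j) u = - chern_curvature n h c (chart_inv c u) $$ (i, j)"
        using ij by (simp add: chern_curvature_def mat_deriv_zbar_def A_def fm_def coord_chart_inv[OF u])
      also have "\<dots> = (mm n (\<phi> u) (P u) - mm n (P u) (\<phi> u)) i j"
        unfolding curvature_eq[OF chart_inv_mem[OF u] ij] commutator_fm[OF u, symmetric] using ij by (simp add: fm_def)
      finally show ?thesis using differentiable_has_wirt[OF A_differentiable[OF u ij]] by simp
    qed
    then show ?thesis unfolding mwirt_def by (intro exI[of _ "\<lambda>i j. deriv_z (\<lambda>v. A v i j) u"]) simp
  qed
  have HA: "mm n (H u) (A u) = fm n (mat_deriv_z n J u)"
    unfolding connection_carrier(2)[OF u] mm_assoc[symmetric] B_H[OF u] by (rule mm_one_left[OF supported_fm])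
  show "mwirt n H (mm n (H u) (A u)) (mm n (adj (A u)) (H u)) u"
    unfolding mwirt_def
  proof (intro allI impI)
    fix i j assume ij: "i < n" "j < n"
    have d: "has_wirt (\<lambda>v. H v i j) (mm n (H u) (A u) i j) (deriv_zbar (\<lambda>v. H v i j) u) u"
      if "i < n" "j < n" for i j
    proof -
      have "deriv_z (\<lambda>v. H v i j) u = mm n (H u) (A u) i j"
        unfolding HA using that by (simp add: H_def fm_def mat_deriv_z_def)
      then show ?thesis using differentiable_has_wirt[OF H_differentiable(1)[OF u that]] by simp
    qed
    have adjH: "adj (H v) = H v" if "v \<in> W" for v
      unfolding H_def using posd_adj[OF posd_fm[OF posdef[OF chart_inv_mem[OF that]]] supported_fm] .
    \<comment> \<open>Since \<open>H\<close> is Hermitian, its conjugate derivative is the adjoint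
      of its z-derivative.\<close>
    have "has_wirt (\<lambda>v. cnj (H v j i)) (cnj (deriv_zbar (\<lambda>v. H v j i) u)) (cnj (mm n (H u) (A u) j i)) u"
      by (rule has_wirt_cnj[OF d[OF ij(2,1)]])
    moreover have "cnj (H v j i) = H v i j" if "v \<in> W" for v
      using fun_cong[OF fun_cong[OF adjH[OF that]], of i j] by (simp add: adj_def)
    ultimately have "has_wirt (\<lambda>v. H v i j) (cnj (deriv_zbar (\<lambda>v. H v j i) u)) (cnj (mm n (H u) (A u) j i)) u"
      by (rule has_wirt_cong[OF _ open_W u])
    from has_wirt_unique(2)[OF d[OF ij] this]
    have "deriv_zbar (\<lambda>v. H v i j) u = adj (mm n (H u) (A u)) i j" by (simp add: adj_def)
    also have "\<dots> = mm n (adj (A u)) (H u) i j" unfolding adj_mm adjH[OF u] ..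
    finally show "has_wirt (\<lambda>v. H v i j) (mm n (H u) (A u) i j) (mm n (adj (A u)) (H u) i j) u"
      using d[OF ij] by simp
  qed
qed

end

section \<open>The maximum principle on a closed surface\<close>

lemma is_chart_facts:
  assumes "is_chart c"
  shows "open (chart_dom c)" "open (coord c ` chart_dom c)" "continuous_on (chart_dom c) (coord c)"
    and "p \<in> chart_dom c \<Longrightarrow> chart_inv c (coord c p) = p"
  using assms by (auto simp: is_chart_def homeomorphism_def)

text \<open>The set where \<open>F\<close> attains its maximum is nonempty by compactness, closed by
  continuity and open by the strong maximum principle in charts.\<close>

lemma subharmonic_constant:
  fixes A :: "'a::t2_space chart set" and F :: "'a \<Rightarrow> real"
  assumes surf: "closed_riemann_surface A"
    and lap: "\<And>c. c \<in> A \<Longrightarrow> \<exists>G L. has_lap (coord c ` chart_dom c) (\<lambda>u. F (chart_inv c u)) G L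
      \<and> (\<forall>u\<in>coord c ` chart_dom c. L u \<ge> 0)"
  shows "F p = F p'"
proof -
  have conn: "connected (UNIV :: 'a set)" and cpt: "compact (UNIV :: 'a set)"
    and cover: "(\<Union>c\<in>A. chart_dom c) = UNIV" and ch: "\<And>c. c \<in> A \<Longrightarrow> is_chart c"
    using surf by (simp_all add: closed_riemann_surface_def riemann_surface_def)
  have "continuous_on (chart_dom c) F" if c: "c \<in> A" for c
  proof -
    note f = is_chart_facts[OF ch[OF c]]
    obtain G L where "has_lap (coord c ` chart_dom c) (\<lambda>u. F (chart_inv c u)) G L" using lap[OF c] by blast
    from continuous_on_compose2[OF has_lap_continuous_on[OF this] f(3)]
    have "continuous_on (chart_dom c) (\<lambda>x. F (chart_inv c (coord c x)))" by simp
    then show ?thesis by (rule continuous_on_eq) (simp add: f(4))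
  qed
  then have cont: "continuous_on UNIV F"
    unfolding cover[symmetric] using is_chart_facts(1)[OF ch] by (rule continuous_on_open_UN[rotated])
  obtain p0 where p0: "\<And>p. F p \<le> F p0"
    using continuous_attains_sup[OF cpt _ cont] by auto
  define Z where "Z = {p. F p = F p0}"
  have clo: "closed Z" unfolding Z_def
    using continuous_closed_preimage_constant[OF cont closed_UNIV, of "F p0"] by simp
  have opn: "open Z"
  proof (subst open_subopen, intro ballI)
    fix p assume p: "p \<in> Z"
    obtain c where c: "c \<in> A" "p \<in> chart_dom c" using cover by blast
    note f = is_chart_facts[OF ch[OF c(1)]]
    from lap[OF c(1)] obtain G L where GL: "has_lap (coord c ` chart_dom c) (\<lambda>u. F (chart_inv c u)) G L"
      and "\<forall>u\<in>coord c ` chart_dom c. L u \<ge> 0" by (elim exE conjE)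
    then have nn: "\<And>u. u \<in> coord c ` chart_dom c \<Longrightarrow> L u \<ge> 0" by (elim bspec)
    have "coord c p \<in> coord c ` chart_dom c" using c(2) by (rule imageI)
    then obtain R where R: "R > 0" "ball (coord c p) R \<subseteq> coord c ` chart_dom c"
      by (rule openE[OF f(2)])
    have const: "F (chart_inv c v) = F (chart_inv c (coord c p))" if "v \<in> ball (coord c p) (R / 2)" for v
    proof (rule subharmonic_strong_max[OF GL nn R(2) _ that])
      show "F (chart_inv c v) \<le> F (chart_inv c (coord c p))" for v
        using p0[of "chart_inv c v"] p f(4)[OF c(2)] by (simp add: Z_def)
    qed
    define T where "T = chart_dom c \<inter> coord c -` ball (coord c p) (R / 2)"
    have "open T" unfolding T_def by (rule continuous_open_preimage[OF f(3,1) open_ball])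
    moreover have "p \<in> T" using c(2) R(1) by (simp add: T_def)
    moreover have "T \<subseteq> Z"
    proof
      fix x assume "x \<in> T"
      then have "F (chart_inv c (coord c x)) = F (chart_inv c (coord c p))" "x \<in> chart_dom c"
        using const by (auto simp: T_def)
      then show "x \<in> Z" using p f(4) c(2) by (simp add: Z_def)
    qed
    ultimately show "\<exists>T. open T \<and> p \<in> T \<and> T \<subseteq> Z" by blast
  qed
  have "p0 \<in> Z" by (simp add: Z_def)
  have "openin (top_of_set UNIV) Z" "closedin (top_of_set UNIV) Z" using clo opn by simp_all
  then have "Z = {} \<or> Z = UNIV" using conn unfolding connected_clopen by blast
  with \<open>p0 \<in> Z\<close> have "Z = UNIV" by blast
  then have "p \<in> Z" "p' \<in> Z" by simp_all
  then show ?thesis by (simp add: Z_def)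
qed

section \<open>Symmetries of the Hitchin equation\<close>

lemma unit_power_cnj: "cmod z = 1 \<Longrightarrow> z ^ k * cnj (z ^ k) = 1"
  by (metis complex_norm_square norm_power of_real_1 power_one)

text \<open>The matrix is symmetric about its antidiagonal. The phase at a nonzero entry (i, j) is
  z^(j - i), which is the conjugate of \<open>z\<close> below the diagonal and, as z^(n - 1) = 1,
  also at the two corner entries.\<close>

lemma sharp_higgs:
  assumes z: "cmod z = 1" "z ^ (n - 1) = 1" and n: "n \<ge> 3"
  shows "sharp n z (higgs n a) = smul (cnj z) (higgs n a)"
proof (intro ext)
  fix i j
  show "sharp n z (higgs n a) i j = smul (cnj z) (higgs n a) i j"
  proof (cases "i < n \<and> j < n")
    case True
    have sym: "higgs n a (n - 1 - j) (n - 1 - i) = higgs n a i j"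
    proof -
      have e: "(n - 1 - j = n - 1 - i + 1) = (i = j + 1)" "(n - 1 - j = 0) = (j = n - 1)"
        "(n - 1 - i = n - 2) = (i = 1)" "(n - 1 - j = 1) = (j = n - 2)" "(n - 1 - i = n - 1) = (i = 0)"
        "n - 1 - j < n" "n - 1 - i < n" using True n by linarith+
      have "higgs n a (n - 1 - j) (n - 1 - i) = (if i = j + 1 then 1 else if j = n - 1 \<and> i = 1 \<or> j = n - 2 \<and> i = 0 then a else 0)"
        unfolding higgs_def prod.inject e using n by auto
      moreover have "higgs n a i j = (if i = j + 1 then 1 else if i = 0 \<and> j = n - 2 \<or> i = 1 \<and> j = n - 1 then a else 0)"
        unfolding higgs_def prod.inject using True by simp
      ultimately show ?thesis by argo
    qed
    consider "i = j + 1" | "i = 0" "j = n - 2" | "i = 1" "j = n - 1" | "higgs n a i j = 0"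
      unfolding higgs_def by (metis prod.inject)
    then have "higgs n a i j = 0 \<or> cnj (z ^ i) * z ^ j = cnj z"
    proof cases
      case 1
      have "cnj (z ^ (j + 1)) * z ^ j = cnj z * (z ^ j * cnj (z ^ j))"
        by (simp add: mult.commute mult.left_commute)
      then show ?thesis unfolding 1 unit_power_cnj[OF z(1)] by simp
    next
      case 2
      have zz: "cnj z * z = 1" using unit_power_cnj[OF z(1), of 1] by (simp add: mult.commute)
      have "n - 1 = Suc (n - 2)" using n by simp
      then have "z * z ^ (n - 2) = 1" using z(2) by (simp only: power_Suc)
      then have "cnj z = cnj z * (z * z ^ (n - 2))" by simp
      also have "\<dots> = z ^ (n - 2)" by (simp only: mult.assoc[symmetric] zz mult_1_left)
      finally show ?thesis using 2 by simp
    next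
      case 3
      then show ?thesis using z(2) by simp
    qed auto
    moreover have "sharp n z (higgs n a) i j = cnj (z ^ i) * z ^ j * higgs n a i j"
      unfolding sharp_def sym using True by (simp only: if_True simp_thms)
    ultimately show ?thesis unfolding smul_def by auto
  next
    case False
    then show ?thesis unfolding sharp_def smul_def higgs_def by (simp only: if_False mult_zero_right)
  qed
qed

definition comparison ::
  "nat \<Rightarrow> complex \<Rightarrow> ('a chart \<Rightarrow> 'a \<Rightarrow> complex mat) \<Rightarrow> 'a chart \<Rightarrow> 'a \<Rightarrow> real" where
  "comparison n z h c p = Re (tr n (mm n (sharp n z (fm n (h c p))) (fm n (h c p))))"

text \<open>Indices \<open>i\<close> and \<open>n - 1 - i\<close> have opposite weights, so the
  transition factors of the two metrics cancel in the trace.\<close>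

lemma comparison_chart_independent:
  assumes met: "hermitian_metric A S n h" and c: "c \<in> A" "p \<in> chart_dom c" and d: "d \<in> A" "p \<in> chart_dom d"
    and n: "n \<ge> 2"
  shows "comparison n z h d p = comparison n z h c p"
proof -
  define T where "T i = S c d p powi summand_weight n i" for i
  have tr: "h d p $$ (i, j) = cnj (T i) * h c p $$ (i, j) * T j" if "i < n" "j < n" for i j
    using met c d that unfolding hermitian_metric_def T_def by blast
  have "pos_def_hermitian n (h d p)" using met d unfolding hermitian_metric_def by blast
  from posd_diag(1)[OF posd_fm[OF this], of 0] n have "h d p $$ (0, 0) \<noteq> 0" by (auto simp: fm_def)
  then have "T 0 \<noteq> 0" using tr[of 0 0] n by auto
  \<comment> \<open>The weight of index 0 is positive, so a vanishing transition function would give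
    a vanishing diagonal entry.\<close>
  then have S0: "S c d p \<noteq> 0"
    using n power_int_0_left[of "int n - 1"] by (auto simp: T_def summand_weight_def)
  have T1: "T (n - 1 - i) * T i = 1" if "i < n" for i
  proof -
    have "summand_weight n (n - 1 - i) = - summand_weight n i"
      using that by (simp add: summand_weight_def)
    then show ?thesis unfolding T_def using S0 by (simp add: power_int_minus)
  qed
  have "(\<Sum>k<n. sharp n z (fm n (h d p)) i k * fm n (h d p) k i)
      = (\<Sum>k<n. sharp n z (fm n (h c p)) i k * fm n (h c p) k i)" if i: "i < n" for i
  proof (intro sum.cong refl)
    fix k assume "k \<in> {..<n}"
    then have k: "k < n" by simp
    have "n - 1 - k < n" "n - 1 - i < n" using i k by auto
    then have "h d p $$ (n - 1 - k, n - 1 - i) * h d p $$ (k, i)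
      = cnj (T (n - 1 - k) * T k) * (T (n - 1 - i) * T i) * (h c p $$ (n - 1 - k, n - 1 - i) * h c p $$ (k, i))"
      using i k by (simp add: tr)
    also have "\<dots> = h c p $$ (n - 1 - k, n - 1 - i) * h c p $$ (k, i)" unfolding T1[OF i] T1[OF k] by simp
    finally show "sharp n z (fm n (h d p)) i k * fm n (h d p) k i = sharp n z (fm n (h c p)) i k * fm n (h c p) k i"
      using i k by (simp add: sharp_def fm_def mult.assoc)
  qed
  then show ?thesis unfolding comparison_def tr_def mm_def by simp
qed

lemma hitchin_chart_intro:
  assumes "riemann_surface A" "c \<in> A" "holomorphic_differential A m q"
    and "hermitian_metric A S n h" "induces_trivial_det_metric A h"
    and "hitchin_equation A n (higgs_field n t q) h"
  shows "hitchin_chart n t q h c"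
proof
  show "is_chart c" using assms(1,2) by (simp add: riemann_surface_def)
  show "(\<lambda>u. q c (chart_inv c u)) holomorphic_on coord c ` chart_dom c"
    using assms(2,3) by (simp add: holomorphic_differential_def)
  show "smooth_on (coord c ` chart_dom c) (\<lambda>u. h c (chart_inv c u) $$ (i, j))" if "i < n" "j < n" for i j
    using assms(2,4) that by (simp add: hermitian_metric_def)
  fix p assume p: "p \<in> chart_dom c"
  show "pos_def_hermitian n (h c p)" using assms(2,4) p by (simp add: hermitian_metric_def)
  show "Determinant.det (h c p) = 1" using assms(2,5) p by (simp add: induces_trivial_det_metric_def)
  show "chern_curvature n h c p + higgs_commutator (higgs_field n t q) h c p = 0\<^sub>m n n"
    using assms(2,6) p by (simp add: hitchin_equation_def)
qed

context local_hitchin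
begin

definition asym_A :: "complex \<Rightarrow> complex \<Rightarrow> fmat" where
  "asym_A z u = A u + sharp n z (A u)"

definition asym_P :: "complex \<Rightarrow> complex \<Rightarrow> fmat" where
  "asym_P z u = P u - smul (cnj z) (sharp n z (P u))"

text \<open>The squared norm of the endomorphism \<open>M\<close> measured by \<open>H\<close> and
  its dual metric.\<close>

definition square :: "complex \<Rightarrow> complex \<Rightarrow> fmat \<Rightarrow> real" where
  "square z u M = Re (tr n (mm n (sharp n z (H u)) (mm n (adj M) (mm n (H u) M))))"

lemma square_nonneg: "cmod z = 1 \<Longrightarrow> u \<in> W \<Longrightarrow> square z u M \<ge> 0"
  unfolding square_def by (intro posd_trace(1) posd_sharp posd_H supported_sharp)

lemma square_eq_0: "cmod z = 1 \<Longrightarrow> u \<in> W \<Longrightarrow> square z u M = 0 \<Longrightarrow> i < n \<Longrightarrow> j < n \<Longrightarrow> M i j = 0"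
  unfolding square_def by (rule posd_trace(2)[OF posd_sharp[OF posd_H] supported_sharp posd_H])

lemma comparison_lap:
  assumes "cmod z = 1" "\<And>u. u \<in> W \<Longrightarrow> sharp n z (\<phi> u) = smul (cnj z) (\<phi> u)"
  shows "\<exists>G. has_lap W (\<lambda>u. Re (tr n (mm n (sharp n z (H u)) (H u)))) G
     (\<lambda>u. square z u (asym_A z u) + square z u (asym_P z u))"
  using bochner[OF assms] unfolding square_def asym_A_def asym_P_def by blast

end

text \<open>The comparison of \<open>h\<close> with its image under a symmetry is subharmonic, hence constant on the closed
  surface, so both squares in the Bochner formula vanish.\<close>

lemma symmetric_connection:
  fixes A :: "'a::t2_space chart set"
  assumes surf: "closed_riemann_surface A" and q: "holomorphic_differential A m q"
    and met: "hermitian_metric A S n h" and det: "induces_trivial_det_metric A h"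
    and eq: "hitchin_equation A n (higgs_field n t q) h" and n: "n \<ge> 3"
    and z: "cmod z = 1" "z ^ (n - 1) = 1"
    and c: "c \<in> A" and u: "u \<in> coord c ` chart_dom c" and ij: "i < n" "j < n"
  shows "hitchin_chart.A n h c u i j = - sharp n z (hitchin_chart.A n h c u) i j"
    and "hitchin_chart.P n t q h c u i j = cnj z * sharp n z (hitchin_chart.P n t q h c u) i j"
proof -
  have rs: "riemann_surface A" using surf by (simp add: closed_riemann_surface_def)
  \<comment> \<open>One chart is chosen at each point, to make the comparison a function on the
    surface.\<close>
  define cf where "cf p = (SOME c. c \<in> A \<and> p \<in> chart_dom c)" for p
  have cf: "cf p \<in> A \<and> p \<in> chart_dom (cf p)" for p
  proof -
    have "p \<in> (\<Union>c\<in>A. chart_dom c)" using rs by (simp add: riemann_surface_def)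
    then have "\<exists>c. c \<in> A \<and> p \<in> chart_dom c" by blast
    then show ?thesis unfolding cf_def by (rule someI_ex)
  qed
  define F where "F p = comparison n z h (cf p) p" for p
  have Fc: "F p = comparison n z h d p" if "d \<in> A" "p \<in> chart_dom d" for d p
    unfolding F_def using n
    by (intro comparison_chart_independent[OF met that conjunct1[OF cf] conjunct2[OF cf]]) simp
  have lap: "\<exists>G. has_lap (coord d ` chart_dom d) (\<lambda>u. F (chart_inv d u)) G
     (\<lambda>u. local_hitchin.square n (hitchin_chart.H n h d) z u (local_hitchin.asym_A n (hitchin_chart.A n h d) z u)
        + local_hitchin.square n (hitchin_chart.H n h d) z u (local_hitchin.asym_P n (hitchin_chart.P n t q h d) z u))"
    if d: "d \<in> A" for d
  proof -
    interpret X: hitchin_chart n t q h d by (rule hitchin_chart_intro[OF rs d q met det eq])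
    have sh: "sharp n z (X.\<phi> u) = smul (cnj z) (X.\<phi> u)" for u
      unfolding X.\<phi>_def by (rule sharp_higgs[OF z n])
    obtain G where G: "has_lap X.W (\<lambda>u. Re (tr n (mm n (sharp n z (X.H u)) (X.H u)))) G
       (\<lambda>u. X.square z u (X.asym_A z u) + X.square z u (X.asym_P z u))"
      using X.comparison_lap[OF z(1) sh] by blast
    have Feq: "Re (tr n (mm n (sharp n z (X.H u)) (X.H u))) = F (chart_inv d u)" if "u \<in> X.W" for u
      using Fc[OF d X.chart_inv_mem[OF that]] by (simp add: comparison_def X.H_def)
    show ?thesis by (rule exI, rule has_lap_cong[OF G X.open_W Feq])
  qed
  have const: "F p = F p'" for p p'
  proof (rule subharmonic_constant[OF surf])
    fix d assume d: "d \<in> A"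
    interpret X: hitchin_chart n t q h d by (rule hitchin_chart_intro[OF rs d q met det eq])
    show "\<exists>G L. has_lap (coord d ` chart_dom d) (\<lambda>u. F (chart_inv d u)) G L \<and> (\<forall>u\<in>coord d ` chart_dom d. 0 \<le> L u)"
    proof -
      obtain G where "has_lap X.W (\<lambda>u. F (chart_inv d u)) G
          (\<lambda>u. X.square z u (X.asym_A z u) + X.square z u (X.asym_P z u))" using lap[OF d] by (elim exE)
      moreover have "\<forall>u\<in>X.W. 0 \<le> X.square z u (X.asym_A z u) + X.square z u (X.asym_P z u)"
        by (intro ballI add_nonneg_nonneg X.square_nonneg z(1))
      ultimately show ?thesis by (intro exI conjI)
    qed
  qed
  interpret X: hitchin_chart n t q h c by (rule hitchin_chart_intro[OF rs c q met det eq])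
  obtain G where G: "has_lap X.W (\<lambda>u. F (chart_inv c u)) G
      (\<lambda>u. X.square z u (X.asym_A z u) + X.square z u (X.asym_P z u))" using lap[OF c] by (elim exE)
  \<comment> \<open>Every point is a maximum of a constant function, so the sum of the two squares
    is at most 0.\<close>
  have "X.square z u (X.asym_A z u) + X.square z u (X.asym_P z u) \<le> 0"
    by (rule has_lap_local_max[OF G X.open_W u], rule eq_refl, rule const)
  then have "X.square z u (X.asym_A z u) = 0" "X.square z u (X.asym_P z u) = 0"
    using X.square_nonneg[OF z(1) u, of "X.asym_A z u"] X.square_nonneg[OF z(1) u, of "X.asym_P z u"] by linarith+
  from this[THEN X.square_eq_0[OF z(1) u _ ij]]
  have "X.A u i j + sharp n z (X.A u) i j = 0" "X.P u i j - cnj z * sharp n z (X.P u) i j = 0"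
    by (simp_all add: X.asym_A_def X.asym_P_def smul_def)
  then show "X.A u i j = - sharp n z (X.A u) i j" "X.P u i j = cnj z * sharp n z (X.P u) i j"
    by (simp_all add: eq_neg_iff_add_eq_0)
qed

section \<open>Consequences of the symmetries for the connection and the adjoint\<close>

lemma mod_eq_cases:
  fixes i j m :: nat
  assumes "i mod m = j mod m" "i \<le> m" "j \<le> m" "m > 0"
  shows "i = j \<or> (i = 0 \<and> j = m) \<or> (i = m \<and> j = 0)"
proof (cases "i = m"; cases "j = m")
  assume "i = m" "j \<noteq> m"
  then have "j mod m = j" using assms by simp
  with assms(1) \<open>i = m\<close> show ?thesis by simp
next
  assume "i \<noteq> m" "j = m"
  then have "i mod m = i" using assms by simp
  with assms(1) \<open>j = m\<close> show ?thesis by simp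
next
  assume "i \<noteq> m" "j \<noteq> m"
  then have "i mod m = i" "j mod m = j" using assms by simp_all
  with assms(1) show ?thesis by simp
qed simp

lemma root_of_unity:
  assumes "m \<ge> 1"
  obtains z :: complex where "cmod z = 1" "z ^ m = 1" "\<And>i j. z ^ i = z ^ j \<Longrightarrow> i mod m = j mod m"
proof -
  define z :: complex where "z = exp (2 * of_real pi * \<i> * of_nat 1 / of_nat m)"
  have p: "z ^ k = exp (2 * of_real pi * \<i> * of_nat k / of_nat m)" for k
    unfolding z_def exp_of_nat_mult[symmetric] by (simp add: ac_simps)
  have "cmod z = 1" unfolding z_def by (simp add: norm_exp_eq_Re)
  moreover have "z ^ m = 1" unfolding p using complex_root_unity_eq_1[OF assms, of m] by simp
  moreover have "i mod m = j mod m" if "z ^ i = z ^ j" for i j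
    using that unfolding p complex_root_unity_eq[OF assms] .
  ultimately show ?thesis using that by blast
qed

text \<open>By the Hitchin equation the entry is the conjugate derivative of an entry of
  \<open>A\<close> that vanishes on an open set.\<close>

lemma (in toda) commutator_off:
  assumes u: "u \<in> W" and ij: "i < n" "j < n" "i \<noteq> j"
  shows "(mm n (\<phi> u) (P u) - mm n (P u) (\<phi> u)) i j = 0"
proof -
  obtain a where a: "mwirt n A a (mm n (\<phi> u) (P u) - mm n (P u) (\<phi> u)) u" using dA[OF u] by (elim exE)
  have "has_wirt (\<lambda>v. A v i j) (a i j) ((mm n (\<phi> u) (P u) - mm n (P u) (\<phi> u)) i j) u"
    using a ij unfolding mwirt_def by blast
  moreover have "has_wirt (\<lambda>v. A v i j) 0 0 u"
    by (rule has_wirt_cong[OF has_wirt_const[of 0] open_W u]) (simp add: A_off[OF _ ij])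
  ultimately show ?thesis by (rule has_wirt_unique(2))
qed

text \<open>The case z = 1 is pure duality. Combined with the case of a primitive root \<zeta> of
  order n - 1, it multiplies the entries (i, j) of \<open>A\<close> and \<open>P\<close> by
  \<zeta>^(j - i) and \<zeta>^(j - i - 1), so an entry survives only if its exponent is divisible by
  n - 1.\<close>

lemma (in hitchin_chart) toda_restrict:
  assumes n3: "n \<ge> 3" and W': "open W'" "W' \<subseteq> W" and nz: "\<And>u. u \<in> W' \<Longrightarrow> \<alpha> u \<noteq> 0"
    and symA: "\<And>z u i j. cmod z = 1 \<Longrightarrow> z ^ (n - 1) = 1 \<Longrightarrow> u \<in> W \<Longrightarrow> i < n \<Longrightarrow> j < n \<Longrightarrow>
      A u i j = - sharp n z (A u) i j"
    and symP: "\<And>z u i j. cmod z = 1 \<Longrightarrow> z ^ (n - 1) = 1 \<Longrightarrow> u \<in> W \<Longrightarrow> i < n \<Longrightarrow> j < n \<Longrightarrow>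
      P u i j = cnj z * sharp n z (P u) i j"
  shows "toda n W' \<phi> H A P \<alpha>"
proof -
  define m where "m = n - 1"
  have m: "m \<ge> 2" "n = m + 1" using n3 by (auto simp: m_def)
  obtain \<zeta> :: complex where z: "cmod \<zeta> = 1" "\<zeta> ^ m = 1" "\<And>i j. \<zeta> ^ i = \<zeta> ^ j \<Longrightarrow> i mod m = j mod m"
    using root_of_unity[of m] m(1) by (metis one_le_numeral order_trans)
  have W: "u \<in> W" if "u \<in> W'" for u using that W'(2) by (rule rev_subsetD)
  have unit: "\<zeta> ^ j = \<zeta> ^ k" if "cnj (\<zeta> ^ k) * \<zeta> ^ j = 1" for j k
  proof -
    have "\<zeta> ^ k = \<zeta> ^ k * (cnj (\<zeta> ^ k) * \<zeta> ^ j)" using that by simp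
    also have "\<dots> = (\<zeta> ^ k * cnj (\<zeta> ^ k)) * \<zeta> ^ j" by (simp only: mult.assoc)
    finally show ?thesis unfolding unit_power_cnj[OF z(1)] by simp
  qed
  have A1: "A u i j = - A u (n - 1 - j) (n - 1 - i)" if "u \<in> W" "i < n" "j < n" for u i j
    using symA[of 1, OF _ _ that] that by (simp add: sharp_def)
  have P1: "P u i j = P u (n - 1 - j) (n - 1 - i)" if "u \<in> W" "i < n" "j < n" for u i j
    using symP[of 1, OF _ _ that] that by (simp add: sharp_def)
  have A2: "A u i j = 0" if u: "u \<in> W" and ij: "i < n" "j < n" "i \<noteq> j" for u i j
  proof (rule ccontr)
    assume nz: "A u i j \<noteq> 0"
    have "A u i j = - (cnj (\<zeta> ^ i) * \<zeta> ^ j * A u (n - 1 - j) (n - 1 - i))"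
      using symA[OF z(1) z(2)[unfolded m_def] u ij(1,2)] ij unfolding sharp_def by (simp only: if_True simp_thms)
    moreover have "A u (n - 1 - j) (n - 1 - i) = - A u i j" using A1[OF u ij(1,2)] by simp
    ultimately have "A u i j = cnj (\<zeta> ^ i) * \<zeta> ^ j * A u i j" by (simp only: mult_minus_right minus_minus)
    then have "cnj (\<zeta> ^ i) * \<zeta> ^ j = 1" using nz by (metis mult_cancel_right2)
    from z(3)[OF unit[OF this]] have "j mod m = i mod m" .
    from mod_eq_cases[OF this] have "i = 0 \<and> j = m \<or> i = m \<and> j = 0" using ij m by auto
    \<comment> \<open>The two corners are fixed by the reflection, and duality makes these entries
      their own negatives.\<close>
    then have "n - 1 - j = i \<and> n - 1 - i = j" using m(2) by auto
    then have "A u i j = - A u i j" using A1[OF u ij(1,2)] by simp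
    with nz show False by simp
  qed
  have P2: "j = i + 1 \<or> (i = n - 2 \<and> j = 0) \<or> (i = n - 1 \<and> j = 1)"
    if u: "u \<in> W" and ij: "i < n" "j < n" and nz: "P u i j \<noteq> 0" for u i j
  proof -
    have "P u i j = cnj \<zeta> * (cnj (\<zeta> ^ i) * \<zeta> ^ j * P u (n - 1 - j) (n - 1 - i))"
      using symP[OF z(1) z(2)[unfolded m_def] u ij(1,2)] ij unfolding sharp_def by (simp only: if_True simp_thms)
    also have "\<dots> = cnj (\<zeta> ^ (i + 1)) * \<zeta> ^ j * P u i j"
      unfolding P1[OF u ij, symmetric] by simp
    finally have "cnj (\<zeta> ^ (i + 1)) * \<zeta> ^ j = 1" using nz by (metis mult_cancel_right2)
    from z(3)[OF unit[OF this]] have mod: "j mod m = (i + 1) mod m" .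
    show ?thesis
    proof (cases "i = m")
      case True
      then have "j mod m = 1 mod m" using mod mod_add_self1[of m 1] by (simp only:)
      from mod_eq_cases[OF this] show ?thesis using True ij m by auto
    next
      case False
      from mod_eq_cases[OF mod] show ?thesis using False ij m by auto
    qed
  qed
  have P3: "\<exists>a b. mwirt n P a b u" if "u \<in> W" for u
    unfolding mwirt_def
    by (rule exI[of _ "\<lambda>i j. deriv_z (\<lambda>v. P v i j) u"], rule exI[of _ "\<lambda>i j. deriv_zbar (\<lambda>v. P v i j) u"])
      (intro allI impI differentiable_has_wirt P_differentiable that)
  show ?thesis
  proof
    fix u
    show "open W'" by (rule W'(1))
    show "supported n (H u)" "supported n (P u)" by (rule supp_H supp_P)+
    show "n \<ge> 3" by (rule n3)
    show "\<alpha> holomorphic_on W'" by (rule holomorphic_on_subset[OF \<alpha>_holomorphic W'(2)])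
    show "\<phi> u = higgs n (\<alpha> u)" by (rule \<phi>_def)
    assume u': "u \<in> W'"
    note u = W[OF u']
    show "posd n (H u)" by (rule posd_H[OF u])
    show "mm n (H u) (P u) = mm n (adj (\<phi> u)) (H u)" by (rule HP[OF u])
    show "mwirt n H (mm n (H u) (A u)) (mm n (adj (A u)) (H u)) u" by (rule dH[OF u])
    show "\<exists>a. mwirt n A a (mm n (\<phi> u) (P u) - mm n (P u) (\<phi> u)) u" by (rule dA[OF u])
    show "\<alpha> u \<noteq> 0" by (rule nz[OF u'])
    show "\<exists>a b. mwirt n P a b u" by (rule P3[OF u])
    fix i j assume ij: "i < n" "j < n"
    show "A u i j = 0" if "i \<noteq> j" by (rule A2[OF u ij that])
    show "j = i + 1 \<or> (i = n - 2 \<and> j = 0) \<or> (i = n - 1 \<and> j = 1)" if "P u i j \<noteq> 0" by (rule P2[OF u ij that])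
    show "P u i j = P u (n - 1 - j) (n - 1 - i)" by (rule P1[OF u ij])
  qed
qed

section \<open>From the local estimate to uniform convergence\<close>

text \<open>\<open>ell\<close> decreases in |q|: the lower bound \<open>q1\<close> on the ball
  bounds it from above, as the choice of \<open>E\<close> requires, while the upper bound
  \<open>q2\<close> at \<open>p\<close> bounds it from below, for dividing it out. The resulting
  bound depends on the point only through these constants.\<close>

lemma pointwise_decay:
  fixes A :: "'a::t2_space chart set" and E R a q1 q2 :: real
  assumes surf: "closed_riemann_surface A" and q: "holomorphic_differential A m' q"
    and met: "hermitian_metric A S n h" and det: "induces_trivial_det_metric A h"
    and eq: "hitchin_equation A n (higgs_field n t q) h" and n: "n \<ge> 3" and t: "t > 0"
    and c: "c \<in> A" and p: "p \<in> chart_dom c" and R: "R > 0"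
    and W': "open W'" "W' \<subseteq> coord c ` chart_dom c" "\<And>u. u \<in> W' \<Longrightarrow> q c (chart_inv c u) \<noteq> 0"
    and sub: "cball (coord c p) (2 * R) \<subseteq> W'"
    and q1: "q1 > 0" "\<And>u. u \<in> cball (coord c p) (2 * R) \<Longrightarrow> q1 \<le> cmod (q c (chart_inv c u))"
    and q2: "cmod (q c p) \<le> q2"
    and E: "E > 0" "8 * real (n - 1) ^ 4 * exp (- 2 / real (n - 1) * ln (2 * t * q1)) * E \<le> 1"
    and a: "a > 0" "a\<^sup>2 * R\<^sup>2 + a \<le> E" and ij: "i < n" "j < n"
  defines "K \<equiv> 6 / (E * R\<^sup>2)"
  shows "(cmod (higgs_commutator (higgs_field n t q) h c p $$ (i, j)))\<^sup>2
    \<le> 4 * ((1 + sqrt (K + (n - 1)))\<^sup>2 * (K * exp (- a * R\<^sup>2))) / (exp (- 2 / real (n - 1) * ln (2 * t * q2)))\<^sup>2"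
    (is "?l \<le> ?N / ?d\<^sup>2")
proof -
  have rs: "riemann_surface A" using surf by (simp add: closed_riemann_surface_def)
  interpret X: hitchin_chart n t q h c by (rule hitchin_chart_intro[OF rs c q met det eq])
  interpret Y: toda n W' X.\<phi> X.H X.A X.P X.\<alpha>
  proof (rule X.toda_restrict[OF n W'(1,2)])
    show "X.\<alpha> u \<noteq> 0" if "u \<in> W'" for u using W'(3)[OF that] t by (simp add: X.\<alpha>_def)
  qed (rule symmetric_connection[OF surf q met det eq n _ _ c]; assumption)+
  define u where "u = coord c p"
  have uW: "u \<in> W'" using sub R by (auto simp: u_def)
  have inv: "chart_inv c u = p" unfolding u_def by (rule X.chart_inv_coord[OF p])
  have uX: "u \<in> X.W" using uW W'(2) by (rule rev_subsetD)
  have K: "K \<ge> 0" using E(1) by (simp add: K_def)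
  have ell: "Y.ell v = exp (- 2 / real (n - 1) * ln (2 * t * cmod (q c (chart_inv c v))))" for v
    using t by (simp add: Y.ell_def X.\<alpha>_def norm_mult mult.assoc)
  have entry: "higgs_commutator (higgs_field n t q) h c p $$ (i, j)
      = (mm n (X.\<phi> u) (X.P u) - mm n (X.P u) (X.\<phi> u)) i j"
    using fun_cong[OF fun_cong[OF X.commutator_fm[OF uX], of i], of j] ij unfolding inv by (simp add: fm_def)
  have dec: "(Y.ell u * Y.D i u)\<^sup>2 \<le> ?N" unfolding K_def
  proof (rule Y.commutator_decay[OF _ R _ E(1) a ij(1)])
    show "cball u (2 * R) \<subseteq> W'" using sub by (simp add: u_def)
    fix v assume v: "v \<in> cball u (2 * R)"
    have "Y.ell v \<le> exp (- 2 / real (n - 1) * ln (2 * t * q1))"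
    proof -
      have "ln (2 * t * q1) \<le> ln (2 * t * cmod (q c (chart_inv c v)))"
        using q1(1) q1(2)[OF v[unfolded u_def]] t by (intro ln_mono mult_left_mono) auto
      then show ?thesis unfolding ell using n by (simp add: divide_right_mono mult_left_mono)
    qed
    then have "8 * real (n - 1) ^ 4 * Y.ell v * E \<le> 8 * real (n - 1) ^ 4 * exp (- 2 / real (n - 1) * ln (2 * t * q1)) * E"
      using E(1) by (intro mult_left_mono mult_right_mono) auto
    then show "8 * real (n - 1) ^ 4 * Y.ell v * E \<le> 1" using E(2) by simp
  qed
  have d: "?d \<le> Y.ell u"
  proof -
    have "cmod (q c p) > 0" using W'(3)[OF uW] unfolding inv by simp
    then have "ln (2 * t * cmod (q c p)) \<le> ln (2 * t * q2)"
      using q2 t by (intro ln_mono mult_left_mono) auto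
    then show ?thesis unfolding ell inv using n by (simp add: divide_right_mono mult_left_mono)
  qed
  have "(Y.D i u)\<^sup>2 \<le> ?N / ?d\<^sup>2"
  proof -
    have "?d\<^sup>2 * (Y.D i u)\<^sup>2 \<le> (Y.ell u)\<^sup>2 * (Y.D i u)\<^sup>2"
      using d by (intro mult_right_mono power_mono) auto
    also have "\<dots> \<le> ?N" using dec by (simp add: power_mult_distrib)
    finally show ?thesis by (simp add: pos_le_divide_eq mult.commute)
  qed
  moreover have "?N / ?d\<^sup>2 \<ge> 0" using K by (intro divide_nonneg_nonneg mult_nonneg_nonneg) auto
  ultimately show ?thesis
    unfolding entry using Y.commutator_diag[OF uW ij(1)] Y.commutator_off[OF uW ij]
    by (cases "i = j") simp_all
qed

lemma decay_rate_tendsto: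
  assumes "m \<ge> 1" "b > 0"
  shows "((\<lambda>t. C * exp (- b * exp (1 / real m * ln t)) * exp (1 / real m * ln t) ^ 4) \<longlongrightarrow> 0) at_top"
proof -
  have c: "1 / real m > 0" using assms by simp
  have "((\<lambda>s. C * exp (- b * s) * s ^ 4) \<longlongrightarrow> 0) at_top"
    using assms(2) by real_asymp
  moreover have "filterlim (\<lambda>t. exp (1 / real m * ln t)) at_top at_top"
    using c by real_asymp
  ultimately show ?thesis by (rule filterlim_compose)
qed

theorem corollary6p11:
  fixes A :: "'a::t2_space chart set"
    and S :: "'a chart \<Rightarrow> 'a chart \<Rightarrow> 'a \<Rightarrow> complex"
    and g n :: nat
    and q :: "'a chart \<Rightarrow> 'a \<Rightarrow> complex"
    and h :: "real \<Rightarrow> 'a chart \<Rightarrow> 'a \<Rightarrow> complex mat"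
  assumes "closed_riemann_surface A"
    and "has_genus (euclidean :: 'a topology) g" and "g \<ge> 2"
    and "canonical_square_root A S"
    and "n \<ge> 3"
    and "holomorphic_differential A (n - 1) q"
    and "\<exists>c\<in>A. \<exists>p \<in> chart_dom c. q c p \<noteq> 0"
    and "\<And>t. t > 0 \<Longrightarrow> hermitian_metric A S n (h t)"
    and "\<And>t. t > 0 \<Longrightarrow> induces_trivial_det_metric A (h t)"
    and "\<And>t. t > 0 \<Longrightarrow> hitchin_equation A n (higgs_field n t q) (h t)"
  shows "forms_tend_to_zero_on A n (- differential_zeros A q) (\<lambda>t. chern_curvature n (h t)) \<and>
         forms_tend_to_zero_on A n (- differential_zeros A q)
           (\<lambda>t. higgs_commutator (higgs_field n t q) (h t))"
proof -
  note surf = assms(1) and n = assms(5) and q = assms(6)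
  note sol = assms(8,9,10)
  have rs: "riemann_surface A" using surf by (simp add: closed_riemann_surface_def)
  have comm: "uniform_limit C (\<lambda>t p. higgs_commutator (higgs_field n t q) (h t) c p $$ (i, j)) (\<lambda>p. 0) at_top"
    if c: "c \<in> A" and C: "compact C" "C \<subseteq> chart_dom c \<inter> - differential_zeros A q" and ij: "i < n" "j < n" for c C i j
  proof (cases "C = {}")
    case True
    then show ?thesis by (simp add: uniform_limit_iff)
  next
    case False
    have ch: "is_chart c" using rs c by (simp add: riemann_surface_def)
    note f = is_chart_facts[OF ch]
    define Q where "Q u = q c (chart_inv c u)" for u
    have Qhol: "Q holomorphic_on coord c ` chart_dom c"
      using q c unfolding Q_def[abs_def] holomorphic_differential_def by simp
    define W' where "W' = coord c ` chart_dom c \<inter> Q -` (- {0})"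
    have W'_open: "open W'" unfolding W'_def
      by (rule continuous_open_preimage[OF holomorphic_on_imp_continuous_on[OF Qhol] f(2)]) auto
    have W'_sub: "W' \<subseteq> coord c ` chart_dom c" by (simp add: W'_def)
    have W'_nz: "Q u \<noteq> 0" if "u \<in> W'" for u using that by (simp add: W'_def)
    have Cdom: "p \<in> chart_dom c" "q c p \<noteq> 0" if "p \<in> C" for p
      using C(2) that c by (auto simp: differential_zeros_def)
    define K where "K = coord c ` C"
    have K: "compact K" unfolding K_def
      by (rule compact_continuous_image[OF continuous_on_subset[OF f(3)] C(1)]) (use Cdom in auto)
    have KW: "K \<subseteq> W'"
    proof
      fix u assume "u \<in> K"
      then obtain p where p: "p \<in> C" "u = coord c p" by (auto simp: K_def)
      then show "u \<in> W'" using Cdom[OF p(1)] f(4) by (simp add: W'_def Q_def)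
    qed
    obtain e where e: "e > 0" "(\<Union>x\<in>K. cball x e) \<subseteq> W'"
      by (rule compact_subset_open_imp_cball_epsilon_subset[OF K W'_open KW])
    define R where "R = e / 2"
    have R: "R > 0" "2 * R = e" using e(1) by (simp_all add: R_def)
    \<comment> \<open>A compact thickening of \<open>K\<close> off the zeros of \<open>q\<close>;
      the extrema of |q| on it give constants valid for all points of \<open>C\<close> at
      once.\<close>
    define K' where "K' = (\<Union>x\<in>K. \<Union>y\<in>cball 0 e. {x + y})"
    have K'_compact: "compact K'" unfolding K'_def by (rule compact_sums'[OF K compact_cball])
    have K'_eq: "K' = (\<Union>x\<in>K. cball x e)"
    proof -
      have "(\<Union>y\<in>cball 0 e. {x + y}) = cball x e" for x :: complex
        using image_add_cball[of x 0 e] by (simp add: UNION_singleton_eq_range)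
      then show ?thesis by (simp only: K'_def)
    qed
    have K'_sub: "cball u e \<subseteq> K'" if "u \<in> K" for u using that unfolding K'_eq by blast
    have K'_W: "K' \<subseteq> W'" unfolding K'_eq by (rule e(2))
    have "K \<noteq> {}" using False by (simp add: K_def)
    then have "K' \<noteq> {}" using e(1) by (auto simp: K'_eq)
    moreover have "continuous_on K' (\<lambda>u. cmod (Q u))"
      by (intro continuous_on_norm continuous_on_subset[OF holomorphic_on_imp_continuous_on[OF Qhol]])
        (rule order_trans[OF K'_W W'_sub])
    ultimately obtain u1 u2 where u1: "u1 \<in> K'" "\<And>u. u \<in> K' \<Longrightarrow> cmod (Q u1) \<le> cmod (Q u)"
      and u2: "u2 \<in> K'" "\<And>u. u \<in> K' \<Longrightarrow> cmod (Q u) \<le> cmod (Q u2)"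
      using continuous_attains_inf[OF K'_compact] continuous_attains_sup[OF K'_compact] by metis
    define q1 where "q1 = cmod (Q u1)"
    define q2 where "q2 = cmod (Q u2)"
    have q1: "q1 > 0" using W'_nz K'_W u1(1) by (auto simp: q1_def)
    have q2: "q2 > 0" using W'_nz K'_W u2(1) by (auto simp: q2_def)
    define m where "m = n - 1"
    have m: "m \<ge> 1" using n by (simp add: m_def)
    \<comment> \<open>This is t to the power 1 / (n - 1), the common growth scale:
      \<open>ell\<close> behaves like 1 / s^2, and the decay exponent is proportional to
      \<open>s\<close>.\<close>
    define s where "s t = exp (1 / real m * ln t)" for t
    define k1 where "k1 = exp (- 2 / real m * ln (2 * q1))"
    define k2 where "k2 = exp (- 2 / real m * ln (2 * q2))"
    have scale: "exp (- 2 / real m * ln (2 * t * r)) = exp (- 2 / real m * ln (2 * r)) / (s t)\<^sup>2"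
      if "t > 0" "r > 0" for t r
    proof -
      have "2 * t * r = t * (2 * r)" by simp
      then have "ln (2 * t * r) = ln t + ln (2 * r)" using that by (simp only: ln_mult_pos)
      then have "- 2 / real m * ln (2 * t * r) = - 2 / real m * ln (2 * r) - 2 * (1 / real m * ln t)"
        by (simp add: algebra_simps add_divide_distrib)
      then show ?thesis unfolding s_def exp_double[symmetric] exp_diff[symmetric] by simp
    qed
    \<comment> \<open>With E = E1 s^2 the condition of \<open>pointwise_decay\<close> on
      \<open>E\<close> holds with equality.\<close>
    define E1 where "E1 = 1 / (8 * real m ^ 4 * k1)"
    have E1: "E1 > 0" using m by (simp add: E1_def k1_def)
    \<comment> \<open>Chosen for a = b s: as \<open>s\<close> is at least 1 and \<open>b\<close> at
      most 1, a^2 R^2 + a is at most b (R^2 + 1) s^2, hence at most \<open>E\<close>.\<close>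
    define b where "b = min 1 (E1 / (R\<^sup>2 + 1))"
    have b: "b > 0" "b \<le> 1" "b * (R\<^sup>2 + 1) \<le> E1"
    proof -
      have p: "R\<^sup>2 + 1 > 0" by (smt (verit) zero_le_power2)
      show "b > 0" using E1 p by (simp add: b_def)
      show "b \<le> 1" by (simp add: b_def)
      have "b \<le> E1 / (R\<^sup>2 + 1)" unfolding b_def by (rule min.cobounded2)
      then show "b * (R\<^sup>2 + 1) \<le> E1" using p by (simp add: pos_le_divide_eq)
    qed
    define K1 where "K1 = 6 / (E1 * R\<^sup>2)"
    define C1 where "C1 = 4 * ((1 + sqrt (K1 + m))\<^sup>2 * K1) / k2\<^sup>2"
    \<comment> \<open>The factor s^4 comes from dividing by the square of k2 / s^2, the lower bound
      for \<open>ell\<close>.\<close>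
    define B where "B t = C1 * exp (- (b * R\<^sup>2) * s t) * s t ^ 4" for t
    have bound: "(cmod (higgs_commutator (higgs_field n t q) (h t) c p $$ (i, j)))\<^sup>2 \<le> B t"
      if t: "t \<ge> 1" and p: "p \<in> C" for t p
    proof -
      have t0: "t > 0" using t by simp
      have s1: "s t \<ge> 1" using t m by (simp add: s_def)
      define E where "E = E1 * (s t)\<^sup>2"
      have E: "E > 0" using E1 s1 by (simp add: E_def)
      have EE: "E \<ge> E1" unfolding E_def using E1 s1 by simp
      have uK: "coord c p \<in> K" unfolding K_def by (rule imageI[OF p])
      have inv: "chart_inv c (coord c p) = p" by (rule f(4)[OF Cdom(1)[OF p]])
      define KE where "KE = 6 / (E * R\<^sup>2)"
      have KE: "KE \<ge> 0" "KE \<le> K1"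
        using E E1 EE R(1) by (auto simp: KE_def K1_def intro!: divide_left_mono mult_right_mono)
      have "(cmod (higgs_commutator (higgs_field n t q) (h t) c p $$ (i, j)))\<^sup>2
        \<le> 4 * ((1 + sqrt (6 / (E * R\<^sup>2) + (n - 1)))\<^sup>2 * (6 / (E * R\<^sup>2) * exp (- (b * s t) * R\<^sup>2)))
          / (exp (- 2 / real (n - 1) * ln (2 * t * q2)))\<^sup>2"
      proof (rule pointwise_decay[OF surf q sol(1)[OF t0] sol(2)[OF t0] sol(3)[OF t0] n t0 c Cdom(1)[OF p] R(1)
            W'_open W'_sub _ _ q1 _ _ E _ _ _ ij])
        show "q c (chart_inv c u) \<noteq> 0" if "u \<in> W'" for u using W'_nz[OF that] by (simp add: Q_def)
        show "cball (coord c p) (2 * R) \<subseteq> W'" unfolding R(2) by (rule order_trans[OF K'_sub[OF uK] K'_W])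
        show "q1 \<le> cmod (q c (chart_inv c u))" if "u \<in> cball (coord c p) (2 * R)" for u
          using u1(2)[of u] K'_sub[OF uK] that unfolding R(2) by (auto simp: q1_def Q_def)
        have "coord c p \<in> K'" using K'_sub[OF uK] e(1) by auto
        from u2(2)[OF this] show "cmod (q c p) \<le> q2" by (simp add: q2_def Q_def inv)
        have "8 * real m ^ 4 * (k1 / (s t)\<^sup>2) * E = 1"
          using s1 m by (simp add: E_def E1_def k1_def)
        then show "8 * real (n - 1) ^ 4 * exp (- 2 / real (n - 1) * ln (2 * t * q1)) * E \<le> 1"
          using scale[OF t0 q1] by (simp add: k1_def m_def)
        show "b * s t > 0" using b(1) s1 by simp
        have "(b * s t)\<^sup>2 * R\<^sup>2 + b * s t \<le> (b * (s t)\<^sup>2) * R\<^sup>2 + b * (s t)\<^sup>2"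
        proof (rule add_mono)
          have "b * b \<le> b * 1" using b by (intro mult_left_mono) auto
          then have "b\<^sup>2 * ((s t)\<^sup>2 * R\<^sup>2) \<le> b * ((s t)\<^sup>2 * R\<^sup>2)"
            by (intro mult_right_mono) (auto simp: power2_eq_square)
          then show "(b * s t)\<^sup>2 * R\<^sup>2 \<le> b * (s t)\<^sup>2 * R\<^sup>2" by (simp add: power_mult_distrib mult.assoc)
          show "b * s t \<le> b * (s t)\<^sup>2" using b s1 by (simp add: power2_eq_square)
        qed
        also have "\<dots> = b * (R\<^sup>2 + 1) * (s t)\<^sup>2" by (simp add: algebra_simps)
        also have "\<dots> \<le> E1 * (s t)\<^sup>2" using b(3) by (intro mult_right_mono) auto
        finally show "(b * s t)\<^sup>2 * R\<^sup>2 + b * s t \<le> E" by (simp only: E_def)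
      qed
      also have "exp (- 2 / real (n - 1) * ln (2 * t * q2)) = k2 / (s t)\<^sup>2"
        using scale[OF t0 q2] by (simp add: k2_def m_def)
      also have "4 * ((1 + sqrt (6 / (E * R\<^sup>2) + (n - 1)))\<^sup>2 * (6 / (E * R\<^sup>2) * exp (- (b * s t) * R\<^sup>2))) / (k2 / (s t)\<^sup>2)\<^sup>2
          \<le> 4 * ((1 + sqrt (K1 + m))\<^sup>2 * (K1 * exp (- (b * s t) * R\<^sup>2))) / (k2 / (s t)\<^sup>2)\<^sup>2"
        unfolding KE_def[symmetric] m_def[symmetric] using KE
        by (intro divide_right_mono mult_left_mono mult_mono power_mono add_left_mono real_sqrt_le_mono add_right_mono) auto
      also have "\<dots> = B t"
        using s1 by (simp add: B_def C1_def power_divide mult.assoc mult.commute mult.left_commute flip: power_mult)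
      finally show ?thesis .
    qed
    have lim: "(B \<longlongrightarrow> 0) at_top"
      unfolding B_def[abs_def] s_def using m b(1) R(1) by (intro decay_rate_tendsto) auto
    show ?thesis unfolding uniform_limit_iff
    proof (intro allI impI)
      fix \<epsilon> :: real assume \<epsilon>: "\<epsilon> > 0"
      have "eventually (\<lambda>t. B t < \<epsilon>\<^sup>2) at_top"
        using order_tendstoD(2)[OF lim, of "\<epsilon>\<^sup>2"] \<epsilon> by simp
      then show "\<forall>\<^sub>F t in at_top. \<forall>p\<in>C. dist (higgs_commutator (higgs_field n t q) (h t) c p $$ (i, j)) 0 < \<epsilon>"
        using eventually_ge_at_top[of 1]
      proof eventually_elim
        case (elim t)
        show ?case
        proof
          fix p assume "p \<in> C"
          from bound[OF elim(2) this] elim(1)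
          have "(cmod (higgs_commutator (higgs_field n t q) (h t) c p $$ (i, j)))\<^sup>2 < \<epsilon>\<^sup>2" by (rule le_less_trans)
          then show "dist (higgs_commutator (higgs_field n t q) (h t) c p $$ (i, j)) 0 < \<epsilon>"
            unfolding dist_0_norm dist_norm using \<epsilon> by (simp add: power_less_imp_less_base)
        qed
      qed
    qed
  qed
  moreover have "uniform_limit C (\<lambda>t p. chern_curvature n (h t) c p $$ (i, j)) (\<lambda>p. 0) at_top"
    if c: "c \<in> A" and C: "compact C" "C \<subseteq> chart_dom c \<inter> - differential_zeros A q" and ij: "i < n" "j < n" for c C i j
  proof -
    \<comment> \<open>By the Hitchin equation, available for positive \<open>t\<close>, the
      curvature is the negative of the commutator, so its limit follows from that of
      \<open>comm\<close>.\<close>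
    have "\<forall>\<^sub>F t in at_top. \<forall>p\<in>C. - higgs_commutator (higgs_field n t q) (h t) c p $$ (i, j)
        = chern_curvature n (h t) c p $$ (i, j)"
      using eventually_gt_at_top[of "0::real"]
    proof eventually_elim
      case (elim t)
      interpret X: hitchin_chart n t q "h t" c
        by (rule hitchin_chart_intro[OF rs c q sol(1)[OF elim] sol(2)[OF elim] sol(3)[OF elim]])
      show ?case using X.curvature_eq ij C(2) by auto
    qed
    from uniform_limit_cong[OF this, of "\<lambda>p. - 0" "\<lambda>p. 0"] uniform_limit_uminus[OF comm[OF that]]
    show ?thesis by simp
  qed
  ultimately show ?thesis unfolding forms_tend_to_zero_on_def by blast
qed

end
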